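(* Let $n\ge1$, $\alpha\in(0,1]$, $g\in L^1(\mathbb{R}^n,d\gamma)$, and let $\{f_k\,d\gamma\}_{k\ge 1}$ be a sequence of centered probability measures on $\mathbb{R}^n$ with $\sqrt{f_k}\in W^{1,2}(\mathbb{R}^n,d\gamma)$ and $\alpha\le f_k\le g$ for all $k$. If $\delta(f_k)\to 0$ as $k\to\infty$, then $f_k\to 1$ in $L^1(d\gamma)$.
   Context: On $\mathbb{R}^n$, $d\gamma=(2\pi)^{-n/2}e^{-|x|^2/2}dx$ is the standard Gaussian measure. For a probability measure $f\,d\gamma$ with $\sqrt f\in W^{1,2}(\mathbb{R}^n,d\gamma)$, the Fisher information is $\mathrm{I}(f)=\int \frac{|\nabla f|^2}{f}\,d\gamma$, the relative entropy is $\mathrm{H}(f)=\int f\log f\,d\gamma$, and the log-Sobolev deficit is $\delta(f)=\frac12 \mathrm{I}(f)-\mathrm{H}(f)\ge 0$. A probability measure $\mu$ is centered if $\int x\,d\mu=0$. *)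

theory Defs
  imports "HOL-Probability.Probability"
begin

definition gauss :: "'a::euclidean_space measure" where
  "gauss = density lborel
     (\<lambda>x. ennreal ((2 * pi) powr (- real DIM('a) / 2) * exp (- (norm x)\<^sup>2 / 2)))"

primrec C_k :: "nat \<Rightarrow> ('a::euclidean_space \<Rightarrow> real) \<Rightarrow> bool" where
  "C_k 0 \<phi> \<longleftrightarrow> continuous_on UNIV \<phi>"
| "C_k (Suc m) \<phi> \<longleftrightarrow> \<phi> differentiable_on UNIV \<and>
     (\<forall>b\<in>Basis. C_k m (\<lambda>x. frechet_derivative \<phi> (at x) b))"

definition test_function :: "('a::euclidean_space \<Rightarrow> real) \<Rightarrow> bool" where
  "test_function \<phi> \<longleftrightarrow> (\<forall>m. C_k m \<phi>) \<and> compact (closure {x. \<phi> x \<noteq> 0})"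

definition locally_integrable :: "('a::euclidean_space \<Rightarrow> 'b::euclidean_space) \<Rightarrow> bool" where
  "locally_integrable u \<longleftrightarrow> (\<forall>K. compact K \<longrightarrow> set_integrable lborel K u)"

definition has_weak_gradient ::
    "('a::euclidean_space \<Rightarrow> real) \<Rightarrow> ('a \<Rightarrow> 'a) \<Rightarrow> bool" where
  "has_weak_gradient u G \<longleftrightarrow> locally_integrable u \<and> locally_integrable G \<and>
     (\<forall>\<phi>. test_function \<phi> \<longrightarrow> (\<forall>b\<in>Basis.
        (LINT x|lborel. u x * frechet_derivative \<phi> (at x) b)
          = - (LINT x|lborel. (G x \<bullet> b) * \<phi> x)))"

text \<open>A weak gradient is unique up to Lebesgue null sets, so the choice below does not
  affect integrals.\<close>

definition weak_gradient :: "('a::euclidean_space \<Rightarrow> real) \<Rightarrow> 'a \<Rightarrow> 'a" where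
  "weak_gradient u = (SOME G. has_weak_gradient u G)"

text \<open>Distributional derivatives are taken with respect to Lebesgue measure; only the
  integrability of the function and of its gradient is measured by the Gaussian.\<close>

definition W12_gauss :: "('a::euclidean_space \<Rightarrow> real) set" where
  "W12_gauss = {u. u \<in> borel_measurable borel \<and> integrable gauss (\<lambda>x. (u x)\<^sup>2) \<and>
     (\<exists>G. has_weak_gradient u G \<and> G \<in> borel_measurable borel \<and>
          integrable gauss (\<lambda>x. (norm (G x))\<^sup>2))}"

text \<open>For a probability density \<open>f\<close> whose square root lies in \<^const>\<open>W12_gauss\<close>, the function
  \<open>f\<close> is weakly differentiable with gradient \<open>2 \<surd>f \<nabla>\<surd>f\<close>, so the Fisher information is finite,
  and the relative entropy is finite by the logarithmic Sobolev inequality. Hence the Bochner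
  integrals below take their genuine values on this class.\<close>

definition fisher_information :: "('a::euclidean_space \<Rightarrow> real) \<Rightarrow> real" where
  "fisher_information f = (LINT x|gauss. (norm (weak_gradient f x))\<^sup>2 / f x)"

definition relative_entropy :: "('a::euclidean_space \<Rightarrow> real) \<Rightarrow> real" where
  "relative_entropy f = (LINT x|gauss. f x * ln (f x))"

definition deficit :: "('a::euclidean_space \<Rightarrow> real) \<Rightarrow> real" where
  "deficit f = fisher_information f / 2 - relative_entropy f"

text \<open>Integrability is demanded explicitly because a Bochner integral that does not exist
  equals \<open>0\<close>.\<close>

definition centered :: "'a::euclidean_space measure \<Rightarrow> bool" where
  "centered \<mu> \<longleftrightarrow> integrable \<mu> (\<lambda>x. x) \<and> (LINT x|\<mu>. x) = 0"

end

theory Submission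
  imports Defs
begin

text \<open>
  Let \<open>f \<ge> \<alpha>\<close> be a density with respect to the standard Gaussian \<open>\<gamma>\<close> and \<open>h = ln f\<close>. Write a Gaussian
  point as \<open>z = x + y\<close> with \<open>x, y\<close> independent and both of variance \<open>1/2\<close>, and let \<open>f'\<close> be the average
  of \<open>f\<close> over \<open>y\<close>. The chain rule splits the entropy of \<open>f\<close> into the mean over \<open>x\<close> of the entropies of
  \<open>y \<mapsto> f (x + y)\<close> and the entropy of \<open>f'\<close>. The logarithmic Sobolev inequality bounds each of the two
  parts, but the second one by the Fisher information of \<open>f'\<close>, which is smaller than that of \<open>f\<close> by
  exactly the conditional variance of \<open>\<nabla>h\<close>. What is lost in this way is at most the deficit:
  \<open>E\<^sub>x E\<^sub>y f (x + y) |\<nabla>h (x + y) - m x|\<^sup>2 \<le> 4 \<delta>(f)\<close> with \<open>m = \<nabla>f' / f'\<close>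
  (\<open>deficit_controls_gradient_fluctuation\<close>).

  Since \<open>f \<ge> \<alpha>\<close>, there is a point \<open>x\<close> in a fixed ball for which \<open>\<nabla>h (x + y)\<close> is \<open>L\<^sup>2\<close>-close to the
  constant \<open>b = m x\<close>, and by the Poincare inequality \<open>h (x + y)\<close> is \<open>L\<^sup>2\<close>-close to an affine function of
  \<open>y\<close> with slope \<open>b\<close> (\<open>small_deficit_log_almost_affine\<close>). Along a sequence with vanishing deficit the
  slopes tend to \<open>0\<close>, because the functions \<open>ln f\<^sub>k \<ge> ln \<alpha>\<close> are bounded below and a nonconstant affine
  function is not (\<open>slopes_vanish\<close>). So \<open>f\<^sub>k\<close> approaches constants in measure; the bound \<open>f\<^sub>k \<le> g\<close> turns
  this into convergence in \<open>L\<^sup>1\<close>, and the total mass identifies the constant as \<open>1\<close>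
  (\<open>dominated_tendsto_1\<close>).

  This argument is carried out for functions with bounded Lipschitz gradient (\<open>C11\<close>), for which both
  functional inequalities are proved by cutting the Gaussian into many independent small increments:
  the chain rule adds up the entropies of the increments, and Taylor's formula computes each of them
  (\<open>entropy_le_energy\<close>). General densities are reached by approximation. If \<open>\<surd>f\<close> is in \<open>W\<^sup>1\<^sup>,\<^sup>2\<close>, then
  the chain rule \<open>\<nabla>f = 2 \<surd>f \<nabla>\<surd>f\<close> and the uniqueness of weak gradients show that the Fisher information
  of \<open>f\<close> is \<open>4 \<integral> |\<nabla>\<surd>f|\<^sup>2 d\<gamma>\<close> (\<open>fisher_information_eq\<close>). Truncating and mollifying \<open>\<surd>f\<close> approximates this
  quantity and \<open>f\<close> itself, while the entropy is lower semicontinuous. Hence every \<open>f\<^sub>k\<close> has a \<open>C11\<close>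
  approximant that is close in \<open>L\<^sup>1\<close>, is again at least \<open>\<alpha>\<close>, and whose deficit is hardly larger
  (\<open>C11_approximation\<close>).
\<close>

section \<open>Standard Gaussian measure\<close>

definition gdens :: "'a::euclidean_space \<Rightarrow> real" where
  "gdens x = (2 * pi) powr (- real DIM('a) / 2) * exp (- (norm x)\<^sup>2 / 2)"

lemma gauss_eq: "gauss = density lborel (\<lambda>x::'a::euclidean_space. ennreal (gdens x))"
  unfolding gauss_def gdens_def ..

lemma gdens_pos: "0 < gdens x"
  by (simp add: gdens_def)

lemma gdens_measurable[measurable]: "gdens \<in> borel_measurable borel"
  unfolding gdens_def by measurable

lemma sets_gauss[simp, measurable_cong]: "sets gauss = sets borel"
  by (simp add: gauss_def)

lemma space_gauss[simp]: "space gauss = UNIV"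
  by (simp add: gauss_def)

lemma gdens_prod:
  "gdens (x::'a::euclidean_space) = (\<Prod>b\<in>Basis. normal_density 0 1 (x \<bullet> b))"
proof -
  have "(\<Prod>b\<in>(Basis::'a set). normal_density 0 1 (x \<bullet> b))
      = (1 / sqrt (2 * pi)) ^ DIM('a) * exp (\<Sum>b\<in>Basis. - (x \<bullet> b)\<^sup>2 / 2)"
    by (simp add: normal_density_def prod_dividef exp_sum power_divide)
  also have "(\<Sum>b\<in>(Basis::'a set). - (x \<bullet> b)\<^sup>2 / 2) = - (norm x)\<^sup>2 / 2"
    by (simp add: sum_negf sum_divide_distrib[symmetric] norm_eq_sqrt_inner euclidean_inner[of x x]
        power2_eq_square sum_nonneg)
  also have "(1 / sqrt (2 * pi)) ^ DIM('a) = (2 * pi) powr (- real DIM('a) / 2)"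
    by (simp add: powr_half_sqrt[symmetric] powr_minus_divide[symmetric] powr_powr flip: powr_realpow)
  finally show ?thesis by (simp add: gdens_def)
qed

lemma nn_integral_gdens: "(\<integral>\<^sup>+x. ennreal (gdens (x::'a::euclidean_space)) \<partial>lborel) = 1"
proof -
  interpret prob_space "density lborel (normal_density 0 1)"
    by (rule prob_space_normal_density) simp
  have 1: "(\<integral>\<^sup>+t. ennreal (normal_density 0 1 t) \<partial>lborel) = 1"
    using emeasure_space_1 by (simp add: emeasure_density)
  have "(\<integral>\<^sup>+x. ennreal (gdens (x::'a)) \<partial>lborel)
      = (\<integral>\<^sup>+x. (\<Prod>b\<in>Basis. ennreal (normal_density 0 1 ((x::'a) \<bullet> b))) \<partial>lborel)"
    by (simp add: gdens_prod prod_ennreal)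
  also have "\<dots> = 1"
    by (subst nn_integral_lborel_prod) (simp_all add: 1)
  finally show ?thesis .
qed

lemma prob_space_gauss: "prob_space (gauss :: 'a::euclidean_space measure)"
  by (rule prob_spaceI) (simp add: gauss_eq emeasure_density nn_integral_gdens)

interpretation gauss: prob_space "gauss :: 'a::euclidean_space measure"
  by (rule prob_space_gauss)

interpretation gauss2: pair_prob_space "gauss :: 'a::euclidean_space measure" "gauss :: 'b::euclidean_space measure"
  ..

lemma AE_gauss_iff: "(AE x in gauss. P x) \<longleftrightarrow> (AE x in lborel. P (x::'a::euclidean_space))"
  unfolding gauss_eq by (subst AE_density) (auto simp: gdens_pos)

lemma nn_integral_gauss:
  "f \<in> borel_measurable borel \<Longrightarrow>
    (\<integral>\<^sup>+x. f x \<partial>gauss) = (\<integral>\<^sup>+x. ennreal (gdens x) * f (x::'a::euclidean_space) \<partial>lborel)"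
  unfolding gauss_eq by (subst nn_integral_density) auto

lemma nn_integral_lborel_affine:
  assumes [measurable]: "f \<in> borel_measurable borel" and "c \<noteq> 0"
  shows "(\<integral>\<^sup>+x. f x \<partial>lborel)
    = ennreal (\<bar>c\<bar> ^ DIM('a)) * (\<integral>\<^sup>+x. f (t + c *\<^sub>R (x::'a::euclidean_space)) \<partial>lborel)"
  by (subst lborel_affine[OF assms(2), of t])
    (simp add: nn_integral_density nn_integral_distr nn_integral_cmult)

text \<open>Completing the square: if \<open>z = c x + s y\<close> for independent standard Gaussian \<open>x\<close> and \<open>y\<close>, then \<open>z\<close> is
  standard Gaussian, and given \<open>z\<close> the point \<open>x\<close> is Gaussian with mean \<open>c z\<close> and variance \<open>s\<^sup>2\<close>.\<close>

lemma gdens_rotate: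
  assumes "c\<^sup>2 + s\<^sup>2 = 1" "s > 0"
  shows "gdens x * gdens ((z - c *\<^sub>R x) /\<^sub>R s) = gdens z * gdens ((x - c *\<^sub>R z) /\<^sub>R s)"
proof -
  have c: "c\<^sup>2 = 1 - s\<^sup>2" using assms by simp
  have n: "(norm (u - c *\<^sub>R v))\<^sup>2 = (norm u)\<^sup>2 - 2 * c * (u \<bullet> v) + (1 - s\<^sup>2) * (norm v)\<^sup>2" for u v :: 'a
    unfolding c[symmetric] power2_norm_eq_inner
    by (simp add: inner_diff_left inner_diff_right inner_commute power2_eq_square algebra_simps)
  have k: "(norm ((u - c *\<^sub>R v) /\<^sub>R s))\<^sup>2
      = ((norm u)\<^sup>2 - 2 * c * (u \<bullet> v) + (1 - s\<^sup>2) * (norm v)\<^sup>2) / s\<^sup>2" for u v :: 'a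
    using assms(2) n[of u v] by (simp add: power_mult_distrib power_divide divide_inverse power_inverse mult.commute)
  have "- (norm x)\<^sup>2 / 2 + - (norm ((z - c *\<^sub>R x) /\<^sub>R s))\<^sup>2 / 2
      = - (norm z)\<^sup>2 / 2 + - (norm ((x - c *\<^sub>R z) /\<^sub>R s))\<^sup>2 / 2"
    unfolding k using assms(2) by (simp add: field_simps inner_commute)
  then have "exp (- (norm x)\<^sup>2 / 2) * exp (- (norm ((z - c *\<^sub>R x) /\<^sub>R s))\<^sup>2 / 2)
      = exp (- (norm z)\<^sup>2 / 2) * exp (- (norm ((x - c *\<^sub>R z) /\<^sub>R s))\<^sup>2 / 2)"
    unfolding exp_add[symmetric] by (rule arg_cong)
  then show ?thesis unfolding gdens_def by algebra
qed

text \<open>Substituting \<open>z = c x + s y\<close> for \<open>y\<close> and then integrating out \<open>x\<close>. Both substitutions are dilations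
  of Lebesgue measure, so the two factors \<open>s ^ DIM('a)\<close> cancel.\<close>

lemma nn_integral_gauss_rotate:
  fixes f :: "'a::euclidean_space \<Rightarrow> ennreal"
  assumes [measurable]: "f \<in> borel_measurable borel" and cs: "c\<^sup>2 + s\<^sup>2 = 1" "s > 0"
  shows "(\<integral>\<^sup>+x. \<integral>\<^sup>+y. f (c *\<^sub>R x + s *\<^sub>R y) \<partial>gauss \<partial>gauss) = (\<integral>\<^sup>+z. f z \<partial>gauss)"
proof -
  have aff: "(\<integral>\<^sup>+y. h ((y - t) /\<^sub>R s) \<partial>lborel) = ennreal (s ^ DIM('a)) * (\<integral>\<^sup>+y. h y \<partial>lborel)"
    if [measurable]: "h \<in> borel_measurable borel" for h :: "'a \<Rightarrow> ennreal" and t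
    using cs(2) by (subst nn_integral_lborel_affine[where c=s and t=t]) auto
  have eq1: "(\<integral>\<^sup>+y. ennreal (gdens y) * f (c *\<^sub>R x + s *\<^sub>R y) \<partial>lborel) * ennreal (s ^ DIM('a))
      = (\<integral>\<^sup>+z. ennreal (gdens ((z - c *\<^sub>R x) /\<^sub>R s)) * f z \<partial>lborel)" for x
    using aff[of "\<lambda>y. ennreal (gdens y) * f (c *\<^sub>R x + s *\<^sub>R y)" "c *\<^sub>R x"] cs(2)
    by (simp add: mult.commute)
  have "(\<integral>\<^sup>+x. \<integral>\<^sup>+y. f (c *\<^sub>R x + s *\<^sub>R y) \<partial>gauss \<partial>gauss) * ennreal (s ^ DIM('a))
    = (\<integral>\<^sup>+x. ennreal (gdens x) * (\<integral>\<^sup>+y. ennreal (gdens y) * f (c *\<^sub>R x + s *\<^sub>R y) \<partial>lborel) \<partial>lborel) * ennreal (s ^ DIM('a))"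
    by (simp add: nn_integral_gauss)
  also have "\<dots> = (\<integral>\<^sup>+x. ennreal (gdens x) * (\<integral>\<^sup>+z. ennreal (gdens ((z - c *\<^sub>R x) /\<^sub>R s)) * f z \<partial>lborel) \<partial>lborel)"
    by (subst nn_integral_multc[symmetric]) (simp_all add: eq1[symmetric] mult.assoc)
  also have "\<dots> = (\<integral>\<^sup>+x. (\<integral>\<^sup>+z. ennreal (gdens x * gdens ((z - c *\<^sub>R x) /\<^sub>R s)) * f z \<partial>lborel) \<partial>lborel)"
    by (subst nn_integral_cmult[symmetric])
      (simp_all add: ennreal_mult less_imp_le[OF gdens_pos] mult.assoc)
  also have "\<dots> = (\<integral>\<^sup>+x. (\<integral>\<^sup>+z. ennreal (gdens z * gdens ((x - c *\<^sub>R z) /\<^sub>R s)) * f z \<partial>lborel) \<partial>lborel)"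
    by (simp add: gdens_rotate[OF cs])
  also have "\<dots> = (\<integral>\<^sup>+z. (\<integral>\<^sup>+x. ennreal (gdens z * gdens ((x - c *\<^sub>R z) /\<^sub>R s)) * f z \<partial>lborel) \<partial>lborel)"
    by (rule lborel_pair.Fubini') measurable
  also have "\<dots> = (\<integral>\<^sup>+z. ennreal (gdens z) * f z * (\<integral>\<^sup>+x. ennreal (gdens ((x - c *\<^sub>R z) /\<^sub>R s)) \<partial>lborel) \<partial>lborel)"
    by (subst nn_integral_cmult[symmetric])
      (simp_all add: ennreal_mult less_imp_le[OF gdens_pos] mult_ac)
  also have "\<dots> = (\<integral>\<^sup>+z. ennreal (gdens z) * f z * ennreal (s ^ DIM('a)) \<partial>lborel)"
    by (subst aff) (simp_all add: nn_integral_gdens)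
  also have "\<dots> = (\<integral>\<^sup>+z. f z \<partial>gauss) * ennreal (s ^ DIM('a))"
    by (simp add: nn_integral_gauss nn_integral_multc)
  finally have "ennreal (s ^ DIM('a)) * (\<integral>\<^sup>+x. \<integral>\<^sup>+y. f (c *\<^sub>R x + s *\<^sub>R y) \<partial>gauss \<partial>gauss)
     = ennreal (s ^ DIM('a)) * (\<integral>\<^sup>+z. f z \<partial>gauss)" by (simp add: mult.commute)
  moreover have "s ^ DIM('a) > 0" using cs(2) by simp
  ultimately show ?thesis
    by (subst (asm) ennreal_mult_cancel_left) (auto simp: ennreal_eq_0_iff not_le)
qed

lemma distr_gauss_rotate:
  assumes cs: "c\<^sup>2 + s\<^sup>2 = 1" "s > 0"
  shows "distr (gauss \<Otimes>\<^sub>M gauss) borel (\<lambda>(x, y). c *\<^sub>R x + s *\<^sub>R y) = (gauss :: 'a::euclidean_space measure)"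
proof (rule measure_eqI)
  fix A assume "A \<in> sets (distr (gauss \<Otimes>\<^sub>M gauss) borel (\<lambda>(x::'a, y). c *\<^sub>R x + s *\<^sub>R y))"
  then have [measurable]: "A \<in> sets borel" by simp
  have "emeasure (distr (gauss \<Otimes>\<^sub>M gauss) borel (\<lambda>(x, y). c *\<^sub>R x + s *\<^sub>R y)) A
     = (\<integral>\<^sup>+z. indicator A z \<partial>distr (gauss \<Otimes>\<^sub>M gauss) borel (\<lambda>(x, y). c *\<^sub>R x + s *\<^sub>R y))"
    by simp
  also have "\<dots> = (\<integral>\<^sup>+p. indicator A (c *\<^sub>R fst p + s *\<^sub>R snd p) \<partial>(gauss \<Otimes>\<^sub>M gauss))"
    by (subst nn_integral_distr) (auto simp: case_prod_beta')
  also have "\<dots> = (\<integral>\<^sup>+x. \<integral>\<^sup>+y. indicator A (c *\<^sub>R x + s *\<^sub>R y) \<partial>gauss \<partial>gauss)"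
    by (subst gauss.nn_integral_fst[symmetric]) auto
  also have "\<dots> = emeasure gauss A"
    by (subst nn_integral_gauss_rotate[OF _ cs]) auto
  finally show "emeasure (distr (gauss \<Otimes>\<^sub>M gauss) borel (\<lambda>(x, y). c *\<^sub>R x + s *\<^sub>R y)) A = emeasure gauss A" .
qed simp

lemma integral_gauss_rotate:
  fixes f :: "'a::euclidean_space \<Rightarrow> 'b::{banach, second_countable_topology}"
  assumes cs: "c\<^sup>2 + s\<^sup>2 = 1" "s > 0" and f: "integrable gauss f"
  shows "(LINT x|gauss. LINT y|gauss. f (c *\<^sub>R x + s *\<^sub>R y)) = (LINT z|gauss. f z)"
proof -
  have [measurable]: "f \<in> borel_measurable borel" using borel_measurable_integrable[OF f] by simp
  have d: "distr (gauss \<Otimes>\<^sub>M gauss) borel (\<lambda>p. c *\<^sub>R fst p + s *\<^sub>R snd p) = (gauss :: 'a measure)"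
    using distr_gauss_rotate[OF cs] by (simp add: case_prod_beta')
  have i: "integrable (gauss \<Otimes>\<^sub>M gauss) (\<lambda>p. f (c *\<^sub>R fst p + s *\<^sub>R snd p))"
  proof -
    have "integrable (distr (gauss \<Otimes>\<^sub>M gauss) borel (\<lambda>p. c *\<^sub>R fst p + s *\<^sub>R snd p)) f"
      using f by (simp only: d)
    then show ?thesis by (subst (asm) integrable_distr_eq) auto
  qed
  have "(LINT x|gauss. LINT y|gauss. f (c *\<^sub>R x + s *\<^sub>R y))
      = (LINT p|(gauss \<Otimes>\<^sub>M gauss). f (c *\<^sub>R fst p + s *\<^sub>R snd p))"
    using gauss2.integral_fst'[OF i] by simp
  also have "\<dots> = (LINT z|gauss. f z)"
  proof -
    have "(LINT z|gauss. f z)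
        = (LINT z|(distr (gauss \<Otimes>\<^sub>M gauss) borel (\<lambda>p. c *\<^sub>R fst p + s *\<^sub>R snd p)). f z)"
      by (simp only: d)
    then show ?thesis by (subst (asm) integral_distr) auto
  qed
  finally show "(LINT x|gauss. LINT y|gauss. f (c *\<^sub>R x + s *\<^sub>R y)) = (LINT z|gauss. f z)" .
qed

section \<open>Gaussian moments\<close>

lemma nn_integral_gauss_exp:
  "(\<integral>\<^sup>+y. ennreal (exp (v \<bullet> y)) \<partial>gauss) = ennreal (exp ((norm (v::'a::euclidean_space))\<^sup>2 / 2))"
proof -
  have sq: "gdens (v + y) * exp (v \<bullet> (v + y)) = exp ((norm v)\<^sup>2 / 2) * gdens y" for y
  proof -
    have "- (norm (v + y))\<^sup>2 / 2 + v \<bullet> (v + y) = (norm v)\<^sup>2 / 2 + - (norm y)\<^sup>2 / 2"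
      by (simp add: power2_norm_eq_inner inner_simps inner_commute diff_divide_distrib add_divide_distrib)
    then have "exp (- (norm (v + y))\<^sup>2 / 2) * exp (v \<bullet> (v + y)) = exp ((norm v)\<^sup>2 / 2) * exp (- (norm y)\<^sup>2 / 2)"
      unfolding exp_add[symmetric] by (rule arg_cong)
    then show ?thesis unfolding gdens_def by algebra
  qed
  have "(\<integral>\<^sup>+y. ennreal (exp (v \<bullet> y)) \<partial>gauss) = (\<integral>\<^sup>+y. ennreal (gdens y * exp (v \<bullet> y)) \<partial>lborel)"
    by (simp add: nn_integral_gauss ennreal_mult less_imp_le[OF gdens_pos])
  also have "\<dots> = (\<integral>\<^sup>+y. ennreal (gdens (v + y) * exp (v \<bullet> (v + y))) \<partial>lborel)"
    by (subst nn_integral_lborel_affine[where c=1 and t=v]) auto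
  also have "\<dots> = ennreal (exp ((norm v)\<^sup>2 / 2)) * (\<integral>\<^sup>+y. ennreal (gdens (y::'a)) \<partial>lborel)"
    unfolding sq by (subst nn_integral_cmult[symmetric]) (simp_all add: ennreal_mult less_imp_le[OF gdens_pos])
  finally show ?thesis by (simp add: nn_integral_gdens)
qed

lemma integrable_gauss_exp: "integrable gauss (\<lambda>y. exp ((v::'a::euclidean_space) \<bullet> y))"
  using nn_integral_gauss_exp[of v] by (intro integrableI_nonneg) auto

lemma integral_gauss_exp: "(LINT y|gauss. exp ((v::'a::euclidean_space) \<bullet> y)) = exp ((norm v)\<^sup>2 / 2)"
  by (rule integral_eq_nn_integral[THEN trans]) (simp_all add: nn_integral_gauss_exp)

lemma distr_gauss_uminus: "distr gauss borel uminus = (gauss :: 'a::euclidean_space measure)"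
proof (rule measure_eqI)
  fix A assume "A \<in> sets (distr gauss borel (uminus :: 'a \<Rightarrow> 'a))"
  then have [measurable]: "A \<in> sets borel" by simp
  have "emeasure (distr gauss borel (uminus :: 'a \<Rightarrow> 'a)) A
     = (\<integral>\<^sup>+z. indicator A z \<partial>distr gauss borel uminus)"
    by simp
  also have "\<dots> = (\<integral>\<^sup>+z. indicator A (- z) \<partial>gauss)"
    by (subst nn_integral_distr) auto
  also have "\<dots> = (\<integral>\<^sup>+z. ennreal (gdens z) * indicator A (- z) \<partial>lborel)"
    by (rule nn_integral_gauss) measurable
  also have "\<dots> = (\<integral>\<^sup>+z. ennreal (gdens z) * indicator A z \<partial>lborel)"
    by (subst nn_integral_lborel_affine[where c="-1" and t=0]) (auto simp: gdens_def)
  also have "\<dots> = (\<integral>\<^sup>+z. indicator A z \<partial>gauss)"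
    by (rule nn_integral_gauss[symmetric]) measurable
  also have "\<dots> = emeasure gauss A" by simp
  finally show "emeasure (distr gauss borel (uminus :: 'a \<Rightarrow> 'a)) A = emeasure gauss A" .
qed simp

lemma power_le_fact_mult_exp:
  fixes x :: real
  assumes "0 \<le> x"
  shows "x ^ k \<le> fact k * exp x"
proof -
  have "x ^ k /\<^sub>R fact k \<le> (\<Sum>n. x ^ n /\<^sub>R fact n)"
    using sum_le_suminf[OF summable_exp_generic[of x], of "{k}"] assms by simp
  then show ?thesis by (simp add: exp_def field_simps)
qed

text \<open>Some coordinate of \<open>y\<close> is comparable to \<open>norm y\<close>, and its powers are dominated by exponentials, which
  have finite Gaussian integrals.\<close>

lemma integrable_gauss_norm_power:
  "integrable gauss (\<lambda>y::'a::euclidean_space. norm y ^ k)"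
proof -
  define M where "M = (sqrt (real DIM('a))) ^ k * fact k"
  have "norm y ^ k \<le> M * (\<Sum>b\<in>Basis. exp (b \<bullet> y) + exp ((- b) \<bullet> y))" for y :: 'a
  proof -
    have "infnorm y \<in> (\<lambda>i. \<bar>y \<bullet> i\<bar>) ` Basis"
      unfolding infnorm_Max by (rule Max_in) auto
    then obtain b where b: "b \<in> Basis" "infnorm y = \<bar>y \<bullet> b\<bar>" by auto
    have "\<bar>y \<bullet> b\<bar> ^ k \<le> fact k * exp \<bar>y \<bullet> b\<bar>" by (rule power_le_fact_mult_exp) simp
    also have "exp \<bar>y \<bullet> b\<bar> \<le> exp (b \<bullet> y) + exp ((- b) \<bullet> y)"
      by (cases "y \<bullet> b \<ge> 0") (simp_all add: inner_commute)
    also have "\<dots> \<le> (\<Sum>b\<in>Basis. exp (b \<bullet> y) + exp ((- b) \<bullet> y))"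
      using member_le_sum[OF b(1), of "\<lambda>b. exp (b \<bullet> y) + exp ((- b) \<bullet> y)"] by (simp add: add_nonneg_nonneg)
    finally have *: "\<bar>y \<bullet> b\<bar> ^ k \<le> fact k * (\<Sum>b\<in>Basis. exp (b \<bullet> y) + exp ((- b) \<bullet> y))" by simp
    have "norm y ^ k \<le> (sqrt (real DIM('a)) * infnorm y) ^ k"
      by (intro power_mono norm_le_infnorm) simp
    also have "\<dots> = sqrt (real DIM('a)) ^ k * \<bar>y \<bullet> b\<bar> ^ k" by (simp add: b(2) power_mult_distrib)
    also have "\<dots> \<le> sqrt (real DIM('a)) ^ k * (fact k * (\<Sum>b\<in>Basis. exp (b \<bullet> y) + exp ((- b) \<bullet> y)))"
      by (rule mult_left_mono[OF *]) simp
    finally show ?thesis by (simp add: M_def mult.assoc)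
  qed
  then have le: "norm (norm y ^ k) \<le> norm (M * (\<Sum>b\<in>Basis. exp (b \<bullet> y) + exp ((- b) \<bullet> y)))" for y :: 'a
    by (simp add: order_trans[OF _ abs_ge_self])
  have "integrable gauss (\<lambda>y::'a. M * (\<Sum>b\<in>Basis. exp (b \<bullet> y) + exp ((- b) \<bullet> y)))"
    by (intro integrable_mult_right Bochner_Integration.integrable_sum Bochner_Integration.integrable_add integrable_gauss_exp)
  then show ?thesis by (rule Bochner_Integration.integrable_bound) (use le in auto)
qed

lemma integrable_gauss_ident: "integrable gauss (\<lambda>y::'a::euclidean_space. y)"
  by (rule Bochner_Integration.integrable_bound[OF integrable_gauss_norm_power[of 1]]) auto

lemma integral_gauss_ident: "(LINT y|gauss. y) = (0::'a::euclidean_space)"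
proof -
  have "(LINT y|gauss. (y::'a)) = (LINT y|(distr gauss borel uminus). (y::'a))"
    by (simp only: distr_gauss_uminus)
  also have "\<dots> = (LINT y|gauss. - (y::'a))"
    by (rule integral_distr) auto
  also have "\<dots> = - (LINT y|gauss. (y::'a))" by simp
  finally have "2 *\<^sub>R (LINT y|gauss. (y::'a)) = 0" unfolding scaleR_2 by (metis add.right_inverse)
  then show ?thesis by simp
qed

lemma square_le_exp_add_exp_minus: "(x::real)\<^sup>2 \<le> exp x + exp (- x) - 2"
proof -
  have pos: "2 * u \<le> exp u - exp (- u)" if "u \<ge> 0" for u :: real
  proof -
    have "(\<lambda>u. exp u - exp (- u) - 2 * u) 0 \<le> (\<lambda>u. exp u - exp (- u) - 2 * u) u"
    proof (rule DERIV_nonneg_imp_nondecreasing[OF that])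
      fix x :: real
      have "0 \<le> (exp (x/2) - exp (- (x/2)))\<^sup>2" by simp
      also have "\<dots> = exp x + exp (- x) - 2"
        by (simp add: power2_eq_square algebra_simps flip: exp_add)
      finally have nn: "0 \<le> exp x + exp (- x) - 2" .
      have "DERIV (\<lambda>u. exp u - exp (- u) - 2 * u) x :> exp x + exp (- x) - 2"
        by (auto intro!: derivative_eq_intros)
      with nn show "\<exists>y. DERIV (\<lambda>u. exp u - exp (- u) - 2 * u) x :> y \<and> 0 \<le> y" by blast
    qed
    then show ?thesis by simp
  qed
  have "(2 * \<bar>x/2\<bar>)\<^sup>2 \<le> (exp \<bar>x/2\<bar> - exp (- \<bar>x/2\<bar>))\<^sup>2"
    by (rule power_mono[OF pos]) auto
  also have "\<dots> = exp \<bar>x\<bar> + exp (- \<bar>x\<bar>) - 2"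
    by (simp add: power2_eq_square algebra_simps flip: exp_add)
  also have "\<dots> = exp x + exp (- x) - 2" by (cases "x \<ge> 0") auto
  finally show ?thesis by simp
qed

text \<open>An upper bound on the covariance, obtained by comparing \<open>t (v \<bullet> y)\<^sup>2\<close> with
  \<open>2 cosh (\<surd>t v \<bullet> y) - 2\<close>, whose mean is known from the moment generating function, and letting
  \<open>t\<close> tend to \<open>0\<close>.\<close>

lemma integral_gauss_inner_square:
  fixes v :: "'a::euclidean_space"
  shows "integrable gauss (\<lambda>y. (v \<bullet> y)\<^sup>2)" and "(LINT y|gauss. (v \<bullet> y)\<^sup>2) \<le> (norm v)\<^sup>2"
proof -
  show i: "integrable gauss (\<lambda>y. (v \<bullet> y)\<^sup>2)"
  proof (rule Bochner_Integration.integrable_bound[OF integrable_mult_right[OF integrable_gauss_norm_power[of 2]]])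
    show "AE y in gauss. norm ((v \<bullet> y)\<^sup>2) \<le> norm ((norm v)\<^sup>2 * norm y ^ 2)"
    proof (rule AE_I2)
      fix y
      have "\<bar>v \<bullet> y\<bar>\<^sup>2 \<le> (norm v * norm y)\<^sup>2"
        by (intro power_mono Cauchy_Schwarz_ineq2) simp
      then show "norm ((v \<bullet> y)\<^sup>2) \<le> norm ((norm v)\<^sup>2 * norm y ^ 2)"
        by (simp add: power_mult_distrib)
    qed
  qed auto
  let ?a = "(norm v)\<^sup>2 / 2" and ?E = "LINT y|gauss. (v \<bullet> y)\<^sup>2"
  have bound: "?E \<le> 2 * ((exp (?a * h) - exp (?a * 0)) / h)" if "h > 0" for h
  proof -
    let ?t = "sqrt h"
    have ie: "integrable gauss (\<lambda>y. exp ((?t *\<^sub>R v) \<bullet> y) + exp ((- ?t *\<^sub>R v) \<bullet> y) - 2)"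
      by (intro Bochner_Integration.integrable_diff Bochner_Integration.integrable_add integrable_gauss_exp) auto
    have "h * ?E = (LINT y|gauss. ((?t *\<^sub>R v) \<bullet> y)\<^sup>2)"
      using that by (simp add: power_mult_distrib)
    also have "\<dots> \<le> (LINT y|gauss. exp ((?t *\<^sub>R v) \<bullet> y) + exp ((- ?t *\<^sub>R v) \<bullet> y) - 2)"
    proof (rule integral_mono[OF _ ie])
      show "integrable gauss (\<lambda>y. ((?t *\<^sub>R v) \<bullet> y)\<^sup>2)"
        using i that by (simp add: power_mult_distrib)
      show "((?t *\<^sub>R v) \<bullet> y)\<^sup>2 \<le> exp ((?t *\<^sub>R v) \<bullet> y) + exp ((- ?t *\<^sub>R v) \<bullet> y) - 2" for y
        using square_le_exp_add_exp_minus[of "(?t *\<^sub>R v) \<bullet> y"] by simp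
    qed
    also have "\<dots> = exp ((norm (?t *\<^sub>R v))\<^sup>2 / 2) + exp ((norm (- ?t *\<^sub>R v))\<^sup>2 / 2) - 2"
      using integrable_gauss_exp[of "?t *\<^sub>R v"] integrable_gauss_exp[of "- ?t *\<^sub>R v"]
        integral_gauss_exp[of "?t *\<^sub>R v"] integral_gauss_exp[of "- ?t *\<^sub>R v"]
      by (subst Bochner_Integration.integral_diff, simp, simp, subst Bochner_Integration.integral_add)
        (simp_all add: gauss.prob_space[simplified])
    also have "\<dots> = 2 * (exp (?a * h) - 1)"
      using that by (simp add: power_mult_distrib mult_ac)
    finally show ?thesis using that by (simp add: field_simps)
  qed
  have "((\<lambda>h. exp (?a * h)) has_real_derivative ?a) (at 0)"
    by (auto intro!: derivative_eq_intros)
  then have "((\<lambda>h. (exp (?a * h) - exp (?a * 0)) / h) \<longlongrightarrow> ?a) (at 0)"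
    by (simp add: DERIV_def)
  then have "((\<lambda>h. 2 * ((exp (?a * h) - exp (?a * 0)) / h)) \<longlongrightarrow> 2 * ?a) (at_right 0)"
    by (intro tendsto_mult tendsto_const) (rule filterlim_mono[OF _ order_refl at_le], auto)
  then have "?E \<le> 2 * ?a"
  proof (rule tendsto_lowerbound)
    show "\<forall>\<^sub>F h in at_right 0. ?E \<le> 2 * ((exp (?a * h) - exp (?a * 0)) / h)"
      using eventually_at_right_less[of "0::real"] by eventually_elim (rule bound)
  qed simp
  then show "?E \<le> (norm v)\<^sup>2" by simp
qed


section \<open>Gaussian averages\<close>

text \<open>The heat semigroup at time \<open>t / 2\<close>.\<close>

definition gavg :: "real \<Rightarrow> ('a::euclidean_space \<Rightarrow> 'b::{banach, second_countable_topology}) \<Rightarrow> 'a \<Rightarrow> 'b" where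
  "gavg t \<phi> x = (LINT y|gauss. \<phi> (x + sqrt t *\<^sub>R y))"

text \<open>A class of functions whose Gaussian averages all exist. It contains the squares of Lipschitz
  functions, which the Poincare inequality is about.\<close>

definition quad_growth :: "('a::euclidean_space \<Rightarrow> 'b::{banach, second_countable_topology}) \<Rightarrow> bool" where
  "quad_growth \<phi> \<longleftrightarrow> \<phi> \<in> borel_measurable borel \<and> (\<exists>C. \<forall>x. norm (\<phi> x) \<le> C * (1 + (norm x)\<^sup>2))"

lemma quad_growthI:
  "\<phi> \<in> borel_measurable borel \<Longrightarrow> (\<And>x. norm (\<phi> x) \<le> C * (1 + (norm x)\<^sup>2)) \<Longrightarrow> quad_growth \<phi>"
  unfolding quad_growth_def by blast

lemma quad_growth_bounded:
  assumes "\<phi> \<in> borel_measurable borel" and "\<And>x. norm (\<phi> x) \<le> C"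
  shows "quad_growth \<phi>"
proof (rule quad_growthI[OF assms(1)])
  fix x :: 'a
  have "C \<ge> 0" using assms(2)[of x] norm_ge_zero[of "\<phi> x"] by linarith
  then show "norm (\<phi> x) \<le> C * (1 + (norm x)\<^sup>2)"
    using assms(2)[of x] by (simp add: algebra_simps add_increasing2)
qed

lemma quad_growth_measurable: "quad_growth \<phi> \<Longrightarrow> \<phi> \<in> borel_measurable borel"
  unfolding quad_growth_def by blast

lemma norm_add_square_le: "(norm (x + y))\<^sup>2 \<le> 2 * (norm x)\<^sup>2 + 2 * (norm (y::'a::real_inner))\<^sup>2"
proof -
  have "0 \<le> (norm (x - y))\<^sup>2" by simp
  then show ?thesis by (simp add: power2_norm_eq_inner inner_simps inner_commute)
qed

lemma quad_growth_integrable: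
  fixes \<phi> :: "'a::euclidean_space \<Rightarrow> 'b::{banach, second_countable_topology}"
  assumes "quad_growth \<phi>"
  shows "integrable gauss (\<lambda>y. \<phi> (x + r *\<^sub>R y))"
proof -
  have [measurable]: "\<phi> \<in> borel_measurable borel" by (rule quad_growth_measurable[OF assms])
  obtain C where C: "\<And>x. norm (\<phi> x) \<le> C * (1 + (norm x)\<^sup>2)" using assms unfolding quad_growth_def by blast
  have C0: "C \<ge> 0" using order_trans[OF norm_ge_zero C[of 0]] by simp
  have "norm (\<phi> (x + r *\<^sub>R y)) \<le> norm (C * (1 + 2 * (norm x)\<^sup>2) + (C * 2 * r\<^sup>2) * norm y ^ 2)" for y
  proof -
    have "(norm (x + r *\<^sub>R y))\<^sup>2 \<le> 2 * (norm x)\<^sup>2 + 2 * (r\<^sup>2 * norm y ^ 2)"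
      using norm_add_square_le[of x "r *\<^sub>R y"] by (simp add: power_mult_distrib)
    then have "C * (1 + (norm (x + r *\<^sub>R y))\<^sup>2) \<le> C * (1 + (2 * (norm x)\<^sup>2 + 2 * (r\<^sup>2 * norm y ^ 2)))"
      using C0 by (intro mult_left_mono) auto
    also have "\<dots> \<le> norm (C * (1 + 2 * (norm x)\<^sup>2) + (C * 2 * r\<^sup>2) * norm y ^ 2)"
      by (simp add: algebra_simps)
    finally show ?thesis using C[of "x + r *\<^sub>R y"] by linarith
  qed
  note bound = this
  have "integrable gauss (\<lambda>y::'a. C * (1 + 2 * (norm x)\<^sup>2) + (C * 2 * r\<^sup>2) * norm y ^ 2)"
    by (intro Bochner_Integration.integrable_add integrable_mult_right integrable_gauss_norm_power
        gauss.integrable_const)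
  from this show ?thesis
    by (rule Bochner_Integration.integrable_bound[OF _ _ AE_I2[OF bound]]) measurable
qed

lemma gavg_measurable:
  assumes [measurable]: "\<phi> \<in> borel_measurable borel"
  shows "gavg t \<phi> \<in> borel_measurable borel"
  unfolding gavg_def by measurable

lemma quad_growth_gavg:
  fixes \<phi> :: "'a::euclidean_space \<Rightarrow> 'b::{banach, second_countable_topology}"
  assumes "quad_growth \<phi>"
  shows "quad_growth (gavg t \<phi>)"
proof -
  have [measurable]: "\<phi> \<in> borel_measurable borel" by (rule quad_growth_measurable[OF assms])
  obtain C where C: "\<And>x. norm (\<phi> x) \<le> C * (1 + (norm x)\<^sup>2)" using assms unfolding quad_growth_def by blast
  have C0: "C \<ge> 0" using order_trans[OF norm_ge_zero C[of 0]] by simp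
  define M where "M = 1 + 2 * \<bar>t\<bar> * (LINT y|gauss. norm (y::'a) ^ 2)"
  have M: "M \<ge> 1" by (simp add: M_def integral_nonneg_AE)
  show ?thesis
  proof (rule quad_growthI[OF gavg_measurable])
    fix x :: 'a
    have "norm (gavg t \<phi> x) \<le> (LINT y|gauss. norm (\<phi> (x + sqrt t *\<^sub>R y)))"
      unfolding gavg_def by (rule integral_norm_bound)
    also have "\<dots> \<le> (LINT y|gauss. C * (1 + 2 * (norm (x::'a))\<^sup>2) + (C * 2 * \<bar>t\<bar>) * norm (y::'a) ^ 2)"
    proof (rule integral_mono)
      show "integrable gauss (\<lambda>y. norm (\<phi> (x + sqrt t *\<^sub>R y)))"
        by (rule integrable_norm[OF quad_growth_integrable[OF assms]])
      show "integrable gauss (\<lambda>y::'a. C * (1 + 2 * (norm x)\<^sup>2) + (C * 2 * \<bar>t\<bar>) * norm y ^ 2)"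
        by (intro Bochner_Integration.integrable_add integrable_mult_right integrable_gauss_norm_power
            gauss.integrable_const)
      fix y :: 'a
      have "(norm (x + sqrt t *\<^sub>R y))\<^sup>2 \<le> 2 * (norm x)\<^sup>2 + 2 * (\<bar>t\<bar> * norm y ^ 2)"
        using norm_add_square_le[of x "sqrt t *\<^sub>R y"]
        by (simp add: power_mult_distrib power2_eq_square[of "sqrt t"])
      then have "C * (1 + (norm (x + sqrt t *\<^sub>R y))\<^sup>2) \<le> C * (1 + (2 * (norm x)\<^sup>2 + 2 * (\<bar>t\<bar> * norm y ^ 2)))"
        using C0 by (intro mult_left_mono) auto
      then show "norm (\<phi> (x + sqrt t *\<^sub>R y)) \<le> C * (1 + 2 * (norm x)\<^sup>2) + (C * 2 * \<bar>t\<bar>) * norm y ^ 2"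
        using C[of "x + sqrt t *\<^sub>R y"] by (simp add: algebra_simps)
    qed
    also have "\<dots> = C * (M + 2 * (norm x)\<^sup>2)"
      by (subst Bochner_Integration.integral_add)
        (auto intro!: integrable_mult_right integrable_gauss_norm_power
          simp: M_def gauss.prob_space[simplified] algebra_simps)
    also have "\<dots> \<le> C * (2 * M * (1 + (norm x)\<^sup>2))"
    proof (rule mult_left_mono[OF _ C0])
      have "1 * (norm x)\<^sup>2 \<le> M * (norm x)\<^sup>2" by (rule mult_right_mono[OF M]) simp
      then show "M + 2 * (norm x)\<^sup>2 \<le> 2 * M * (1 + (norm x)\<^sup>2)" using M by (simp add: algebra_simps)
    qed
    finally show "norm (gavg t \<phi> x) \<le> (C * (2 * M)) * (1 + (norm x)\<^sup>2)" by (simp add: mult.assoc)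
  qed measurable
qed

lemma gavg_gavg:
  fixes \<phi> :: "'a::euclidean_space \<Rightarrow> 'b::{banach, second_countable_topology}"
  assumes "quad_growth \<phi>" "a \<ge> 0" "b > 0"
  shows "gavg a (gavg b \<phi>) = gavg (a + b) \<phi>"
proof
  fix z :: 'a
  let ?c = "sqrt (a / (a + b))" and ?s = "sqrt (b / (a + b))"
  have cs: "?c\<^sup>2 + ?s\<^sup>2 = 1" "?s > 0" using assms by (simp_all add: add_divide_distrib[symmetric])
  have r: "sqrt (a + b) * ?c = sqrt a" "sqrt (a + b) * ?s = sqrt b"
    using assms by (simp_all add: real_sqrt_mult[symmetric])
  have "gavg (a + b) \<phi> z = (LINT x|gauss. LINT y|gauss. \<phi> (z + sqrt (a + b) *\<^sub>R (?c *\<^sub>R x + ?s *\<^sub>R y)))"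
    unfolding gavg_def by (rule integral_gauss_rotate[symmetric, OF cs quad_growth_integrable[OF assms(1)]])
  also have "\<dots> = gavg a (gavg b \<phi>) z"
    unfolding gavg_def by (simp add: scaleR_add_right r add.assoc)
  finally show "gavg a (gavg b \<phi>) z = gavg (a + b) \<phi> z" ..
qed

lemma gavg_add:
  assumes "quad_growth \<phi>" "quad_growth \<psi>"
  shows "gavg t (\<lambda>x. \<phi> x + \<psi> x) x = gavg t \<phi> x + gavg t \<psi> x"
  unfolding gavg_def by (rule Bochner_Integration.integral_add[OF quad_growth_integrable[OF assms(1)] quad_growth_integrable[OF assms(2)]])

lemma gavg_diff:
  assumes "quad_growth \<phi>" "quad_growth \<psi>"
  shows "gavg t (\<lambda>x. \<phi> x - \<psi> x) x = gavg t \<phi> x - gavg t \<psi> x"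
  unfolding gavg_def by (rule Bochner_Integration.integral_diff[OF quad_growth_integrable[OF assms(1)] quad_growth_integrable[OF assms(2)]])

lemma gavg_cmult: "gavg t (\<lambda>x. c * \<phi> x) x = c * (gavg t \<phi> x :: real)"
  unfolding gavg_def by simp

lemma gavg_const [simp]: "gavg t (\<lambda>x. c) x = c"
  unfolding gavg_def by (simp add: gauss.prob_space[simplified])

lemma gavg_mono:
  fixes \<phi> :: "'a::euclidean_space \<Rightarrow> real"
  assumes "quad_growth \<phi>" "quad_growth \<psi>" "\<And>x. \<phi> x \<le> \<psi> x"
  shows "gavg t \<phi> x \<le> gavg t \<psi> x"
  unfolding gavg_def by (rule integral_mono[OF quad_growth_integrable[OF assms(1)] quad_growth_integrable[OF assms(2)] assms(3)])

lemma gavg_ge: "quad_growth f \<Longrightarrow> (\<And>x. c \<le> f x) \<Longrightarrow> c \<le> (gavg t f x :: real)"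
  using gavg_mono[of "\<lambda>x. c" f t x] quad_growth_bounded[of "\<lambda>x. c" "\<bar>c\<bar>"] by simp

lemma gavg_le: "quad_growth f \<Longrightarrow> (\<And>x. f x \<le> c) \<Longrightarrow> (gavg t f x :: real) \<le> c"
  using gavg_mono[of f "\<lambda>x. c" t x] quad_growth_bounded[of "\<lambda>x. c" "\<bar>c\<bar>"] by simp

lemma gavg_inner:
  assumes "quad_growth \<phi>"
  shows "gavg t (\<lambda>x. \<phi> x \<bullet> v) x = gavg t \<phi> x \<bullet> (v::'a::euclidean_space)"
  unfolding gavg_def by (rule integral_inner_left[OF quad_growth_integrable[OF assms]])

lemma quad_growth_add:
  "quad_growth \<phi> \<Longrightarrow> quad_growth \<psi> \<Longrightarrow> quad_growth (\<lambda>x. \<phi> x + \<psi> x)"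
proof -
  assume a: "quad_growth \<phi>" "quad_growth \<psi>"
  then obtain C C' where "\<And>x. norm (\<phi> x) \<le> C * (1 + (norm x)\<^sup>2)" "\<And>x. norm (\<psi> x) \<le> C' * (1 + (norm x)\<^sup>2)"
    unfolding quad_growth_def by blast
  then have "norm (\<phi> x + \<psi> x) \<le> (C + C') * (1 + (norm x)\<^sup>2)" for x
    unfolding distrib_right by (intro order_trans[OF norm_triangle_ineq] add_mono)
  moreover have "(\<lambda>x. \<phi> x + \<psi> x) \<in> borel_measurable borel"
    using a by (intro borel_measurable_add quad_growth_measurable)
  ultimately show ?thesis by (rule quad_growthI[rotated])
qed

lemma quad_growth_cmult:
  "quad_growth \<phi> \<Longrightarrow> quad_growth (\<lambda>x. c * (\<phi> x :: real))"
proof -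
  assume a: "quad_growth \<phi>"
  then obtain C where "\<And>x. norm (\<phi> x) \<le> C * (1 + (norm x)\<^sup>2)"
    unfolding quad_growth_def by blast
  then have "norm (c * \<phi> x) \<le> (\<bar>c\<bar> * C) * (1 + (norm x)\<^sup>2)" for x
    by (simp add: abs_mult mult.assoc mult_left_mono)
  moreover have "(\<lambda>x. c * \<phi> x) \<in> borel_measurable borel"
    using quad_growth_measurable[OF a] by measurable
  ultimately show ?thesis by (rule quad_growthI[rotated])
qed

lemma quad_growth_diff:
  "quad_growth \<phi> \<Longrightarrow> quad_growth \<psi> \<Longrightarrow> quad_growth (\<lambda>x. \<phi> x - (\<psi> x :: real))"
  using quad_growth_add[of \<phi> "\<lambda>x. (-1) * \<psi> x"] quad_growth_cmult[of \<psi> "-1"] by simp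

section \<open>Functions with Lipschitz gradient\<close>

lemma gavg_0 [simp]: "gavg 0 \<phi> x = \<phi> x"
  unfolding gavg_def by (simp add: gauss.prob_space[simplified])

text \<open>Bounded Lipschitz gradient \<open>D\<close>, expressed by inequalities between values instead of derivatives. Such
  inequalities pass to averages over translates without differentiation under the integral.\<close>

definition C11 :: "real \<Rightarrow> ('a::euclidean_space \<Rightarrow> real) \<Rightarrow> ('a \<Rightarrow> 'a) \<Rightarrow> bool" where
  "C11 L f D \<longleftrightarrow>
     (\<forall>x v. \<bar>f (x + v) - f x - D x \<bullet> v\<bar> \<le> L * (norm v)\<^sup>2) \<and>
     (\<forall>x y. \<bar>f x - f y\<bar> \<le> L * norm (x - y)) \<and>
     (\<forall>x. norm (D x) \<le> L) \<and>
     (\<forall>x y. norm (D x - D y) \<le> L * norm (x - y))"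

lemma C11D:
  assumes "C11 L f D"
  shows "\<bar>f (x + v) - f x - D x \<bullet> v\<bar> \<le> L * (norm v)\<^sup>2"
    and "\<bar>f x - f y\<bar> \<le> L * norm (x - y)"
    and "norm (D x) \<le> L"
    and "norm (D x - D y) \<le> L * norm (x - y)"
    and "0 \<le> L"
  using assms order_trans[OF norm_ge_zero, of "D x" L] unfolding C11_def by auto

lemma lipschitz_measurable:
  fixes f :: "'a::euclidean_space \<Rightarrow> 'b::euclidean_space"
  assumes "\<And>x y. norm (f x - f y) \<le> L * norm (x - y)"
  shows "f \<in> borel_measurable borel"
proof -
  have "(max L 0)-lipschitz_on UNIV f"
  proof (rule lipschitz_onI)
    fix x y
    have "norm (f x - f y) \<le> L * norm (x - y)" by (rule assms)
    also have "\<dots> \<le> max L 0 * norm (x - y)" by (rule mult_right_mono) auto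
    finally show "dist (f x) (f y) \<le> max L 0 * dist x y" by (simp add: dist_norm)
  qed simp
  then show ?thesis by (intro borel_measurable_continuous_onI lipschitz_on_continuous_on)
qed

lemma C11_measurable:
  assumes "C11 L f D"
  shows "f \<in> borel_measurable borel" "D \<in> borel_measurable borel"
  using lipschitz_measurable[of f L] lipschitz_measurable[of D L] C11D[OF assms] by auto

lemma C11_quad_growth:
  fixes f :: "'a::euclidean_space \<Rightarrow> real"
  assumes "C11 L f D"
  shows "quad_growth f" "quad_growth D" "quad_growth (\<lambda>x. (norm (D x))\<^sup>2)" "quad_growth (\<lambda>x. (f x)\<^sup>2)"
proof -
  note [measurable] = C11_measurable[OF assms]
  have b: "\<bar>f x\<bar> \<le> \<bar>f 0\<bar> + L * norm x" for x using C11D(2)[OF assms, of x 0] by simp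
  have L: "L \<ge> 0" by (rule C11D(5)[OF assms])
  show "quad_growth f"
  proof (rule quad_growthI)
    fix x :: 'a
    have "2 * norm x \<le> 1 + (norm x)\<^sup>2" using sum_squares_bound[of 1 "norm x"] by simp
    then have "norm x \<le> 1 + (norm x)\<^sup>2" using norm_ge_zero[of x] by linarith
    then have "L * norm x \<le> L * (1 + (norm x)\<^sup>2)" using L by (rule mult_left_mono)
    moreover have "0 \<le> L * norm x" "0 \<le> \<bar>f 0\<bar> * (norm x)\<^sup>2" using L by auto
    moreover have "(\<bar>f 0\<bar> + L) * (1 + (norm x)\<^sup>2) = \<bar>f 0\<bar> + \<bar>f 0\<bar> * (norm x)\<^sup>2 + L * (1 + (norm x)\<^sup>2)"
      by (simp add: algebra_simps)
    ultimately show "norm (f x) \<le> (\<bar>f 0\<bar> + L) * (1 + (norm x)\<^sup>2)"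
      using b[of x] unfolding real_norm_def by linarith
  qed measurable
  show "quad_growth (\<lambda>x. (f x)\<^sup>2)"
  proof (rule quad_growthI)
    fix x :: 'a
    have "(f x)\<^sup>2 \<le> (\<bar>f 0\<bar> + L * norm x)\<^sup>2" using b[of x] power_mono[of "\<bar>f x\<bar>" "\<bar>f 0\<bar> + L * norm x" 2] by simp
    also have "\<dots> \<le> 2 * \<bar>f 0\<bar>\<^sup>2 + 2 * (L * norm x)\<^sup>2"
      using norm_add_square_le[of "\<bar>f 0\<bar>" "L * norm x"] by simp
    also have "\<dots> \<le> (2 * \<bar>f 0\<bar>\<^sup>2 + 2 * L\<^sup>2) * (1 + (norm x)\<^sup>2)"
      by (simp add: algebra_simps power_mult_distrib)
    finally show "norm ((f x)\<^sup>2) \<le> (2 * \<bar>f 0\<bar>\<^sup>2 + 2 * L\<^sup>2) * (1 + (norm x)\<^sup>2)" by simp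
  qed measurable
  show "quad_growth D" by (rule quad_growth_bounded[of _ L]) (auto simp: C11D[OF assms])
  show "quad_growth (\<lambda>x. (norm (D x))\<^sup>2)"
    by (rule quad_growth_bounded[of _ "L\<^sup>2"]) (auto simp: C11D[OF assms] intro!: power_mono)
qed

lemma C11_norm_square_lipschitz:
  assumes "C11 L f D"
  shows "\<bar>(norm (D x))\<^sup>2 - (norm (D z))\<^sup>2\<bar> \<le> 2 * (L\<^sup>2 * norm (x - z))"
proof -
  note c = C11D[OF assms]
  have "\<bar>(norm (D x))\<^sup>2 - (norm (D z))\<^sup>2\<bar> = \<bar>norm (D x) - norm (D z)\<bar> * (norm (D x) + norm (D z))"
    by (simp add: power2_eq_square square_diff_square_factored abs_mult mult.commute)
  also have "\<dots> \<le> (L * norm (x - z)) * (2 * L)"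
    using norm_triangle_ineq3[of "D x" "D z"] c(3)[of x] c(3)[of z] c(4)[of x z] by (intro mult_mono) auto
  finally show ?thesis by (simp add: power2_eq_square mult_ac)
qed

lemma gauss_integral_bound:
  fixes g :: "'a::euclidean_space \<Rightarrow> 'b::{banach, second_countable_topology}"
  assumes "\<And>y. norm (g y) \<le> B"
  shows "norm (LINT y|gauss. g y) \<le> B"
proof (cases "integrable gauss g")
  case True
  have "norm (LINT y|gauss. g y) \<le> (LINT y|gauss. norm (g y))" by (rule integral_norm_bound)
  also have "\<dots> \<le> (LINT y|(gauss :: 'a measure). B)"
    by (rule integral_mono) (auto intro!: integrable_norm True simp: assms)
  finally show ?thesis by (simp add: gauss.prob_space[simplified])
next
  case False
  then show ?thesis using order_trans[OF norm_ge_zero assms] by (simp add: not_integrable_integral_eq)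
qed

lemma C11_gavg:
  fixes f :: "'a::euclidean_space \<Rightarrow> real"
  assumes "C11 L f D"
  shows "C11 L (gavg t f) (gavg t D)"
  unfolding C11_def
proof (intro conjI allI)
  note q = C11_quad_growth[OF assms]
  note i = quad_growth_integrable[OF q(1)] quad_growth_integrable[OF q(2)]
  fix x y v :: 'a
  have "gavg t f (x + v) - gavg t f x - gavg t D x \<bullet> v
    = (LINT y|gauss. f ((x + v) + sqrt t *\<^sub>R y) - f (x + sqrt t *\<^sub>R y) - D (x + sqrt t *\<^sub>R y) \<bullet> v)"
    unfolding gavg_def using i(1)[of "x + v" "sqrt t"] i(1)[of x "sqrt t"] i(2)[of x "sqrt t"] by simp
  also have "\<bar>\<dots>\<bar> \<le> L * (norm v)\<^sup>2"
    using C11D(1)[OF assms, of "x + sqrt t *\<^sub>R _" v]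
    by (intro gauss_integral_bound[where 'b=real, simplified]) (simp add: add_ac)
  finally show "\<bar>gavg t f (x + v) - gavg t f x - gavg t D x \<bullet> v\<bar> \<le> L * (norm v)\<^sup>2" .
  have "gavg t f x - gavg t f y = (LINT z|gauss. f (x + sqrt t *\<^sub>R z) - f (y + sqrt t *\<^sub>R z))"
    unfolding gavg_def using i(1)[of x "sqrt t"] i(1)[of y "sqrt t"] by simp
  also have "\<bar>\<dots>\<bar> \<le> L * norm (x - y)"
    using C11D(2)[OF assms, of "x + sqrt t *\<^sub>R _" "y + sqrt t *\<^sub>R _"]
    by (intro gauss_integral_bound[where 'b=real, simplified]) (metis add_diff_cancel_right)
  finally show "\<bar>gavg t f x - gavg t f y\<bar> \<le> L * norm (x - y)" .
  show "norm (gavg t D x) \<le> L"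
    unfolding gavg_def by (rule gauss_integral_bound) (rule C11D(3)[OF assms])
  have "gavg t D x - gavg t D y = (LINT z|gauss. D (x + sqrt t *\<^sub>R z) - D (y + sqrt t *\<^sub>R z))"
    unfolding gavg_def using i(2)[of x "sqrt t"] i(2)[of y "sqrt t"] by simp
  also have "norm \<dots> \<le> L * norm (x - y)"
    using C11D(4)[OF assms, of "x + sqrt t *\<^sub>R _" "y + sqrt t *\<^sub>R _"]
    by (intro gauss_integral_bound) (metis add_diff_cancel_right)
  finally show "norm (gavg t D x - gavg t D y) \<le> L * norm (x - y)" .
qed

section \<open>Entropies of Gaussian increments\<close>

text \<open>Data for bounding the entropy \<open>E \<Phi>(f) - \<Phi>(E f)\<close> by the energy \<open>E q(f) |\<nabla>f|\<^sup>2\<close>, where \<open>q = \<Phi>'' / 2\<close>. The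
  cubic remainder in Taylor's formula is of order \<open>s\<^sup>3\<^sup>/\<^sup>2\<close> for an increment of variance \<open>s\<close>, so that the
  sum of \<open>t / s\<close> such errors vanishes as \<open>s \<rightarrow> 0\<close>. The class \<open>N\<close> is closed under Gaussian averages, which
  allows induction on the number of increments. The cases of interest are \<open>\<Phi>(r) = r\<^sup>2\<close> (Poincare) and
  \<open>\<Phi>(r) = r ln r\<close> (logarithmic Sobolev).\<close>

locale phi_entropy =
  fixes \<Phi> \<Phi>' q :: "real \<Rightarrow> real" and I :: "real set" and M Q K L :: real
    and N :: "('a::euclidean_space \<Rightarrow> real) \<Rightarrow> ('a \<Rightarrow> 'a) \<Rightarrow> bool"
  assumes supporting: "\<And>r c. r \<in> I \<Longrightarrow> c \<in> I \<Longrightarrow> \<Phi> c + \<Phi>' c * (r - c) \<le> \<Phi> r"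
    and taylor: "\<And>r c. r \<in> I \<Longrightarrow> c \<in> I \<Longrightarrow>
        \<Phi> r \<le> \<Phi> c + \<Phi>' c * (r - c) + q c * (r - c)\<^sup>2 + M * \<bar>r - c\<bar> ^ 3"
    and q_nonneg: "\<And>c. c \<in> I \<Longrightarrow> 0 \<le> q c" and q_le: "\<And>c. c \<in> I \<Longrightarrow> q c \<le> Q" and M_nonneg: "0 \<le> M"
    and N_C11: "\<And>f D. N f D \<Longrightarrow> C11 L f D"
    and N_range: "\<And>f D x. N f D \<Longrightarrow> f x \<in> I"
    and N_gavg: "\<And>f D t. N f D \<Longrightarrow> t \<ge> 0 \<Longrightarrow> N (gavg t f) (gavg t D)"
    and N_growth: "\<And>f D. N f D \<Longrightarrow> quad_growth (\<lambda>x. \<Phi> (f x))"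
    and energy_lipschitz: "\<And>f D x z. N f D \<Longrightarrow>
        \<bar>q (f x) * (norm (D x))\<^sup>2 - q (f z) * (norm (D z))\<^sup>2\<bar> \<le> K * norm (x - z)"
    and energy_gavg: "\<And>f D t x. N f D \<Longrightarrow> t \<ge> 0 \<Longrightarrow>
        q (gavg t f x) * (norm (gavg t D x))\<^sup>2 \<le> gavg t (\<lambda>x. q (f x) * (norm (D x))\<^sup>2) x"
begin

abbreviation energy :: "('a \<Rightarrow> real) \<Rightarrow> ('a \<Rightarrow> 'a) \<Rightarrow> 'a \<Rightarrow> real" where
  "energy f D x \<equiv> q (f x) * (norm (D x))\<^sup>2"

lemma energy_growth:
  assumes "N f D"
  shows "quad_growth (energy f D)"
proof (rule quad_growth_bounded)
  show "energy f D \<in> borel_measurable borel"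
    using energy_lipschitz[OF assms] by (intro lipschitz_measurable[of _ K]) auto
  fix x
  have "(norm (D x))\<^sup>2 \<le> L\<^sup>2" using C11D(3)[OF N_C11[OF assms]] by (intro power_mono) auto
  then show "norm (energy f D x) \<le> Q * L\<^sup>2"
    using q_nonneg[OF N_range[OF assms]] q_le[OF N_range[OF assms]]
    by (simp add: abs_mult mult_mono')
qed

text \<open>The coefficient of \<open>s\<^sup>3\<^sup>/\<^sup>2\<close> in the Taylor remainder at the point \<open>x + \<surd>s y\<close>, for \<open>s \<le> 1\<close>.\<close>

definition err :: "'a \<Rightarrow> real" where
  "err y = (2 * Q * L\<^sup>2 + M * L ^ 3) * norm y ^ 3 + Q * L\<^sup>2 * norm y ^ 4"

text \<open>Expanding \<open>\<Phi>(f)\<close> around \<open>c = f x\<close>: the linear term is absorbed by the supporting line of \<open>\<Phi>\<close> at \<open>c\<close>,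
  the quadratic one has mean at most \<open>s q(c) |D x|\<^sup>2\<close>, and the rest is of higher order. The Lipschitz bound
  on the energy then replaces its value at \<open>x\<close> by its average around \<open>x\<close>.\<close>

lemma one_step:
  assumes N: "N f D" and s: "0 < s" "s \<le> 1"
  shows "gavg s (\<lambda>x. \<Phi> (f x)) x \<le> \<Phi> (gavg s f x) + s * gavg s (energy f D) x
    + ((LINT y|gauss. err y) + \<bar>K\<bar> * (LINT y|gauss. norm (y::'a) ^ 1)) * (s * sqrt s)"
proof -
  note c = C11D[OF N_C11[OF N]]
  define c where "c = f x"
  have cI: "c \<in> I" unfolding c_def by (rule N_range[OF N])
  have Q: "Q \<ge> 0" using q_nonneg[OF cI] q_le[OF cI] by simp
  have q2: "q c \<le> Q" "0 \<le> q c" using q_nonneg[OF cI] q_le[OF cI] by auto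
  have pt: "\<Phi> (f (x + sqrt s *\<^sub>R y)) \<le> \<Phi> c + \<Phi>' c * (f (x + sqrt s *\<^sub>R y) - c) + q c * s * (D x \<bullet> y)\<^sup>2
      + err y * (s * sqrt s)" for y
  proof -
    let ?w = "sqrt s *\<^sub>R y"
    let ?r = "f (x + ?w)"
    let ?n = "norm ?w"
    have rc: "\<bar>?r - c\<bar> \<le> L * ?n" using c(2)[of "x + ?w" x] by (simp add: c_def)
    define e where "e = ?r - c - D x \<bullet> ?w"
    have e: "\<bar>e\<bar> \<le> L * ?n\<^sup>2" using c(1)[of x ?w] by (simp add: e_def c_def)
    have Dw: "\<bar>D x \<bullet> ?w\<bar> \<le> L * ?n"
      using Cauchy_Schwarz_ineq2[of "D x" ?w] mult_right_mono[OF c(3)[of x] norm_ge_zero[of ?w]] by linarith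
    have "(?r - c)\<^sup>2 = (D x \<bullet> ?w)\<^sup>2 + 2 * ((D x \<bullet> ?w) * e) + e\<^sup>2"
      by (simp add: e_def power2_eq_square algebra_simps)
    also have "(D x \<bullet> ?w) * e \<le> (L * ?n) * (L * ?n\<^sup>2)"
      using mult_mono[OF Dw e] c(5) abs_ge_self[of "(D x \<bullet> ?w) * e"] by (simp only: abs_mult) auto
    also have "e\<^sup>2 \<le> (L * ?n\<^sup>2)\<^sup>2" using e by (metis abs_ge_zero power2_abs power_mono)
    finally have sq: "(?r - c)\<^sup>2 \<le> (D x \<bullet> ?w)\<^sup>2 + (2 * L\<^sup>2 * ?n ^ 3 + L\<^sup>2 * ?n ^ 4)"
      by (simp add: algebra_simps power2_eq_square power3_eq_cube power4_eq_xxxx)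
    have "q c * (?r - c)\<^sup>2 \<le> q c * (D x \<bullet> ?w)\<^sup>2 + q c * (2 * L\<^sup>2 * ?n ^ 3 + L\<^sup>2 * ?n ^ 4)"
      using mult_left_mono[OF sq q2(2)] by (simp add: distrib_left)
    also have "q c * (2 * L\<^sup>2 * ?n ^ 3 + L\<^sup>2 * ?n ^ 4) \<le> Q * (2 * L\<^sup>2 * ?n ^ 3 + L\<^sup>2 * ?n ^ 4)"
      by (rule mult_right_mono[OF q2(1)]) auto
    finally have a1: "q c * (?r - c)\<^sup>2 \<le> q c * (D x \<bullet> ?w)\<^sup>2 + Q * (2 * L\<^sup>2 * ?n ^ 3 + L\<^sup>2 * ?n ^ 4)" by simp
    have a2: "M * \<bar>?r - c\<bar> ^ 3 \<le> M * (L * ?n) ^ 3"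
      by (intro mult_left_mono power_mono rc M_nonneg) auto
    have n3: "?n ^ 3 = (s * sqrt s) * norm y ^ 3"
      using s by (simp add: power_mult_distrib power3_eq_cube real_sqrt_mult_self)
    have "?n ^ 4 = (s * s) * norm y ^ 4"
      using s by (simp add: power_mult_distrib power4_eq_xxxx)
    also have "\<dots> \<le> (s * sqrt s) * norm y ^ 4"
    proof (intro mult_right_mono mult_left_mono)
      show "s \<le> sqrt s" using s by (simp add: real_le_rsqrt power2_eq_square mult_left_le)
    qed (use s in auto)
    finally have n4: "?n ^ 4 \<le> (s * sqrt s) * norm y ^ 4" .
    have "Q * (2 * L\<^sup>2 * ?n ^ 3 + L\<^sup>2 * ?n ^ 4) + M * (L * ?n) ^ 3
        = (2 * Q * L\<^sup>2 + M * L ^ 3) * ?n ^ 3 + Q * L\<^sup>2 * ?n ^ 4"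
      by (simp add: algebra_simps power_mult_distrib)
    also have "\<dots> \<le> (2 * Q * L\<^sup>2 + M * L ^ 3) * ((s * sqrt s) * norm y ^ 3) + Q * L\<^sup>2 * ((s * sqrt s) * norm y ^ 4)"
      unfolding n3 using Q by (intro add_left_mono mult_left_mono n4) auto
    also have "\<dots> = err y * (s * sqrt s)" by (simp add: err_def algebra_simps)
    finally have a3: "Q * (2 * L\<^sup>2 * ?n ^ 3 + L\<^sup>2 * ?n ^ 4) + M * (L * ?n) ^ 3 \<le> err y * (s * sqrt s)" .
    have "(D x \<bullet> ?w)\<^sup>2 = s * (D x \<bullet> y)\<^sup>2" using s by (simp add: power_mult_distrib)
    then have "q c * (D x \<bullet> ?w)\<^sup>2 = q c * s * (D x \<bullet> y)\<^sup>2" by simp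
    then show ?thesis using taylor[OF N_range[OF N, of "x + ?w"] cI] a1 a2 a3 by linarith
  qed
  have ierr: "integrable gauss err"
    unfolding err_def by (intro Bochner_Integration.integrable_add integrable_mult_right integrable_gauss_norm_power)
  note i_f = quad_growth_integrable[OF C11_quad_growth(1)[OF N_C11[OF N]], of x "sqrt s"]
  have gf: "(LINT y|gauss. f (x + sqrt s *\<^sub>R y) - c) = gavg s f x - c"
    using i_f by (simp add: gavg_def gauss.prob_space[simplified])
  have ir: "integrable gauss (\<lambda>y. \<Phi> c + \<Phi>' c * (f (x + sqrt s *\<^sub>R y) - c) + q c * s * (D x \<bullet> y)\<^sup>2
      + err y * (s * sqrt s))"
    by (intro Bochner_Integration.integrable_add integrable_mult_right integrable_mult_left
        Bochner_Integration.integrable_diff i_f gauss.integrable_const integral_gauss_inner_square(1) ierr)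
  have "gavg s (\<lambda>x. \<Phi> (f x)) x \<le> (LINT y|gauss. \<Phi> c + \<Phi>' c * (f (x + sqrt s *\<^sub>R y) - c) + q c * s * (D x \<bullet> y)\<^sup>2
      + err y * (s * sqrt s))"
    unfolding gavg_def by (rule integral_mono[OF quad_growth_integrable[OF N_growth[OF N]] ir pt])
  also have "\<dots> = \<Phi> c + \<Phi>' c * (gavg s f x - c) + q c * s * (LINT y|gauss. (D x \<bullet> y)\<^sup>2)
      + (LINT y|gauss. err y) * (s * sqrt s)"
    using i_f ierr integral_gauss_inner_square(1)[of "D x"]
    by (simp add: gf[simplified] gavg_def gauss.prob_space[simplified] right_diff_distrib)
  also have "\<dots> \<le> \<Phi> (gavg s f x) + q c * s * (norm (D x))\<^sup>2 + (LINT y|gauss. err y) * (s * sqrt s)"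
    using supporting[OF N_range[OF N_gavg[OF N], of s x] cI] s q2
      mult_left_mono[OF integral_gauss_inner_square(2)[of "D x"], of "q c * s"] by simp
  also have "q c * s * (norm (D x))\<^sup>2 = s * energy f D x" by (simp add: c_def)
  also have "energy f D x \<le> gavg s (energy f D) x + \<bar>K\<bar> * (LINT y|gauss. norm (y::'a) ^ 1) * sqrt s"
  proof -
    note ie = quad_growth_integrable[OF energy_growth[OF N], of x "sqrt s"]
    have "energy f D x = (LINT y|(gauss :: 'a measure). energy f D x)" by (simp add: gauss.prob_space[simplified])
    also have "\<dots> \<le> (LINT y|gauss. energy f D (x + sqrt s *\<^sub>R y) + (\<bar>K\<bar> * sqrt s) * norm (y::'a) ^ 1)"
    proof (rule integral_mono)
      show "integrable gauss (\<lambda>y. energy f D (x + sqrt s *\<^sub>R y) + (\<bar>K\<bar> * sqrt s) * norm (y::'a) ^ 1)"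
        by (intro Bochner_Integration.integrable_add ie integrable_mult_right integrable_gauss_norm_power)
      fix y
      have "\<bar>energy f D x - energy f D (x + sqrt s *\<^sub>R y)\<bar> \<le> K * (sqrt s * norm y)"
        using energy_lipschitz[OF N, of x "x + sqrt s *\<^sub>R y"] s by simp
      also have "\<dots> \<le> \<bar>K\<bar> * (sqrt s * norm y)" using s by (intro mult_right_mono) auto
      finally show "energy f D x \<le> energy f D (x + sqrt s *\<^sub>R y) + (\<bar>K\<bar> * sqrt s) * norm y ^ 1" by simp
    qed auto
    also have "\<dots> = gavg s (energy f D) x + \<bar>K\<bar> * (LINT y|gauss. norm (y::'a) ^ 1) * sqrt s"
      unfolding gavg_def using ie integrable_gauss_norm_power[where 'a='a and k=1] by simp
    finally show ?thesis by blast
  qed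
  finally show ?thesis using s by (simp add: algebra_simps)
qed


text \<open>The Gaussian of variance \<open>t\<close> is the sum of \<open>m\<close> independent ones of variance \<open>s = t / m\<close>. Integrating
  out the last increment costs \<open>s\<close> times the energy plus \<open>O(s\<^sup>3\<^sup>/\<^sup>2)\<close> and replaces \<open>f\<close> by \<open>gavg s f\<close>, whose
  energy is no larger than the average of the energy of \<open>f\<close>.\<close>

theorem entropy_le_energy:
  assumes N: "N f D" and t: "0 < t"
  shows "gavg t (\<lambda>x. \<Phi> (f x)) z \<le> \<Phi> (gavg t f z) + t * gavg t (energy f D) z"
proof -
  define C where "C = (LINT y|gauss. err y) + \<bar>K\<bar> * (LINT y|gauss. norm (y::'a) ^ 1)"
  have steps: "gavg (real m * s) (\<lambda>x. \<Phi> (f x)) z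
      \<le> \<Phi> (gavg (real m * s) f z) + real m * s * gavg (real m * s) (energy f D) z + real m * (C * (s * sqrt s))"
    if "N f D" and s: "0 < s" "s \<le> 1" for f D z m s
    using that(1)
  proof (induction m arbitrary: f D)
    case 0
    then show ?case by simp
  next
    case (Suc m)
    note N = Suc.prems
    note Ng = N_gavg[OF N less_imp_le[OF s(1)]]
    have ms: "real (Suc m) * s = real m * s + s" "real m * s \<ge> 0" using s by (simp_all add: algebra_simps)
    note g\<Phi> = N_growth[OF N] and ge = energy_growth[OF N] and gf = C11_quad_growth(1)[OF N_C11[OF N]]
    have "gavg (real m * s + s) (\<lambda>x. \<Phi> (f x)) z = gavg (real m * s) (gavg s (\<lambda>x. \<Phi> (f x))) z"
      by (simp add: gavg_gavg[OF g\<Phi> ms(2) s(1)])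
    also have "\<dots> \<le> gavg (real m * s) (\<lambda>x. \<Phi> (gavg s f x) + s * gavg s (energy f D) x + C * (s * sqrt s)) z"
      using one_step[OF N s]
      by (intro gavg_mono quad_growth_add quad_growth_cmult quad_growth_gavg g\<Phi> ge N_growth[OF Ng])
        (auto simp: C_def intro!: quad_growth_bounded)
    also have "\<dots> = gavg (real m * s) (\<lambda>x. \<Phi> (gavg s f x)) z + s * gavg (real m * s) (gavg s (energy f D)) z + C * (s * sqrt s)"
    proof -
      have qc: "quad_growth (\<lambda>x::'a. C * (s * sqrt s))" by (rule quad_growth_bounded) auto
      note q1 = N_growth[OF Ng] and q2 = quad_growth_cmult[OF quad_growth_gavg[OF ge, of s], of s]
      show ?thesis
        by (simp only: gavg_add[OF quad_growth_add[OF q1 q2] qc] gavg_add[OF q1 q2] gavg_cmult gavg_const)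
    qed
    also have "gavg (real m * s) (gavg s (energy f D)) z = gavg (real m * s + s) (energy f D) z"
      by (simp add: gavg_gavg[OF ge ms(2) s(1)])
    also have "gavg (real m * s) (\<lambda>x. \<Phi> (gavg s f x)) z
      \<le> \<Phi> (gavg (real m * s) (gavg s f) z) + real m * s * gavg (real m * s) (energy (gavg s f) (gavg s D)) z
        + real m * (C * (s * sqrt s))"
      by (rule Suc.IH[OF Ng])
    also have "gavg (real m * s) (gavg s f) z = gavg (real m * s + s) f z"
      by (simp add: gavg_gavg[OF gf ms(2) s(1)])
    also have "real m * s * gavg (real m * s) (energy (gavg s f) (gavg s D)) z
      \<le> real m * s * gavg (real m * s + s) (energy f D) z"
    proof (rule mult_left_mono[OF _ ms(2)])
      have "gavg (real m * s) (energy (gavg s f) (gavg s D)) z \<le> gavg (real m * s) (gavg s (energy f D)) z"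
        using s by (intro gavg_mono energy_growth[OF Ng] quad_growth_gavg ge energy_gavg[OF N]) auto
      then show "gavg (real m * s) (energy (gavg s f) (gavg s D)) z \<le> gavg (real m * s + s) (energy f D) z"
        by (simp add: gavg_gavg[OF ge ms(2) s(1)])
    qed
    finally show ?case unfolding ms(1) by (simp add: algebra_simps)
  qed
  have ev: "\<forall>\<^sub>F m in sequentially. gavg t (\<lambda>x. \<Phi> (f x)) z
      \<le> \<Phi> (gavg t f z) + t * gavg t (energy f D) z + C * t * sqrt (t / real m)"
    using eventually_ge_at_top[of "nat \<lceil>t\<rceil> + 1"]
  proof eventually_elim
    case (elim m)
    then have m: "real m \<ge> t" "real m > 0" using t by linarith+
    have s: "0 < t / real m" "t / real m \<le> 1" "real m * (t / real m) = t" using m t by auto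
    have "real m * (C * ((t / real m) * sqrt (t / real m))) = C * (real m * (t / real m)) * sqrt (t / real m)"
      by simp
    then show ?case using steps[OF N s(1,2), of m z] unfolding s(3) by simp
  qed
  have "(\<lambda>m. \<Phi> (gavg t f z) + t * gavg t (energy f D) z + C * t * sqrt (t / real m))
      \<longlonglongrightarrow> \<Phi> (gavg t f z) + t * gavg t (energy f D) z + C * t * sqrt 0"
    by (intro tendsto_add tendsto_const tendsto_mult tendsto_real_sqrt lim_const_over_n)
  then have "gavg t (\<lambda>x. \<Phi> (f x)) z \<le> \<Phi> (gavg t f z) + t * gavg t (energy f D) z + C * t * sqrt 0"
    by (rule tendsto_lowerbound[OF _ ev]) simp
  then show ?thesis by simp
qed

end

section \<open>Poincare and logarithmic Sobolev inequalities\<close>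

lemma quad_growth_inner:
  assumes "quad_growth D"
  shows "quad_growth (\<lambda>x. D x \<bullet> (m::'a::euclidean_space))"
proof -
  obtain C where C: "\<And>x. norm (D x) \<le> C * (1 + (norm x)\<^sup>2)" using assms unfolding quad_growth_def by blast
  note [measurable] = quad_growth_measurable[OF assms]
  show ?thesis
  proof (rule quad_growthI)
    fix x
    have "norm (D x \<bullet> m) \<le> norm (D x) * norm m" by (simp add: Cauchy_Schwarz_ineq2)
    also have "\<dots> \<le> (C * (1 + (norm x)\<^sup>2)) * norm m" by (intro mult_right_mono C) simp
    finally show "norm (D x \<bullet> m) \<le> (C * norm m) * (1 + (norm x)\<^sup>2)" by (simp add: mult_ac)
  qed measurable
qed

lemma quad_growth_fisher:
  assumes "f \<in> borel_measurable borel" "\<And>x. \<alpha> \<le> f x" "0 < \<alpha>"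
    and "D \<in> borel_measurable borel" "\<And>x. norm (D x) \<le> L"
  shows "quad_growth (\<lambda>z. (norm (D z :: 'b::euclidean_space))\<^sup>2 / f z)"
proof (rule quad_growth_bounded[of _ "L\<^sup>2 / \<alpha>"])
  note [measurable] = assms(1,4)
  show "(\<lambda>z. (norm (D z))\<^sup>2 / f z) \<in> borel_measurable borel" by measurable
  show "norm ((norm (D x))\<^sup>2 / f x) \<le> L\<^sup>2 / \<alpha>" for x
  proof -
    have "f x > 0" using assms(2)[of x] assms(3) by simp
    moreover have "(norm (D x))\<^sup>2 \<le> L\<^sup>2" using assms(5)[of x] by (intro power_mono) auto
    ultimately show ?thesis using assms(2)[of x] assms(3) by (simp add: frac_le)
  qed
qed

text \<open>The Jensen gap of the jointly convex function \<open>(a, r) \<mapsto> |a|\<^sup>2 / r\<close> is a weighted variance: with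
  \<open>m = E D / E f\<close> one has \<open>f |D/f - m|\<^sup>2 = |D|\<^sup>2/f - 2 D \<bullet> m + f |m|\<^sup>2\<close>, and the last two terms have mean
  \<open>- |E D|\<^sup>2 / E f\<close>. This equality, and not only Jensen's inequality, is what makes the deficit visible.\<close>

lemma gavg_perspective:
  fixes f :: "'a::euclidean_space \<Rightarrow> real" and D :: "'a \<Rightarrow> 'b::euclidean_space" and t x
  assumes f: "quad_growth f" "\<And>x. \<alpha> \<le> f x" "0 < \<alpha>"
    and D: "D \<in> borel_measurable borel" "\<And>x. norm (D x) \<le> L"
  defines "m \<equiv> gavg t D x /\<^sub>R gavg t f x"
  shows "quad_growth (\<lambda>z. f z * (norm (D z /\<^sub>R f z - m))\<^sup>2)" (is ?qg)
    and "gavg t (\<lambda>z. (norm (D z))\<^sup>2 / f z) x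
      = (norm (gavg t D x))\<^sup>2 / gavg t f x + gavg t (\<lambda>z. f z * (norm (D z /\<^sub>R f z - m))\<^sup>2) x" (is ?eq)
proof -
  note q1 = quad_growth_fisher[OF quad_growth_measurable[OF f(1)] f(2,3) D]
  have qD: "quad_growth D" by (rule quad_growth_bounded[OF D])
  note q2 = quad_growth_cmult[OF quad_growth_inner[OF qD, of m], of 2]
  note q3 = quad_growth_cmult[OF f(1), of "(norm m)\<^sup>2"]
  have fpos: "gavg t f x > 0" using gavg_ge[OF f(1,2), of t x] f(3) by simp
  have eq: "(\<lambda>z. f z * (norm (D z /\<^sub>R f z - m))\<^sup>2)
      = (\<lambda>z. ((norm (D z))\<^sup>2 / f z - 2 * (D z \<bullet> m)) + (norm m)\<^sup>2 * f z)"
  proof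
    fix z
    have "f z > 0" using f(2)[of z] f(3) by simp
    moreover have "(norm (D z /\<^sub>R f z - m))\<^sup>2 = (D z \<bullet> D z) / (f z)\<^sup>2 - 2 * (D z \<bullet> m) / f z + (m \<bullet> m)"
      unfolding power2_norm_eq_inner
      by (simp add: inner_diff_left inner_diff_right inner_commute divide_inverse power2_eq_square)
    ultimately show "f z * (norm (D z /\<^sub>R f z - m))\<^sup>2 = ((norm (D z))\<^sup>2 / f z - 2 * (D z \<bullet> m)) + (norm m)\<^sup>2 * f z"
      unfolding power2_norm_eq_inner by (simp add: field_simps power2_eq_square)
  qed
  show ?qg unfolding eq by (intro quad_growth_add quad_growth_diff q1 q2 q3)
  have "gavg t (\<lambda>z. f z * (norm (D z /\<^sub>R f z - m))\<^sup>2) x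
      = gavg t (\<lambda>z. (norm (D z))\<^sup>2 / f z) x - 2 * (gavg t D x \<bullet> m) + (norm m)\<^sup>2 * gavg t f x"
    unfolding eq gavg_add[OF quad_growth_diff[OF q1 q2] q3] gavg_diff[OF q1 q2]
    by (simp only: gavg_cmult gavg_inner[OF qD])
  also have "gavg t D x \<bullet> m = (norm (gavg t D x))\<^sup>2 / gavg t f x"
    by (simp add: m_def power2_norm_eq_inner divide_inverse mult.commute)
  also have "(norm m)\<^sup>2 * gavg t f x = (norm (gavg t D x))\<^sup>2 / gavg t f x"
    using fpos by (simp add: m_def power_mult_distrib power2_eq_square field_simps)
  finally show ?eq by simp
qed

lemma norm_gavg_square_le:
  fixes D :: "'a::euclidean_space \<Rightarrow> 'b::euclidean_space"
  assumes D: "D \<in> borel_measurable borel" "\<And>x. norm (D x) \<le> L"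
  shows "(norm (gavg t D x))\<^sup>2 \<le> gavg t (\<lambda>z. (norm (D z))\<^sup>2) x"
proof -
  have q: "quad_growth (\<lambda>x::'a. 1::real)" by (rule quad_growth_bounded) auto
  have "0 \<le> gavg t (\<lambda>z. 1 * (norm (D z /\<^sub>R 1 - gavg t D x /\<^sub>R gavg t (\<lambda>x::'a. 1::real) x))\<^sup>2) x"
    unfolding gavg_def by (rule integral_nonneg_AE) auto
  then show ?thesis using gavg_perspective(2)[OF q order_refl zero_less_one D, of t x] by simp
qed

lemma norm_gavg_square_div_le:
  fixes f :: "'a::euclidean_space \<Rightarrow> real" and D :: "'a \<Rightarrow> 'b::euclidean_space"
  assumes f: "quad_growth f" "\<And>x. \<alpha> \<le> f x" "0 < \<alpha>"
    and D: "D \<in> borel_measurable borel" "\<And>x. norm (D x) \<le> L"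
  shows "(norm (gavg t D x))\<^sup>2 / gavg t f x \<le> gavg t (\<lambda>z. (norm (D z))\<^sup>2 / f z) x"
proof -
  have "0 \<le> f z" for z using f(2)[of z] f(3) by simp
  then have "0 \<le> gavg t (\<lambda>z. f z * (norm (D z /\<^sub>R f z - gavg t D x /\<^sub>R gavg t f x))\<^sup>2) x"
    unfolding gavg_def by (intro integral_nonneg_AE) auto
  then show ?thesis using gavg_perspective(2)[OF assms, of t x] by simp
qed

lemma poincare_C11:
  fixes f :: "'a::euclidean_space \<Rightarrow> real"
  assumes "C11 L f D" "0 < t"
  shows "gavg t (\<lambda>x. (f x)\<^sup>2) z \<le> (gavg t f z)\<^sup>2 + t * gavg t (\<lambda>x. (norm (D x))\<^sup>2) z"
proof -
  interpret phi_entropy "\<lambda>r. r\<^sup>2" "\<lambda>c. 2 * c" "\<lambda>c. 1" UNIV 0 1 "2 * L\<^sup>2" L "\<lambda>f D. C11 L (f :: 'a \<Rightarrow> real) D"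
  proof
    fix r c :: real
    show "c\<^sup>2 + 2 * c * (r - c) \<le> r\<^sup>2" using zero_le_power2[of "r - c"]
      by (simp add: power2_eq_square algebra_simps)
    show "r\<^sup>2 \<le> c\<^sup>2 + 2 * c * (r - c) + 1 * (r - c)\<^sup>2 + 0 * \<bar>r - c\<bar> ^ 3"
      by (simp add: power2_eq_square algebra_simps)
  next
    fix f :: "'a \<Rightarrow> real" and D assume N: "C11 L f D"
    show "quad_growth (\<lambda>x. (f x)\<^sup>2)" by (rule C11_quad_growth(4)[OF N])
    show "C11 L (gavg t f) (gavg t D)" for t by (rule C11_gavg[OF N])
    fix x z t
    show "1 * (norm (gavg t D x))\<^sup>2 \<le> gavg t (\<lambda>x. 1 * (norm (D x))\<^sup>2) x"
      using norm_gavg_square_le[OF C11_measurable(2)[OF N] C11D(3)[OF N]] by simp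
    show "\<bar>1 * (norm (D x))\<^sup>2 - 1 * (norm (D z))\<^sup>2\<bar> \<le> 2 * L\<^sup>2 * norm (x - z)"
      using C11_norm_square_lipschitz[OF N, of x z] by (simp add: mult.assoc)
  qed auto
  show ?thesis using entropy_le_energy[OF assms] by simp
qed

lemma ln_le_cubic:
  fixes u :: real
  assumes "u > -1"
  shows "ln (1 + u) \<le> u - u\<^sup>2 / 2 + u ^ 3 / 3"
proof -
  define k where "k = (\<lambda>u::real. u - u\<^sup>2 / 2 + u ^ 3 / 3 - ln (1 + u))"
  have d: "DERIV k v :> v ^ 3 / (1 + v)" if "v > -1" for v
  proof -
    have "DERIV k v :> 1 - v + v\<^sup>2 - 1 / (1 + v)"
      unfolding k_def using that by (auto intro!: derivative_eq_intros simp: field_simps)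
    moreover have "1 - v + v\<^sup>2 - 1 / (1 + v) = v ^ 3 / (1 + v)"
      using that by (simp add: field_simps power2_eq_square power3_eq_cube)
    ultimately show ?thesis by simp
  qed
  have "k 0 \<le> k u"
  proof (cases "u \<ge> 0")
    case True
    show ?thesis
    proof (rule DERIV_nonneg_imp_nondecreasing[OF True])
      fix v assume "0 \<le> v" "v \<le> u"
      then show "\<exists>y. DERIV k v :> y \<and> 0 \<le> y" using d[of v] by (intro exI[of _ "v ^ 3 / (1 + v)"]) auto
    qed
  next
    case False
    then have "u \<le> 0" by simp
    then show ?thesis
    proof (rule DERIV_nonpos_imp_nonincreasing)
      fix v assume "u \<le> v" "v \<le> 0"
      then have "v ^ 3 / (1 + v) \<le> 0" using assms
        by (intro divide_nonpos_pos) (auto simp: power3_eq_cube mult_nonneg_nonpos)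
      then show "\<exists>y. DERIV k v :> y \<and> y \<le> 0" using d[of v] \<open>u \<le> v\<close> assms
        by (intro exI[of _ "v ^ 3 / (1 + v)"]) auto
    qed
  qed
  then show ?thesis by (simp add: k_def)
qed

lemma xlnx_supporting:
  fixes r c :: real
  assumes "0 < r" "0 < c"
  shows "c * ln c + (1 + ln c) * (r - c) \<le> r * ln r"
proof -
  have "ln (c / r) \<le> c / r - 1" using assms by (intro ln_le_minus_one) simp
  then have "r * ln (c / r) \<le> r * (c / r - 1)" using assms by (intro mult_left_mono) auto
  then show ?thesis using assms by (simp add: ln_div algebra_simps)
qed

text \<open>For \<open>r = c (1 + u)\<close> the claim reduces to \<open>(1 + u) ln (1 + u) \<le> u + u\<^sup>2/2 + O(|u|\<^sup>3)\<close>, which follows from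
  the cubic upper bound on \<open>ln (1 + u)\<close>. The fourth power of \<open>u\<close> that appears in the product is reduced
  to the third by \<open>|u| \<le> \<beta> / \<alpha>\<close>.\<close>

lemma xlnx_taylor:
  fixes r c :: real
  assumes r: "\<alpha> \<le> r" "r \<le> \<beta>" and c: "\<alpha> \<le> c" "c \<le> \<beta>" and "0 < \<alpha>"
  shows "r * ln r \<le> c * ln c + (1 + ln c) * (r - c) + 1 / (2 * c) * (r - c)\<^sup>2
    + ((1 + \<beta> / \<alpha>) / \<alpha>\<^sup>2) * \<bar>r - c\<bar> ^ 3"
proof -
  have pos: "r > 0" "c > 0" "\<beta> > 0" using assms by auto
  define u where "u = (r - c) / c"
  have u: "r = c * (1 + u)" "1 + u > 0" "u > -1" using pos by (auto simp: u_def field_simps)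
  have "r / c \<le> \<beta> / \<alpha>" using assms pos by (intro frac_le) auto
  then have uB: "1 + u \<le> \<beta> / \<alpha>" using pos by (simp add: u_def field_simps)
  have B1: "1 \<le> \<beta> / \<alpha>" using assms pos by simp
  have absu: "\<bar>u\<bar> \<le> \<beta> / \<alpha>" using uB u B1 by linarith
  have "(1 + u) * ln (1 + u) \<le> (1 + u) * (u - u\<^sup>2 / 2 + u ^ 3 / 3)"
    using ln_le_cubic[OF u(3)] u by (intro mult_left_mono) auto
  also have "\<dots> = u + u\<^sup>2 / 2 + u ^ 3 * (2 * u - 1) / 6"
    by (simp add: power2_eq_square power3_eq_cube field_simps)
  also have "u ^ 3 * (2 * u - 1) / 6 \<le> (1 + \<beta> / \<alpha>) * \<bar>u\<bar> ^ 3"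
  proof -
    have "u ^ 3 * (2 * u - 1) / 6 \<le> \<bar>u ^ 3 * (2 * u - 1) / 6\<bar>" by simp
    also have "\<dots> = \<bar>u\<bar> ^ 3 * (\<bar>2 * u - 1\<bar> / 6)" by (simp add: abs_mult power_abs)
    also have "\<dots> \<le> \<bar>u\<bar> ^ 3 * (1 + \<beta> / \<alpha>)"
    proof (intro mult_left_mono)
      have "\<bar>2 * u - 1\<bar> \<le> 2 * \<bar>u\<bar> + 1" using abs_triangle_ineq4[of "2 * u" 1] by simp
      moreover define B where "B = \<beta> / \<alpha>"
      ultimately have "\<bar>2 * u - 1\<bar> / 6 \<le> 1 + B" using absu B1 unfolding B_def[symmetric] by simp
      then show "\<bar>2 * u - 1\<bar> / 6 \<le> 1 + \<beta> / \<alpha>" by (simp add: B_def)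
    qed simp
    finally show ?thesis by (simp add: mult.commute)
  qed
  finally have main: "(1 + u) * ln (1 + u) \<le> u + u\<^sup>2 / 2 + (1 + \<beta> / \<alpha>) * \<bar>u\<bar> ^ 3" by simp
  have "r * ln r = c * ln c + (1 + ln c) * (r - c) + c * ((1 + u) * ln (1 + u) - u)"
  proof -
    have "ln r = ln c + ln (1 + u)" using u pos by (simp add: u(1) ln_mult_pos)
    moreover have "r = c + c * u" using u(1) by (simp add: distrib_left)
    ultimately show ?thesis by (simp add: algebra_simps)
  qed
  also have "c * ((1 + u) * ln (1 + u) - u) \<le> c * (u\<^sup>2 / 2 + (1 + \<beta> / \<alpha>) * \<bar>u\<bar> ^ 3)"
    using main pos by (intro mult_left_mono) auto
  also have "\<dots> = 1 / (2 * c) * (r - c)\<^sup>2 + ((1 + \<beta> / \<alpha>) / c\<^sup>2) * \<bar>r - c\<bar> ^ 3"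
    using pos by (simp add: u_def power_divide abs_divide power2_eq_square power3_eq_cube field_simps)
  also have "((1 + \<beta> / \<alpha>) / c\<^sup>2) * \<bar>r - c\<bar> ^ 3 \<le> ((1 + \<beta> / \<alpha>) / \<alpha>\<^sup>2) * \<bar>r - c\<bar> ^ 3"
    using assms pos by (intro mult_right_mono divide_left_mono power_mono) auto
  finally show ?thesis by simp
qed

lemma log_sobolev_C11:
  fixes f :: "'a::euclidean_space \<Rightarrow> real"
  assumes f: "C11 L f D" "\<And>x. \<alpha> \<le> f x" "\<And>x. f x \<le> \<beta>" "0 < \<alpha>" and t: "0 < t"
  shows "quad_growth (\<lambda>x. f x * ln (f x))"
    and "gavg t (\<lambda>x. f x * ln (f x)) z
      \<le> gavg t f z * ln (gavg t f z) + t / 2 * gavg t (\<lambda>x. (norm (D x))\<^sup>2 / f x) z"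
proof -
  define N where "N = (\<lambda>(f :: 'a \<Rightarrow> real) D. C11 L f D \<and> (\<forall>x. f x \<in> {\<alpha>..\<beta>}))"
  have ab: "\<alpha> \<le> \<beta>" using f(2,3)[of 0] by linarith
  have gr: "quad_growth (\<lambda>x. f x * ln (f x))" if "N f D" for f D
  proof (rule quad_growth_bounded)
    have [measurable]: "f \<in> borel_measurable borel" using C11_measurable that by (auto simp: N_def)
    show "(\<lambda>x. f x * ln (f x)) \<in> borel_measurable borel" by measurable
    fix x
    have x: "\<alpha> \<le> f x" "f x \<le> \<beta>" using that by (auto simp: N_def)
    then have "ln \<alpha> \<le> ln (f x)" "ln (f x) \<le> ln \<beta>" using f(4) by auto
    then have "\<bar>ln (f x)\<bar> \<le> \<bar>ln \<alpha>\<bar> + \<bar>ln \<beta>\<bar>" by linarith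
    then show "norm (f x * ln (f x)) \<le> \<beta> * (\<bar>ln \<alpha>\<bar> + \<bar>ln \<beta>\<bar>)"
      using x f(4) by (simp add: abs_mult mult_mono)
  qed
  interpret phi_entropy "\<lambda>r. r * ln r" "\<lambda>c. 1 + ln c" "\<lambda>c. 1 / (2 * c)" "{\<alpha>..\<beta>}"
    "(1 + \<beta> / \<alpha>) / \<alpha>\<^sup>2" "1 / (2 * \<alpha>)" "L\<^sup>2 / \<alpha> + L ^ 3 / (2 * \<alpha>\<^sup>2)" L N
  proof
    fix r c assume rc: "r \<in> {\<alpha>..\<beta>}" "c \<in> {\<alpha>..\<beta>}"
    show "c * ln c + (1 + ln c) * (r - c) \<le> r * ln r"
      using rc f(4) by (intro xlnx_supporting) auto
    show "r * ln r \<le> c * ln c + (1 + ln c) * (r - c) + 1 / (2 * c) * (r - c)\<^sup>2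
        + ((1 + \<beta> / \<alpha>) / \<alpha>\<^sup>2) * \<bar>r - c\<bar> ^ 3"
      using rc f(4) by (intro xlnx_taylor) auto
    show "0 \<le> 1 / (2 * c)" "1 / (2 * c) \<le> 1 / (2 * \<alpha>)" using rc f(4) by (auto intro!: divide_left_mono)
  next
    show "0 \<le> (1 + \<beta> / \<alpha>) / \<alpha>\<^sup>2" using f(4) ab by auto
  next
    fix f :: "'a \<Rightarrow> real" and D assume N: "N f D"
    show C: "C11 L f D" using N by (simp add: N_def)
    show I: "f x \<in> {\<alpha>..\<beta>}" for x using N by (simp add: N_def)
    then have I': "\<alpha> \<le> f x" "f x \<le> \<beta>" "0 < f x" for x using f(4) by (auto intro: less_le_trans)
    show "quad_growth (\<lambda>x. f x * ln (f x))" by (rule gr[OF N])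
    fix t :: real
    show "N (gavg t f) (gavg t D)"
      using C11_gavg[OF C] gavg_ge[OF C11_quad_growth(1)[OF C] I'(1)] gavg_le[OF C11_quad_growth(1)[OF C] I'(2)]
      by (simp add: N_def)
    fix x z
    have "(norm (gavg t D x))\<^sup>2 / gavg t f x \<le> gavg t (\<lambda>z. (norm (D z))\<^sup>2 / f z) x"
      by (rule norm_gavg_square_div_le[OF C11_quad_growth(1)[OF C] I'(1) f(4) C11_measurable(2)[OF C] C11D(3)[OF C]])
    then have "1 / 2 * ((norm (gavg t D x))\<^sup>2 / gavg t f x) \<le> 1 / 2 * gavg t (\<lambda>z. (norm (D z))\<^sup>2 / f z) x" by simp
    also have "\<dots> = gavg t (\<lambda>z. 1 / 2 * ((norm (D z))\<^sup>2 / f z)) x" by (rule gavg_cmult[symmetric])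
    finally show "1 / (2 * gavg t f x) * (norm (gavg t D x))\<^sup>2 \<le> gavg t (\<lambda>x. 1 / (2 * f x) * (norm (D x))\<^sup>2) x"
      by (simp add: field_simps)
    let ?d = "norm (x - z)"
    have L: "0 \<le> L" by (rule C11D(5)[OF C])
    note n1 = C11_norm_square_lipschitz[OF C, of x z]
    have "1 / (2 * f x) * (norm (D x))\<^sup>2 - 1 / (2 * f z) * (norm (D z))\<^sup>2
      = ((norm (D x))\<^sup>2 - (norm (D z))\<^sup>2) / (2 * f x) + (norm (D z))\<^sup>2 * (f z - f x) / (2 * (f x * f z))"
      using I'(3)[of x] I'(3)[of z] by (simp add: field_simps)
    also have "\<bar>\<dots>\<bar> \<le> \<bar>((norm (D x))\<^sup>2 - (norm (D z))\<^sup>2) / (2 * f x)\<bar> + \<bar>(norm (D z))\<^sup>2 * (f z - f x) / (2 * (f x * f z))\<bar>"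
      by (rule abs_triangle_ineq)
    also have "\<bar>((norm (D x))\<^sup>2 - (norm (D z))\<^sup>2) / (2 * f x)\<bar> \<le> (2 * (L\<^sup>2 * ?d)) / (2 * \<alpha>)"
      unfolding abs_divide using I'[of x] f(4) n1 by (intro frac_le) auto
    also have "\<bar>(norm (D z))\<^sup>2 * (f z - f x) / (2 * (f x * f z))\<bar> \<le> (L\<^sup>2 * (L * ?d)) / (2 * (\<alpha> * \<alpha>))"
      unfolding abs_divide abs_mult
    proof (intro frac_le mult_mono)
      show "\<bar>f z - f x\<bar> \<le> L * ?d" using C11D(2)[OF C, of x z] by (simp add: abs_minus_commute)
      show "\<bar>(norm (D z))\<^sup>2\<bar> \<le> L\<^sup>2" using C11D(3)[OF C, of z] by (simp add: power_mono)
    qed (use I'[of x] I'[of z] f(4) L in auto)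
    finally show "\<bar>1 / (2 * f x) * (norm (D x))\<^sup>2 - 1 / (2 * f z) * (norm (D z))\<^sup>2\<bar>
        \<le> (L\<^sup>2 / \<alpha> + L ^ 3 / (2 * \<alpha>\<^sup>2)) * ?d"
      by (simp add: field_simps power2_eq_square power3_eq_cube)
  qed
  have N: "N f D" using f by (simp add: N_def)
  show "quad_growth (\<lambda>x. f x * ln (f x))" by (rule gr[OF N])
  have "gavg t (energy f D) z = gavg t (\<lambda>x. 1 / 2 * ((norm (D x))\<^sup>2 / f x)) z" by (simp add: field_simps)
  also have "\<dots> = 1 / 2 * gavg t (\<lambda>x. (norm (D x))\<^sup>2 / f x) z" by (rule gavg_cmult)
  finally show "gavg t (\<lambda>x. f x * ln (f x)) z
      \<le> gavg t f z * ln (gavg t f z) + t / 2 * gavg t (\<lambda>x. (norm (D x))\<^sup>2 / f x) z"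
    using entropy_le_energy[OF N t, of z] by (simp only: times_divide_eq_left mult_1 divide_divide_eq_left)
qed

lemma ln_estimates:
  fixes r c :: real
  assumes "\<alpha> \<le> r" "\<alpha> \<le> c" "0 < \<alpha>"
  shows "\<bar>ln r - ln c\<bar> \<le> \<bar>r - c\<bar> / \<alpha>"
    and "\<bar>ln r - ln c - (r - c) / c\<bar> \<le> (r - c)\<^sup>2 / \<alpha>\<^sup>2"
proof -
  have pos: "r > 0" "c > 0" using assms by auto
  have up: "ln r - ln c \<le> (r - c) / c"
    using ln_le_minus_one[of "r / c"] pos by (simp add: ln_div diff_divide_distrib)
  have lo: "(r - c) / r \<le> ln r - ln c"
    using ln_le_minus_one[of "c / r"] pos by (simp add: ln_div diff_divide_distrib)
  have "(r - c) / c \<le> \<bar>r - c\<bar> / \<alpha>"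
    using assms pos by (intro order_trans[OF divide_right_mono[OF abs_ge_self] divide_left_mono]) auto
  moreover have "- ((r - c) / r) \<le> \<bar>r - c\<bar> / \<alpha>"
  proof -
    have "- ((r - c) / r) = (c - r) / r" by (simp add: minus_divide_left)
    also have "\<dots> \<le> \<bar>r - c\<bar> / r" using pos by (intro divide_right_mono) auto
    also have "\<dots> \<le> \<bar>r - c\<bar> / \<alpha>" using assms pos by (intro divide_left_mono) auto
    finally show ?thesis .
  qed
  ultimately show "\<bar>ln r - ln c\<bar> \<le> \<bar>r - c\<bar> / \<alpha>" using up lo by linarith
  have "(r - c) / c - (r - c) / r = (r - c)\<^sup>2 / (r * c)"
    using pos by (simp add: field_simps power2_eq_square)
  also have "\<dots> \<le> (r - c)\<^sup>2 / (\<alpha> * \<alpha>)"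
    using assms pos by (intro divide_left_mono mult_mono) auto
  finally show "\<bar>ln r - ln c - (r - c) / c\<bar> \<le> (r - c)\<^sup>2 / \<alpha>\<^sup>2"
    using up lo by (simp add: power2_eq_square)
qed

text \<open>The first two derivatives of the logarithm are bounded on the half-line \<open>[\<alpha>, \<infinity>)\<close>.\<close>

lemma C11_ln:
  assumes f: "C11 L f D" "\<And>x. \<alpha> \<le> f x" "0 < \<alpha>"
  shows "C11 (L / \<alpha> + L\<^sup>2 / \<alpha>\<^sup>2) (\<lambda>x. ln (f x)) (\<lambda>x. D x /\<^sub>R f x)"
  unfolding C11_def
proof (intro conjI allI)
  note c = C11D[OF f(1)]
  have L: "0 \<le> L / \<alpha>" "0 \<le> L\<^sup>2 / \<alpha>\<^sup>2" using c(5) f(3) by auto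
  fix x y v
  have fx: "0 < f x" "0 < f y" "\<alpha> \<le> f x" "\<alpha> \<le> f y" using f(2)[of x] f(2)[of y] f(3) by auto
  let ?r = "f (x + v)"
  have "\<bar>ln ?r - ln (f x) - (D x /\<^sub>R f x) \<bullet> v\<bar>
      \<le> \<bar>ln ?r - ln (f x) - (?r - f x) / f x\<bar> + \<bar>(?r - f x - D x \<bullet> v) / f x\<bar>"
  proof -
    have "ln ?r - ln (f x) - (D x /\<^sub>R f x) \<bullet> v
        = (ln ?r - ln (f x) - (?r - f x) / f x) + (?r - f x - D x \<bullet> v) / f x"
      by (simp add: divide_inverse algebra_simps)
    then show ?thesis by (rule ssubst) (rule abs_triangle_ineq)
  qed
  also have "\<bar>ln ?r - ln (f x) - (?r - f x) / f x\<bar> \<le> (?r - f x)\<^sup>2 / \<alpha>\<^sup>2"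
    by (rule ln_estimates(2)[OF f(2) f(2) f(3)])
  also have "(?r - f x)\<^sup>2 / \<alpha>\<^sup>2 \<le> (L * norm v)\<^sup>2 / \<alpha>\<^sup>2"
  proof (rule divide_right_mono)
    have "\<bar>?r - f x\<bar>\<^sup>2 \<le> (L * norm v)\<^sup>2"
      using c(2)[of "x + v" x] by (intro power_mono) auto
    then show "(?r - f x)\<^sup>2 \<le> (L * norm v)\<^sup>2" by simp
  qed simp
  also have "\<bar>(?r - f x - D x \<bullet> v) / f x\<bar> \<le> (L * (norm v)\<^sup>2) / \<alpha>"
    unfolding abs_divide using c(1)[of x v] fx f(3) by (intro frac_le) auto
  finally show "\<bar>ln ?r - ln (f x) - (D x /\<^sub>R f x) \<bullet> v\<bar> \<le> (L / \<alpha> + L\<^sup>2 / \<alpha>\<^sup>2) * (norm v)\<^sup>2"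
    by (simp add: power_mult_distrib algebra_simps)
  have "\<bar>ln (f x) - ln (f y)\<bar> \<le> \<bar>f x - f y\<bar> / \<alpha>" by (rule ln_estimates(1)[OF f(2) f(2) f(3)])
  also have "\<dots> \<le> (L * norm (x - y)) / \<alpha>" using c(2)[of x y] f(3) by (intro divide_right_mono) auto
  also have "\<dots> \<le> (L / \<alpha> + L\<^sup>2 / \<alpha>\<^sup>2) * norm (x - y)"
    using L(2) by (simp add: distrib_right)
  finally show "\<bar>ln (f x) - ln (f y)\<bar> \<le> (L / \<alpha> + L\<^sup>2 / \<alpha>\<^sup>2) * norm (x - y)" .
  have nd: "norm (w /\<^sub>R f x) = norm w / f x" for w :: 'a
    using fx by (simp add: divide_inverse mult.commute)
  have "norm (D x /\<^sub>R f x) \<le> L / \<alpha>"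
    unfolding nd using c(3)[of x] fx f(3) c(5) by (intro frac_le) auto
  then show "norm (D x /\<^sub>R f x) \<le> L / \<alpha> + L\<^sup>2 / \<alpha>\<^sup>2" using L(2) by linarith
  have "D x /\<^sub>R f x - D y /\<^sub>R f y = (D x - D y) /\<^sub>R f x + ((f y - f x) / (f x * f y)) *\<^sub>R D y"
  proof -
    have "(f y - f x) / (f x * f y) = inverse (f x) - inverse (f y)" using fx by (simp add: field_simps)
    then show ?thesis by (simp only: scaleR_diff_right scaleR_diff_left) simp
  qed
  also have "norm \<dots> \<le> norm ((D x - D y) /\<^sub>R f x) + norm (((f y - f x) / (f x * f y)) *\<^sub>R D y)"
    by (rule norm_triangle_ineq)
  also have "norm ((D x - D y) /\<^sub>R f x) \<le> (L * norm (x - y)) / \<alpha>"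
    unfolding nd using c(4)[of x y] fx f(3) c(5) by (intro frac_le) auto
  also have "norm (((f y - f x) / (f x * f y)) *\<^sub>R D y) = \<bar>f y - f x\<bar> * norm (D y) / (f x * f y)"
    using fx by (simp add: abs_mult)
  also have "\<dots> \<le> ((L * norm (x - y)) * L) / (\<alpha> * \<alpha>)"
    using c(2)[of y x] c(3)[of y] c(5) fx f(3) by (intro frac_le mult_mono) (auto simp: norm_minus_commute)
  finally show "norm (D x /\<^sub>R f x - D y /\<^sub>R f y) \<le> (L / \<alpha> + L\<^sup>2 / \<alpha>\<^sup>2) * norm (x - y)"
    by (simp add: algebra_simps power2_eq_square)
qed

lemma C11_minus_affine:
  assumes f: "C11 L f D"
  shows "C11 (L + norm m) (\<lambda>x. f x - m \<bullet> x - c) (\<lambda>x. D x - m)"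
  unfolding C11_def
proof (intro conjI allI)
  note c = C11D[OF f]
  fix x y v
  have "f (x + v) - m \<bullet> (x + v) - c - (f x - m \<bullet> x - c) - (D x - m) \<bullet> v = f (x + v) - f x - D x \<bullet> v"
    by (simp add: inner_simps)
  then show "\<bar>f (x + v) - m \<bullet> (x + v) - c - (f x - m \<bullet> x - c) - (D x - m) \<bullet> v\<bar> \<le> (L + norm m) * (norm v)\<^sup>2"
    using c(1)[of x v] by (simp add: distrib_right add_increasing2)
  have "f x - m \<bullet> x - c - (f y - m \<bullet> y - c) = (f x - f y) - m \<bullet> (x - y)"
    by (simp add: inner_simps)
  then show "\<bar>f x - m \<bullet> x - c - (f y - m \<bullet> y - c)\<bar> \<le> (L + norm m) * norm (x - y)"
    using c(2)[of x y] Cauchy_Schwarz_ineq2[of m "x - y"] by (simp add: distrib_right)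
  show "norm (D x - m) \<le> L + norm m" using c(3)[of x] norm_triangle_ineq4[of "D x" m] by linarith
  have "L * norm (x - y) \<le> (L + norm m) * norm (x - y)" by (intro mult_right_mono) auto
  then show "norm (D x - m - (D y - m)) \<le> (L + norm m) * norm (x - y)" using c(4)[of x y] by simp
qed

section \<open>Oscillation of the logarithmic gradient\<close>

text \<open>The deficit without the requirement that \<open>f\<close> have total mass \<open>1\<close>, homogeneous of degree one in \<open>(f, D)\<close>.\<close>

definition C11_deficit :: "('a::euclidean_space \<Rightarrow> real) \<Rightarrow> ('a \<Rightarrow> 'a) \<Rightarrow> real" where
  "C11_deficit f D = gavg 1 (\<lambda>x. (norm (D x))\<^sup>2 / f x) 0 / 2
     - (gavg 1 (\<lambda>x. f x * ln (f x)) 0 - gavg 1 f 0 * ln (gavg 1 f 0))"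

text \<open>The logarithmic Sobolev inequality is applied with variance \<open>1/2\<close> twice: to \<open>f\<close> around each point
  \<open>x\<close>, and to the average \<open>gavg (1/2) f\<close>. The Fisher informations of \<open>f\<close> and of this average enter
  with weight \<open>1/4\<close> each, and the second one falls short of the Fisher information of \<open>f\<close> by the mean of \<open>G\<close>.\<close>

theorem deficit_controls_gradient_fluctuation:
  fixes f :: "'a::euclidean_space \<Rightarrow> real"
  assumes f: "C11 L f D" "\<And>x. \<alpha> \<le> f x" "\<And>x. f x \<le> \<beta>" "0 < \<alpha>"
  defines "m \<equiv> \<lambda>x. gavg (1/2) D x /\<^sub>R gavg (1/2) f x"
  defines "G \<equiv> \<lambda>x. gavg (1/2) (\<lambda>z. f z * (norm (D z /\<^sub>R f z - m x))\<^sup>2) x"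
  shows "quad_growth G" and "gavg (1/2) G 0 \<le> 4 * C11_deficit f D"
proof -
  note qf = C11_quad_growth(1)[OF f(1)]
  note qE = quad_growth_fisher[OF C11_measurable(1)[OF f(1)] f(2,4) C11_measurable(2)[OF f(1)] C11D(3)[OF f(1)]]
  let ?E = "\<lambda>x. (norm (D x))\<^sup>2 / f x"
  let ?h = "1/2 :: real"
  note g = C11_gavg[OF f(1), of ?h]
  note ga = gavg_ge[OF qf f(2), of ?h] and gb = gavg_le[OF qf f(3), of ?h]
  note qE2 = quad_growth_fisher[OF C11_measurable(1)[OF g] ga f(4) C11_measurable(2)[OF g] C11D(3)[OF g]]
  let ?E2 = "\<lambda>x. (norm (gavg ?h D x))\<^sup>2 / gavg ?h f x"
  have G: "G = (\<lambda>x. gavg ?h ?E x - ?E2 x)"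
    unfolding G_def m_def
    using gavg_perspective(2)[OF qf f(2,4) C11_measurable(2)[OF f(1)] C11D(3)[OF f(1)]] by auto
  show "quad_growth G" unfolding G by (intro quad_growth_diff quad_growth_gavg qE qE2)
  have comb: "gavg ?h (gavg ?h \<phi>) 0 = gavg 1 \<phi> 0" if "quad_growth \<phi>" for \<phi> :: "'a \<Rightarrow> real"
    using gavg_gavg[OF that, of ?h ?h] by simp
  note l1 = log_sobolev_C11[OF f, of ?h]
  note l2 = log_sobolev_C11[OF g ga gb f(4), of ?h]
  have q\<Phi>: "quad_growth (\<lambda>x. f x * ln (f x))" using l1(1) by simp
  have q\<Phi>2: "quad_growth (\<lambda>x. gavg ?h f x * ln (gavg ?h f x))" using l2(1) by simp
  have "gavg 1 (\<lambda>x. f x * ln (f x)) 0 = gavg ?h (gavg ?h (\<lambda>x. f x * ln (f x))) 0"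
    by (rule comb[OF q\<Phi>, symmetric])
  also have "\<dots> \<le> gavg ?h (\<lambda>x. gavg ?h f x * ln (gavg ?h f x) + ?h / 2 * gavg ?h ?E x) 0"
    using l1(2) by (intro gavg_mono quad_growth_gavg quad_growth_add quad_growth_cmult q\<Phi> q\<Phi>2 qE) simp
  also have "\<dots> = gavg ?h (\<lambda>x. gavg ?h f x * ln (gavg ?h f x)) 0 + ?h / 2 * gavg 1 ?E 0"
    unfolding gavg_add[OF q\<Phi>2 quad_growth_cmult[OF quad_growth_gavg[OF qE]]] gavg_cmult comb[OF qE] ..
  finally have s1: "gavg 1 (\<lambda>x. f x * ln (f x)) 0
      \<le> gavg ?h (\<lambda>x. gavg ?h f x * ln (gavg ?h f x)) 0 + ?h / 2 * gavg 1 ?E 0" .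
  have s2: "gavg ?h (\<lambda>x. gavg ?h f x * ln (gavg ?h f x)) 0
      \<le> gavg 1 f 0 * ln (gavg 1 f 0) + ?h / 2 * gavg ?h ?E2 0"
    using l2(2)[of 0] unfolding comb[OF qf] by simp
  have "gavg ?h ?E2 0 = gavg 1 ?E 0 - gavg ?h G 0"
    unfolding G gavg_diff[OF quad_growth_gavg[OF qE] qE2] comb[OF qE] by simp
  note s3 = this
  have arith: "g \<le> 4 * (E / 2 - (X - Z))" if "X \<le> Y + ?h / 2 * E" "Y \<le> Z + ?h / 2 * E2" "E2 = E - g"
    for X Y Z E E2 g :: real using that by (simp add: field_simps)
  show "gavg ?h G 0 \<le> 4 * C11_deficit f D"
    unfolding C11_deficit_def by (rule arith[OF s1 s2 s3])
qed

lemma gavg_affine: "gavg t (\<lambda>z. m \<bullet> z) x = m \<bullet> (x::'a::euclidean_space)"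
proof -
  have "integrable gauss (\<lambda>y::'a. sqrt t * (m \<bullet> y))"
    by (intro integrable_mult_right integrable_inner_right integrable_gauss_ident)
  moreover have "(LINT y|gauss. m \<bullet> (y::'a)) = m \<bullet> (LINT y|gauss. y)"
    by (rule integral_inner_right[OF integrable_gauss_ident])
  ultimately show ?thesis
    unfolding gavg_def by (simp add: inner_add_right gauss.prob_space[simplified] integral_gauss_ident)
qed

text \<open>A Chebyshev argument selects \<open>x\<close>: the sum of \<open>G / (4 e)\<close>, half the average of \<open>f\<close>, and
  \<open>|x|\<^sup>2\<close> divided by the dimension has mean at most \<open>3\<close>, so it is smaller than \<open>4\<close> somewhere. At this
  point the gradient of \<open>ln f\<close> is close to \<open>m x\<close>, and the Poincare inequality is applied to \<open>ln f\<close> minus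
  the affine function with this slope. The mean \<open>c\<close> of \<open>ln f\<close> is bounded above because \<open>ln f \<le> f\<close>.\<close>

theorem small_deficit_log_almost_affine:
  fixes f :: "'a::euclidean_space \<Rightarrow> real"
  assumes f: "C11 L f D" "\<And>x. \<alpha> \<le> f x" "\<And>x. f x \<le> \<beta>" "0 < \<alpha>"
    and e: "C11_deficit f D \<le> e" "0 < e" and mass: "gavg 1 f 0 \<le> 2"
  obtains x b c where "(norm x)\<^sup>2 \<le> 4 * DIM('a)" and "ln \<alpha> \<le> c" and "c \<le> 8"
    and "integrable gauss (\<lambda>y. (ln (f (x + sqrt (1/2) *\<^sub>R y)) - b \<bullet> y - c)\<^sup>2)"
    and "(LINT y|gauss. (ln (f (x + sqrt (1/2) *\<^sub>R y)) - b \<bullet> y - c)\<^sup>2) \<le> 8 * e / \<alpha>"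
proof -
  let ?h = "1/2 :: real"
  define m where "m = (\<lambda>x. gavg ?h D x /\<^sub>R gavg ?h f x)"
  define G where "G = (\<lambda>x. gavg ?h (\<lambda>z. f z * (norm (D z /\<^sub>R f z - m x))\<^sup>2) x)"
  have G: "quad_growth G" "gavg ?h G 0 \<le> 4 * C11_deficit f D"
    using deficit_controls_gradient_fluctuation[OF f] unfolding G_def m_def by auto
  have fpos: "f x > 0" for x using f(2)[of x] f(4) by simp
  have Gnn: "0 \<le> G x" for x
    unfolding G_def gavg_def using fpos by (intro integral_nonneg_AE AE_I2 mult_nonneg_nonneg) (auto intro: less_imp_le)
  note qf = C11_quad_growth(1)[OF f(1)]
  let ?n = "real DIM('a)"
  have qn: "quad_growth (\<lambda>x::'a. (norm x)\<^sup>2)"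
    by (rule quad_growthI[of _ 1]) auto
  have "\<exists>x. 1 / (4 * e) * G x + (1 / 2 * gavg ?h f x + 1 / ?n * (norm x)\<^sup>2) < 4"
  proof (rule ccontr)
    assume "\<nexists>x. 1 / (4 * e) * G x + (1 / 2 * gavg ?h f x + 1 / ?n * (norm x)\<^sup>2) < 4"
    then have ge: "4 \<le> 1 / (4 * e) * G x + (1 / 2 * gavg ?h f x + 1 / ?n * (norm x)\<^sup>2)" for x
      by (meson not_less)
    note q1 = quad_growth_cmult[OF G(1), of "1 / (4 * e)"]
    note q2 = quad_growth_cmult[OF quad_growth_gavg[OF qf, of ?h], of "1 / 2"]
    note q3 = quad_growth_cmult[OF qn, of "1 / ?n"]
    have "gavg ?h (\<lambda>x::'a. 4::real) 0
        \<le> gavg ?h (\<lambda>x. 1 / (4 * e) * G x + (1 / 2 * gavg ?h f x + 1 / ?n * (norm x)\<^sup>2)) 0"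
      using ge by (intro gavg_mono quad_growth_add q1 q2 q3) (auto intro: quad_growth_bounded)
    also have "\<dots> = 1 / (4 * e) * gavg ?h G 0 + (1 / 2 * gavg 1 f 0 + 1 / ?n * gavg ?h (\<lambda>x::'a. (norm x)\<^sup>2) 0)"
      unfolding gavg_add[OF q1 quad_growth_add[OF q2 q3]] gavg_add[OF q2 q3] gavg_cmult
      using gavg_gavg[OF qf, of ?h ?h] by simp
    also have "1 / (4 * e) * gavg ?h G 0 \<le> 1"
      using G(2) e by (simp add: field_simps)
    also have "gavg ?h (\<lambda>x::'a. (norm x)\<^sup>2) 0 \<le> ?n"
    proof -
      have "gavg ?h (\<lambda>x::'a. (norm x)\<^sup>2) 0 = ?h * (LINT y|gauss. (norm (y::'a))\<^sup>2)"
        unfolding gavg_def by (simp add: power_mult_distrib power_divide)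
      also have "(LINT y|gauss. (norm (y::'a))\<^sup>2) = (LINT y|gauss. (\<Sum>b\<in>Basis. (b \<bullet> (y::'a))\<^sup>2))"
      proof -
        have "(norm y)\<^sup>2 = (\<Sum>b\<in>Basis. (b \<bullet> y)\<^sup>2)" for y :: 'a
          unfolding power2_norm_eq_inner
          by (subst euclidean_inner) (simp add: power2_eq_square inner_commute)
        then show ?thesis by simp
      qed
      also have "\<dots> = (\<Sum>b\<in>Basis. (LINT y|gauss. (b \<bullet> (y::'a))\<^sup>2))"
        by (rule Bochner_Integration.integral_sum) (rule integral_gauss_inner_square)
      also have "\<dots> \<le> (\<Sum>b\<in>(Basis::'a set). 1)"
        using integral_gauss_inner_square(2) by (intro sum_mono order_trans[OF integral_gauss_inner_square(2)]) simp
      finally show ?thesis by simp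
    qed
    finally show False using mass by (simp add: divide_le_eq)
  qed
  then obtain x where x: "1 / (4 * e) * G x + (1 / 2 * gavg ?h f x + 1 / ?n * (norm x)\<^sup>2) < 4" by blast
  have nn: "0 \<le> 1 / (4 * e) * G x" "0 \<le> 1 / ?n * (norm x)\<^sup>2" using Gnn e by auto
  have fx: "0 < gavg ?h f x" using gavg_ge[OF qf f(2), of ?h x] f(4) by simp
  have x1: "G x \<le> 16 * e"
  proof -
    have "1 / (4 * e) * G x < 4" using x nn fx by linarith
    then show ?thesis using e by (simp add: field_simps)
  qed
  have x2: "gavg ?h f x \<le> 8" using x nn fx by linarith
  have x3: "(norm x)\<^sup>2 \<le> 4 * ?n"
  proof -
    have "1 / ?n * (norm x)\<^sup>2 < 4" using x nn fx by linarith
    then show ?thesis by (simp add: field_simps)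
  qed
  let ?L = "L / \<alpha> + L\<^sup>2 / \<alpha>\<^sup>2"
  note h = C11_ln[OF f(1,2,4)]
  note qh = C11_quad_growth(1)[OF h]
  define c where "c = gavg ?h (\<lambda>x. ln (f x)) x"
  \<comment> \<open>the affine function \<open>m x \<bullet> z + k\<close> has the same average around \<open>x\<close> as \<open>ln f\<close>\<close>
  define k where "k = c - m x \<bullet> x"
  note a = C11_minus_affine[OF h, of "m x" k]
  let ?\<phi> = "\<lambda>z. ln (f z) - m x \<bullet> z - k"
  have qm: "quad_growth (\<lambda>z. m x \<bullet> z)"
  proof (rule quad_growthI[of _ "norm (m x)"])
    fix z :: 'a
    have "norm z \<le> 1 + (norm z)\<^sup>2"
      using sum_squares_bound[of 1 "norm z"] norm_ge_zero[of z] unfolding power_one mult_1_right by linarith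
    then have "norm (m x) * norm z \<le> norm (m x) * (1 + (norm z)\<^sup>2)" by (rule mult_left_mono) simp
    then show "norm (m x \<bullet> z) \<le> norm (m x) * (1 + (norm z)\<^sup>2)"
      using Cauchy_Schwarz_ineq2[of "m x" z] by simp
  qed simp
  have qk: "quad_growth (\<lambda>z::'a. k)" by (rule quad_growth_bounded) auto
  have "gavg ?h ?\<phi> x = 0"
    unfolding gavg_diff[OF quad_growth_diff[OF qh qm] qk] gavg_diff[OF qh qm] gavg_affine
    by (simp add: k_def c_def)
  then have P: "gavg ?h (\<lambda>z. (?\<phi> z)\<^sup>2) x \<le> ?h * gavg ?h (\<lambda>z. (norm (D z /\<^sub>R f z - m x))\<^sup>2) x"
    using poincare_C11[OF a, of ?h x] by simp
  have "\<alpha> * gavg ?h (\<lambda>z. (norm (D z /\<^sub>R f z - m x))\<^sup>2) x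
      = gavg ?h (\<lambda>z. \<alpha> * (norm (D z /\<^sub>R f z - m x))\<^sup>2) x" by (rule gavg_cmult[symmetric])
  also have "\<dots> \<le> G x"
    unfolding G_def
  proof (rule gavg_mono)
    show "quad_growth (\<lambda>z. \<alpha> * (norm (D z /\<^sub>R f z - m x))\<^sup>2)"
      by (intro quad_growth_cmult C11_quad_growth(3)[OF a])
    show "quad_growth (\<lambda>z. f z * (norm (D z /\<^sub>R f z - m x))\<^sup>2)"
      unfolding m_def by (rule gavg_perspective(1)[OF qf f(2,4) C11_measurable(2)[OF f(1)] C11D(3)[OF f(1)]])
  qed (intro mult_right_mono f(2) zero_le_power2)
  finally have "gavg ?h (\<lambda>z. (norm (D z /\<^sub>R f z - m x))\<^sup>2) x \<le> 16 * e / \<alpha>"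
    using x1 f(4) by (simp add: field_simps)
  then have P2: "gavg ?h (\<lambda>z. (?\<phi> z)\<^sup>2) x \<le> 8 * e / \<alpha>" using P by simp
  have \<phi>eq: "?\<phi> (x + sqrt ?h *\<^sub>R y) = ln (f (x + sqrt ?h *\<^sub>R y)) - (sqrt ?h *\<^sub>R m x) \<bullet> y - c" for y
    by (simp add: k_def inner_simps)
  have c1: "ln \<alpha> \<le> c"
    unfolding c_def using f(2,4) fpos by (intro gavg_ge qh) simp
  have "c \<le> gavg ?h f x"
    unfolding c_def using ln_le_minus_one[OF fpos] by (intro gavg_mono qh qf) (smt (verit))
  then have c2: "c \<le> 8" using x2 by simp
  show thesis
  proof (rule that[OF _ c1 c2])
    show "(norm x)\<^sup>2 \<le> 4 * DIM('a)" using x3 by simp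
    show "integrable gauss (\<lambda>y. (ln (f (x + sqrt (1/2) *\<^sub>R y)) - (sqrt ?h *\<^sub>R m x) \<bullet> y - c)\<^sup>2)"
      using quad_growth_integrable[OF C11_quad_growth(4)[OF a], of x "sqrt ?h"] unfolding \<phi>eq .
    show "(LINT y|gauss. (ln (f (x + sqrt (1/2) *\<^sub>R y)) - (sqrt ?h *\<^sub>R m x) \<bullet> y - c)\<^sup>2) \<le> 8 * e / \<alpha>"
      using P2 unfolding gavg_def \<phi>eq .
  qed
qed

section \<open>Sequences with vanishing deficit\<close>

text \<open>A Gaussian of variance \<open>1/4\<close> has lighter tails than any translate of the Gaussian of variance \<open>1/2\<close>, so
  it is at most a multiple of each of them, with a factor that is uniform over centers in a ball.\<close>

lemma gdens_le_shifted:
  fixes x z :: "'a::euclidean_space"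
  shows "gdens (2 *\<^sub>R z) \<le> exp (2 * (norm x)\<^sup>2) * gdens ((z - x) /\<^sub>R sqrt (1/2))"
proof -
  have "(norm ((z - x) /\<^sub>R sqrt (1/2)))\<^sup>2 = 2 * (norm (z - x))\<^sup>2"
    by (simp add: power_mult_distrib real_sqrt_divide)
  moreover have "(norm (z - x))\<^sup>2 \<le> 2 * (norm z)\<^sup>2 + 2 * (norm x)\<^sup>2"
    using norm_add_square_le[of z "- x"] by simp
  moreover have "(norm (2 *\<^sub>R z))\<^sup>2 = 4 * (norm z)\<^sup>2" by (simp add: power_mult_distrib)
  ultimately have "- (norm (2 *\<^sub>R z))\<^sup>2 / 2 \<le> 2 * (norm x)\<^sup>2 + - (norm ((z - x) /\<^sub>R sqrt (1/2)))\<^sup>2 / 2"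
    by simp
  then have "exp (- (norm (2 *\<^sub>R z))\<^sup>2 / 2) \<le> exp (2 * (norm x)\<^sup>2) * exp (- (norm ((z - x) /\<^sub>R sqrt (1/2)))\<^sup>2 / 2)"
    unfolding exp_add[symmetric] by simp
  then show ?thesis unfolding gdens_def by simp
qed

text \<open>Up to normalization, the Gaussian of variance \<open>1/4\<close>. It serves as a common reference measure when the
  centers of the Gaussians of variance \<open>1/2\<close> move along the sequence.\<close>

definition narrow :: "'a::euclidean_space measure" where
  "narrow = density lborel (\<lambda>z. ennreal (gdens (2 *\<^sub>R z)))"

lemma AE_narrow_iff: "(AE x in narrow. P x) \<longleftrightarrow> (AE x in lborel. P (x::'a::euclidean_space))"
  unfolding narrow_def by (subst AE_density) (auto simp: gdens_pos)

lemma sets_narrow[simp, measurable_cong]: "sets narrow = sets borel"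
  by (simp add: narrow_def)

lemma narrow_compare:
  fixes S :: "'a::euclidean_space \<Rightarrow> real"
  assumes [measurable]: "S \<in> borel_measurable borel" and "\<And>z. 0 \<le> S z"
    and i: "integrable gauss (\<lambda>y. S (x + sqrt (1/2) *\<^sub>R y))"
  shows "integrable narrow S"
    and "(LINT z|narrow. S z) \<le> exp (2 * (norm x)\<^sup>2) * (LINT y|gauss. S (x + sqrt (1/2) *\<^sub>R y))"
proof -
  let ?r = "sqrt (1/2)" and ?C = "exp (2 * (norm x)\<^sup>2)"
  have "(\<integral>\<^sup>+z. ennreal (S z) \<partial>narrow) = (\<integral>\<^sup>+z. ennreal (gdens (2 *\<^sub>R z)) * ennreal (S z) \<partial>lborel)"
    unfolding narrow_def by (subst nn_integral_density) auto
  also have "\<dots> \<le> (\<integral>\<^sup>+z. ennreal (?C * gdens ((z - x) /\<^sub>R ?r)) * ennreal (S z) \<partial>lborel)"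
    by (intro nn_integral_mono mult_right_mono ennreal_leI gdens_le_shifted) simp
  also have "\<dots> = ennreal (\<bar>?r\<bar> ^ DIM('a)) * (\<integral>\<^sup>+y. ennreal (?C * gdens y) * ennreal (S (x + ?r *\<^sub>R y)) \<partial>lborel)"
    by (subst nn_integral_lborel_affine[where c="?r" and t=x]) (auto simp: real_sqrt_divide)
  also have "\<dots> \<le> 1 * (\<integral>\<^sup>+y. ennreal (?C * gdens y) * ennreal (S (x + ?r *\<^sub>R y)) \<partial>lborel)"
  proof (rule mult_right_mono)
    have "\<bar>?r\<bar> ^ DIM('a) \<le> 1" by (rule power_le_one) auto
    then show "ennreal (\<bar>?r\<bar> ^ DIM('a)) \<le> 1" by (simp add: ennreal_le_1)
  qed simp
  also have "\<dots> = ennreal ?C * (\<integral>\<^sup>+y. ennreal (S (x + ?r *\<^sub>R y)) \<partial>gauss)"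
    by (simp add: nn_integral_gauss ennreal_mult less_imp_le[OF gdens_pos] mult.assoc nn_integral_cmult)
  also have "(\<integral>\<^sup>+y. ennreal (S (x + ?r *\<^sub>R y)) \<partial>gauss) = ennreal (LINT y|gauss. S (x + ?r *\<^sub>R y))"
    using assms by (intro nn_integral_eq_integral) auto
  also have "ennreal ?C * \<dots> = ennreal (?C * (LINT y|gauss. S (x + ?r *\<^sub>R y)))"
    using assms by (intro ennreal_mult[symmetric] integral_nonneg_AE) auto
  finally have le: "(\<integral>\<^sup>+z. ennreal (S z) \<partial>narrow) \<le> ennreal (?C * (LINT y|gauss. S (x + ?r *\<^sub>R y)))" .
  show "integrable narrow S"
    using assms le by (intro integrableI_nonneg) (auto intro: le_less_trans)
  have "(LINT z|narrow. S z) = enn2real (\<integral>\<^sup>+z. ennreal (S z) \<partial>narrow)"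
    using assms by (intro integral_eq_nn_integral) auto
  also have "\<dots> \<le> ?C * (LINT y|gauss. S (x + ?r *\<^sub>R y))"
    using assms by (intro enn2real_leI le mult_nonneg_nonneg integral_nonneg_AE) auto
  finally show "(LINT z|narrow. S z) \<le> ?C * (LINT y|gauss. S (x + ?r *\<^sub>R y))" .
qed

lemma halfspace_not_full:
  fixes v :: "'a::euclidean_space"
  assumes "AE y in gauss. - (v \<bullet> y) \<le> C"
  shows "v = 0"
proof (rule ccontr)
  assume "v \<noteq> 0"
  let ?U = "{y. C < (- v) \<bullet> y}"
  have "?U \<in> null_sets lborel"
    using assms unfolding AE_gauss_iff by (subst (asm) AE_iff_null) (auto simp: not_le)
  then have "negligible ?U" by (simp add: negligible_iff_null_sets null_sets_completionI)
  moreover have "open ?U" by (rule open_halfspace_gt)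
  moreover have "(- ((\<bar>C\<bar> + 1) / (v \<bullet> v))) *\<^sub>R v \<in> ?U" using \<open>v \<noteq> 0\<close> by simp
  ultimately show False using open_not_negligible by blast
qed

text \<open>Otherwise the normalized slopes \<open>b k / |b k|\<close> would accumulate at a unit vector \<open>w\<close> for which
  \<open>- (w \<bullet> y)\<close> is bounded above for almost every \<open>y\<close>, since \<open>\<psi> k\<close> is bounded below and \<open>c k\<close> above.\<close>

lemma slopes_vanish:
  fixes \<psi> :: "nat \<Rightarrow> 'a::euclidean_space \<Rightarrow> real"
  assumes lower: "\<And>k y. m \<le> \<psi> k y" and c: "\<And>k. c k \<le> C"
    and i: "\<And>k. integrable gauss (\<lambda>y. (\<psi> k y - b k \<bullet> y - c k)\<^sup>2)"
    and lim: "(\<lambda>k. LINT y|gauss. (\<psi> k y - b k \<bullet> y - c k)\<^sup>2) \<longlonglongrightarrow> 0"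
  shows "b \<longlonglongrightarrow> 0"
proof (rule ccontr)
  assume "\<not> b \<longlonglongrightarrow> 0"
  then obtain \<epsilon> where \<epsilon>: "\<epsilon> > 0" "\<not> (\<forall>\<^sub>F k in sequentially. norm (b k) < \<epsilon>)"
    unfolding tendsto_iff by (auto simp: dist_norm)
  obtain s :: "nat \<Rightarrow> nat" where "strict_mono s" "\<forall>k. \<not> norm (b (s k)) < \<epsilon>"
    using not_eventually_sequentiallyD[OF \<epsilon>(2)] by blast
  then have s: "strict_mono s" "\<And>k. \<epsilon> \<le> norm (b (s k))" by (auto simp: not_less)
  let ?R = "\<lambda>k y. (\<psi> k y - b k \<bullet> y - c k)\<^sup>2"
  have "(\<lambda>k. LINT y|gauss. norm (?R (s k) y)) \<longlonglongrightarrow> 0"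
    using LIMSEQ_subseq_LIMSEQ[OF lim s(1)] by (simp add: o_def)
  from tendsto_L1_AE_subseq[OF i this] obtain s' where s': "strict_mono s'"
    "AE y in gauss. (\<lambda>k. ?R (s (s' k)) y) \<longlonglongrightarrow> 0" by auto
  define v where "v = (\<lambda>k. sgn (b (s (s' k))))"
  have "v k \<in> sphere 0 1" for k
    using s(2)[of "s' k"] \<epsilon>(1) by (auto simp: v_def norm_sgn)
  then obtain w r where w: "w \<in> sphere 0 1" "strict_mono r" "(v \<circ> r) \<longlonglongrightarrow> w"
    using compact_sphere[of "0::'a" 1] unfolding compact_def by metis
  have "AE y in gauss. - (w \<bullet> y) \<le> \<bar>C - m\<bar> / \<epsilon>"
    using s'(2)
  proof eventually_elim
    case (elim y)
    let ?t = "\<lambda>k. s (s' (r k))"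
    have "(\<lambda>k. ?R (?t k) y) \<longlonglongrightarrow> 0"
      using LIMSEQ_subseq_LIMSEQ[OF elim w(2)] by (simp add: o_def)
    then have "(\<lambda>k. sqrt (?R (?t k) y)) \<longlonglongrightarrow> sqrt 0" by (rule tendsto_real_sqrt)
    then have sq: "(\<lambda>k. \<bar>C - m\<bar> / \<epsilon> + sqrt (?R (?t k) y) / \<epsilon>) \<longlonglongrightarrow> \<bar>C - m\<bar> / \<epsilon> + sqrt 0 / \<epsilon>"
      using \<epsilon> by (intro tendsto_add tendsto_divide tendsto_const) auto
    have "- (v (r k) \<bullet> y) \<le> \<bar>C - m\<bar> / \<epsilon> + sqrt (?R (?t k) y) / \<epsilon>" for k
    proof -
      let ?b = "b (?t k)"
      have nb: "norm ?b \<ge> \<epsilon>" by (rule s(2))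
      have "- (?b \<bullet> y) \<le> \<bar>C - m\<bar> + sqrt (?R (?t k) y)"
        using lower[of "?t k" y] c[of "?t k"] by simp
      then have "- (?b \<bullet> y) / norm ?b \<le> (\<bar>C - m\<bar> + sqrt (?R (?t k) y)) / norm ?b"
        by (rule divide_right_mono) simp
      also have "\<dots> \<le> (\<bar>C - m\<bar> + sqrt (?R (?t k) y)) / \<epsilon>"
        using nb \<epsilon>(1) by (intro divide_left_mono) (auto intro!: mult_pos_pos)
      finally show ?thesis by (simp add: v_def sgn_div_norm divide_inverse algebra_simps)
    qed
    moreover have "(\<lambda>k. - (v (r k) \<bullet> y)) \<longlonglongrightarrow> - (w \<bullet> y)"
      using w(3) by (intro tendsto_minus tendsto_inner tendsto_const) (simp add: o_def)
    ultimately show "- (w \<bullet> y) \<le> \<bar>C - m\<bar> / \<epsilon>"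
      using sq by (intro LIMSEQ_le[of _ _ _ "\<bar>C - m\<bar> / \<epsilon>"]) auto
  qed
  then have "w = 0" by (rule halfspace_not_full)
  then show False using w(1) by simp
qed

text \<open>Along a subsequence \<open>ln (F k) - c k\<close> tends to \<open>0\<close> and \<open>F k - f k\<close> tends to \<open>0\<close> almost everywhere, while
  the constants \<open>c k\<close> converge. Hence \<open>f k\<close> converges almost everywhere to a constant, and by dominated
  convergence this constant has integral \<open>1\<close>.\<close>

lemma dominated_subseq_to_1:
  fixes F :: "nat \<Rightarrow> 'a::euclidean_space \<Rightarrow> real" and f :: "nat \<Rightarrow> 'a \<Rightarrow> real" and g :: "'a \<Rightarrow> real"
  assumes F: "\<And>k. C11 (L k) (F k) (D k)" "\<And>k x. \<alpha> \<le> F k x" "\<And>k x. F k x \<le> \<beta> k" "0 < \<alpha>"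
    and e: "\<And>k. C11_deficit (F k) (D k) \<le> e k" "\<And>k. 0 < e k" "e \<longlonglongrightarrow> 0"
    and mass: "\<And>k. gavg 1 (F k) 0 \<le> 2"
    and f: "\<And>k. f k \<in> borel_measurable borel" "integrable gauss g" "\<And>k. AE x in gauss. \<bar>f k x\<bar> \<le> g x"
      "\<And>k. (LINT x|gauss. f k x) = 1"
    and close: "\<And>k. (LINT x|gauss. \<bar>F k x - f k x\<bar>) \<le> e k"
  shows "\<exists>r. strict_mono r \<and> (\<lambda>k. LINT x|gauss. \<bar>f (r k) x - 1\<bar>) \<longlonglongrightarrow> 0"
proof -
  note [measurable] = f(1) C11_measurable(1)[OF F(1)]
  define P where "P = (\<lambda>k (x :: 'a) (b :: 'a) c. (norm x)\<^sup>2 \<le> 4 * DIM('a) \<and> ln \<alpha> \<le> c \<and> c \<le> 8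
    \<and> integrable gauss (\<lambda>y. (ln (F k (x + sqrt (1/2) *\<^sub>R y)) - b \<bullet> y - c)\<^sup>2)
    \<and> (LINT y|gauss. (ln (F k (x + sqrt (1/2) *\<^sub>R y)) - b \<bullet> y - c)\<^sup>2) \<le> 8 * e k / \<alpha>)"
  have "\<exists>x b c. P k x b c" for k
    by (rule small_deficit_log_almost_affine[OF F(1,2,3,4) e(1,2) mass, of k]) (unfold P_def, blast)
  then obtain x b c where "\<And>k. P k (x k) (b k) (c k)" by metis
  then have x: "\<And>k. (norm (x k))\<^sup>2 \<le> 4 * DIM('a)" and c: "\<And>k. ln \<alpha> \<le> c k" "\<And>k. c k \<le> 8"
    and i: "\<And>k. integrable gauss (\<lambda>y. (ln (F k (x k + sqrt (1/2) *\<^sub>R y)) - b k \<bullet> y - c k)\<^sup>2)"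
    and le: "\<And>k. (LINT y|gauss. (ln (F k (x k + sqrt (1/2) *\<^sub>R y)) - b k \<bullet> y - c k)\<^sup>2) \<le> 8 * e k / \<alpha>"
    unfolding P_def by blast+
  have Fpos: "F k y > 0" for k y using F(2)[of k y] F(4) by simp
  let ?R = "\<lambda>k y. (ln (F k (x k + sqrt (1/2) *\<^sub>R y)) - b k \<bullet> y - c k)\<^sup>2"
  have limR: "(\<lambda>k. LINT y|gauss. ?R k y) \<longlonglongrightarrow> 0"
  proof (rule tendsto_sandwich[OF _ _ tendsto_const])
    show "\<forall>\<^sub>F k in sequentially. 0 \<le> (LINT y|gauss. ?R k y)" by (auto intro!: always_eventually integral_nonneg_AE)
    show "\<forall>\<^sub>F k in sequentially. (LINT y|gauss. ?R k y) \<le> 8 * e k / \<alpha>" using le by auto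
    have "(\<lambda>k. 8 * e k / \<alpha>) \<longlonglongrightarrow> 8 * 0 / \<alpha>" using F(4) by (intro tendsto_intros e) auto
    then show "(\<lambda>k. 8 * e k / \<alpha>) \<longlonglongrightarrow> 0" by simp
  qed
  have b0: "b \<longlonglongrightarrow> 0"
  proof (rule slopes_vanish[OF _ c(2) i limR])
    show "ln \<alpha> \<le> ln (F k (x k + sqrt (1/2) *\<^sub>R y))" for k y using F(2,4) Fpos by simp
  qed
  define S where "S = (\<lambda>k z. (ln (F k z) - c k)\<^sup>2)"
  have S_meas[measurable]: "S k \<in> borel_measurable borel" for k unfolding S_def by measurable
  have S_le: "S k (x k + sqrt (1/2) *\<^sub>R y) \<le> 2 * ?R k y + 2 * (b k \<bullet> y)\<^sup>2" for k y
    using norm_add_square_le[of "ln (F k (x k + sqrt (1/2) *\<^sub>R y)) - b k \<bullet> y - c k" "b k \<bullet> y"] by (simp add: S_def)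
  have iB: "integrable gauss (\<lambda>y. 2 * ?R k y + 2 * (b k \<bullet> y)\<^sup>2)" for k
    by (intro Bochner_Integration.integrable_add integrable_mult_right i integral_gauss_inner_square)
  have iS: "integrable gauss (\<lambda>y. S k (x k + sqrt (1/2) *\<^sub>R y))" for k
  proof (rule Bochner_Integration.integrable_bound[OF iB[of k]])
    have "norm (S k (x k + sqrt (1/2) *\<^sub>R y)) \<le> norm (2 * ?R k y + 2 * (b k \<bullet> y)\<^sup>2)" for y
      using S_le[of k y] by (simp add: S_def)
    then show "AE y in gauss. norm (S k (x k + sqrt (1/2) *\<^sub>R y)) \<le> norm (2 * ?R k y + 2 * (b k \<bullet> y)\<^sup>2)"
      by simp
  qed measurable
  have leS: "(LINT y|gauss. S k (x k + sqrt (1/2) *\<^sub>R y)) \<le> 2 * (LINT y|gauss. ?R k y) + 2 * (norm (b k))\<^sup>2" for k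
  proof -
    have "(LINT y|gauss. S k (x k + sqrt (1/2) *\<^sub>R y)) \<le> (LINT y|gauss. 2 * ?R k y + 2 * (b k \<bullet> y)\<^sup>2)"
      by (rule integral_mono[OF iS iB S_le])
    also have "\<dots> = 2 * (LINT y|gauss. ?R k y) + 2 * (LINT y|gauss. (b k \<bullet> y)\<^sup>2)"
      using i[of k] integral_gauss_inner_square(1)[of "b k"] by simp
    finally show ?thesis using integral_gauss_inner_square(2)[of "b k"] by simp
  qed
  have inS: "integrable narrow (S k)" for k by (rule narrow_compare(1)[OF _ _ iS]) (auto simp: S_def)
  have leN: "(LINT z|narrow. S k z) \<le> exp (8 * DIM('a)) * (2 * (LINT y|gauss. ?R k y) + 2 * (norm (b k))\<^sup>2)" for k
  proof -
    have "(LINT z|narrow. S k z) \<le> exp (2 * (norm (x k))\<^sup>2) * (LINT y|gauss. S k (x k + sqrt (1/2) *\<^sub>R y))"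
      by (rule narrow_compare(2)[OF _ _ iS]) (auto simp: S_def)
    also have "\<dots> \<le> exp (8 * DIM('a)) * (2 * (LINT y|gauss. ?R k y) + 2 * (norm (b k))\<^sup>2)"
      using x[of k] by (intro mult_mono leS) (auto simp: S_def intro!: integral_nonneg_AE)
    finally show ?thesis .
  qed
  have "(\<lambda>k. exp (8 * DIM('a)) * (2 * (LINT y|gauss. ?R k y) + 2 * (norm (b k))\<^sup>2))
      \<longlonglongrightarrow> exp (8 * DIM('a)) * (2 * 0 + 2 * (norm (0::'a))\<^sup>2)"
    by (rule tendsto_mult[OF tendsto_const tendsto_add[OF tendsto_mult[OF tendsto_const limR]
          tendsto_mult[OF tendsto_const tendsto_power[OF tendsto_norm[OF b0]]]]])
  then have lim0: "(\<lambda>k. exp (8 * DIM('a)) * (2 * (LINT y|gauss. ?R k y) + 2 * (norm (b k))\<^sup>2)) \<longlonglongrightarrow> 0"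
    by simp
  have "(\<lambda>k. LINT z|narrow. S k z) \<longlonglongrightarrow> 0"
  proof (rule tendsto_sandwich[OF _ _ tendsto_const lim0])
    show "\<forall>\<^sub>F k in sequentially. 0 \<le> (LINT z|narrow. S k z)"
      by (simp add: S_def integral_nonneg_AE)
    show "\<forall>\<^sub>F k in sequentially. (LINT z|narrow. S k z)
        \<le> exp (8 * DIM('a)) * (2 * (LINT y|gauss. ?R k y) + 2 * (norm (b k))\<^sup>2)"
      by (rule always_eventually) (rule allI, rule leN)
  qed
  then have "(\<lambda>k. LINT z|narrow. norm (S k z)) \<longlonglongrightarrow> 0" by (simp add: S_def)
  from tendsto_L1_AE_subseq[OF inS this] obtain r1 where r1: "strict_mono r1"
    "AE z in narrow. (\<lambda>k. S (r1 k) z) \<longlonglongrightarrow> 0" by auto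
  have ifk: "integrable gauss (f k)" for k
    by (rule Bochner_Integration.integrable_bound[OF f(2)]) (use f(3)[of k] in auto)
  have iF: "integrable gauss (F k)" for k
    using quad_growth_integrable[OF C11_quad_growth(1)[OF F(1)[of k]], of 0 1] by simp
  have iD: "integrable gauss (\<lambda>z. F k z - f k z)" for k by (intro Bochner_Integration.integrable_diff ifk iF)
  have "(\<lambda>k. LINT x|gauss. norm (F (r1 k) x - f (r1 k) x)) \<longlonglongrightarrow> 0"
  proof (rule tendsto_sandwich[OF _ _ tendsto_const])
    show "(\<lambda>k. e (r1 k)) \<longlonglongrightarrow> 0" using LIMSEQ_subseq_LIMSEQ[OF e(3) r1(1)] by (simp add: o_def)
    show "\<forall>\<^sub>F k in sequentially. 0 \<le> (LINT x|gauss. norm (F (r1 k) x - f (r1 k) x))"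
      by (simp add: integral_nonneg_AE)
    show "\<forall>\<^sub>F k in sequentially. (LINT x|gauss. norm (F (r1 k) x - f (r1 k) x)) \<le> e (r1 k)"
      using close by simp
  qed
  from tendsto_L1_AE_subseq[OF iD this] obtain r2 where r2: "strict_mono r2"
    "AE z in gauss. (\<lambda>k. F (r1 (r2 k)) z - f (r1 (r2 k)) z) \<longlonglongrightarrow> 0" by auto
  have "c (r1 (r2 k)) \<in> {ln \<alpha>..8}" for k using c by auto
  then obtain l r3 where r3: "strict_mono r3" "((\<lambda>k. c (r1 (r2 k))) \<circ> r3) \<longlonglongrightarrow> l"
    using compact_Icc[of "ln \<alpha>" "8::real"] unfolding compact_def by metis
  define r where "r = (\<lambda>k. r1 (r2 (r3 k)))"
  have r: "strict_mono r" using r1(1) r2(1) r3(1) by (simp add: r_def strict_mono_def)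
  have ae: "AE z in gauss. (\<lambda>k. f (r k) z) \<longlonglongrightarrow> exp l"
    using r1(2)[unfolded AE_narrow_iff, folded AE_gauss_iff] r2(2)
  proof eventually_elim
    case (elim z)
    have "(\<lambda>k. S (r k) z) \<longlonglongrightarrow> 0"
      using LIMSEQ_subseq_LIMSEQ[OF elim(1), of "\<lambda>k. r2 (r3 k)"] r2(1) r3(1)
      by (simp add: r_def o_def strict_mono_def)
    then have "(\<lambda>k. sqrt (S (r k) z)) \<longlonglongrightarrow> sqrt 0" by (rule tendsto_real_sqrt)
    then have "(\<lambda>k. ln (F (r k) z) - c (r k)) \<longlonglongrightarrow> 0" by (simp add: S_def tendsto_rabs_zero_iff)
    from tendsto_add[OF this r3(2)] have "(\<lambda>k. ln (F (r k) z)) \<longlonglongrightarrow> l" by (simp add: r_def o_def)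
    then have "(\<lambda>k. exp (ln (F (r k) z))) \<longlonglongrightarrow> exp l" by (rule tendsto_exp)
    then have "(\<lambda>k. F (r k) z) \<longlonglongrightarrow> exp l" using Fpos by simp
    moreover have "(\<lambda>k. F (r k) z - f (r k) z) \<longlonglongrightarrow> 0"
      using LIMSEQ_subseq_LIMSEQ[OF elim(2) r3(1)] by (simp add: r_def o_def)
    ultimately have "(\<lambda>k. F (r k) z - (F (r k) z - f (r k) z)) \<longlonglongrightarrow> exp l - 0" by (rule tendsto_diff)
    then show "(\<lambda>k. f (r k) z) \<longlonglongrightarrow> exp l" by simp
  qed
  have "(\<lambda>k. LINT z|gauss. f (r k) z) \<longlonglongrightarrow> (LINT z|(gauss :: 'a measure). exp l)"
    by (rule integral_dominated_convergence[OF _ _ f(2) ae]) (use f(3) in auto)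
  then have "exp l = 1" using f(4) by (simp add: gauss.prob_space[simplified] LIMSEQ_const_iff)
  then have ae1: "AE z in gauss. (\<lambda>k. \<bar>f (r k) z - 1\<bar>) \<longlonglongrightarrow> 0"
    using ae by (simp add: tendsto_rabs_zero_iff LIM_zero_iff)
  have "(\<lambda>k. LINT z|gauss. \<bar>f (r k) z - 1\<bar>) \<longlonglongrightarrow> (LINT z|(gauss :: 'a measure). 0)"
  proof (rule integral_dominated_convergence[OF _ _ _ ae1, of "\<lambda>z. g z + 1"])
    show "AE z in gauss. norm \<bar>f (r k) z - 1\<bar> \<le> g z + 1" for k
      using f(3)[of "r k"] by eventually_elim auto
  qed (use f(2) in auto)
  then show ?thesis using r by auto
qed

theorem dominated_tendsto_1:
  fixes F :: "nat \<Rightarrow> 'a::euclidean_space \<Rightarrow> real" and f :: "nat \<Rightarrow> 'a \<Rightarrow> real" and g :: "'a \<Rightarrow> real"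
  assumes F: "\<And>k. C11 (L k) (F k) (D k)" "\<And>k x. \<alpha> \<le> F k x" "\<And>k x. F k x \<le> \<beta> k" "0 < \<alpha>"
    and e: "\<And>k. C11_deficit (F k) (D k) \<le> e k" "\<And>k. 0 < e k" "e \<longlonglongrightarrow> 0"
    and mass: "\<And>k. gavg 1 (F k) 0 \<le> 2"
    and f: "\<And>k. f k \<in> borel_measurable borel" "integrable gauss g" "\<And>k. AE x in gauss. \<bar>f k x\<bar> \<le> g x"
      "\<And>k. (LINT x|gauss. f k x) = 1"
    and close: "\<And>k. (LINT x|gauss. \<bar>F k x - f k x\<bar>) \<le> e k"
  shows "(\<lambda>k. LINT x|gauss. \<bar>f k x - 1\<bar>) \<longlonglongrightarrow> 0"
proof (rule ccontr)
  let ?a = "\<lambda>k. LINT x|gauss. \<bar>f k x - 1\<bar>"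
  assume "\<not> ?a \<longlonglongrightarrow> 0"
  then obtain \<epsilon> where \<epsilon>: "\<epsilon> > 0" "\<not> (\<forall>\<^sub>F k in sequentially. norm (?a k) < \<epsilon>)"
    unfolding tendsto_iff by (auto simp: dist_norm)
  obtain s :: "nat \<Rightarrow> nat" where "strict_mono s" "\<forall>k. \<not> norm (?a (s k)) < \<epsilon>"
    using not_eventually_sequentiallyD[OF \<epsilon>(2)] by blast
  then have s: "strict_mono s" "\<And>k. \<epsilon> \<le> norm (?a (s k))" by (auto simp: not_less)
  have "(\<lambda>k. e (s k)) \<longlonglongrightarrow> 0" using LIMSEQ_subseq_LIMSEQ[OF e(3) s(1)] by (simp add: o_def)
  then obtain r where r: "strict_mono r" "(\<lambda>k. ?a (s (r k))) \<longlonglongrightarrow> 0"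
    using dominated_subseq_to_1[of "\<lambda>k. L (s k)" "\<lambda>k. F (s k)" "\<lambda>k. D (s k)" \<alpha> "\<lambda>k. \<beta> (s k)"
        "\<lambda>k. e (s k)" "\<lambda>k. f (s k)" g] F e mass f close by blast
  have "\<forall>\<^sub>F k in sequentially. norm (?a (s (r k))) < \<epsilon>"
    using tendstoD[OF r(2) \<epsilon>(1)] by (simp add: dist_norm)
  then obtain k where "norm (?a (s (r k))) < \<epsilon>" by (auto dest: eventually_happens)
  then show False using s(2)[of "r k"] by simp
qed

section \<open>Test functions\<close>

lemma C_k_continuous: "C_k m \<phi> \<Longrightarrow> continuous_on UNIV \<phi>"
  by (cases m) (auto intro: differentiable_imp_continuous_on)

lemma C_k_Suc_D: "C_k (Suc m) \<phi> \<Longrightarrow> C_k m \<phi>"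
proof (induction m arbitrary: \<phi>)
  case 0
  then show ?case by (auto intro: differentiable_imp_continuous_on)
qed auto

lemma C_k_Suc_iff:
  "C_k (Suc m) \<phi> \<longleftrightarrow> (\<forall>x. \<phi> differentiable at x) \<and> (\<forall>b\<in>Basis. C_k m (\<lambda>x. frechet_derivative \<phi> (at x) b))"
  by (simp add: differentiable_on_def)

lemma frechet_derivative_eqI: "(\<phi> has_derivative D) (at x) \<Longrightarrow> frechet_derivative \<phi> (at x) = D"
  using frechet_derivative_at by metis

lemma C_k_add: "C_k m \<phi> \<Longrightarrow> C_k m \<psi> \<Longrightarrow> C_k m (\<lambda>x. \<phi> x + \<psi> x)"
proof (induction m arbitrary: \<phi> \<psi>)
  case 0
  then show ?case by (auto intro: continuous_on_add)
next
  case (Suc m)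
  have d: "\<phi> differentiable at x" "\<psi> differentiable at x" for x
    using Suc.prems unfolding C_k_Suc_iff by auto
  have "frechet_derivative (\<lambda>x. \<phi> x + \<psi> x) (at x) b = frechet_derivative \<phi> (at x) b + frechet_derivative \<psi> (at x) b" for x b
    by (subst frechet_derivative_eqI[OF has_derivative_add[OF d[unfolded frechet_derivative_works]]]) simp
  then show ?case using Suc d unfolding C_k_Suc_iff by (auto intro!: Suc.IH differentiable_add)
qed

lemma frechet_derivative_times:
  fixes \<phi> \<psi> :: "'a::euclidean_space \<Rightarrow> real"
  assumes "\<phi> differentiable at x" "\<psi> differentiable at x"
  shows "frechet_derivative (\<lambda>x. \<phi> x * \<psi> x) (at x) b
    = \<phi> x * frechet_derivative \<psi> (at x) b + frechet_derivative \<phi> (at x) b * \<psi> x"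
  by (subst frechet_derivative_eqI[OF has_derivative_mult[OF assms[unfolded frechet_derivative_works]]]) simp

lemma C_k_mult: "C_k m \<phi> \<Longrightarrow> C_k m \<psi> \<Longrightarrow> C_k m (\<lambda>x. \<phi> x * \<psi> x)"
proof (induction m arbitrary: \<phi> \<psi>)
  case 0
  then show ?case by (auto intro: continuous_on_mult)
next
  case (Suc m)
  have d: "\<phi> differentiable at x" "\<psi> differentiable at x" for x
    using Suc.prems unfolding C_k_Suc_iff by auto
  have "C_k m \<phi>" "C_k m \<psi>" using Suc.prems by (auto dest: C_k_Suc_D simp del: C_k.simps)
  then show ?case
    using Suc.prems unfolding C_k_Suc_iff frechet_derivative_times[OF d]
    by (auto intro!: C_k_add Suc.IH differentiable_mult)
qed

text \<open>Smoothness by coinduction: a function is smooth if it lies in a class that is stable under partial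
  derivatives.\<close>

lemma C_k_coinduct:
  assumes "\<phi> \<in> S"
    and step: "\<And>\<phi> b. \<phi> \<in> S \<Longrightarrow> b \<in> Basis \<Longrightarrow> \<exists>D. (\<forall>x. (\<phi> has_derivative D x) (at x)) \<and> (\<lambda>x. D x b) \<in> S"
  shows "C_k m \<phi>"
  using assms(1)
proof (induction m arbitrary: \<phi>)
  have diff: "\<phi> differentiable at x" if "\<phi> \<in> S" for \<phi> x
  proof -
    obtain b :: 'a where "b \<in> Basis" using nonempty_Basis by blast
    then show ?thesis using step[OF that] unfolding differentiable_def by blast
  qed
  {
    case 0
    then show ?case using diff by (auto simp: continuous_on_eq_continuous_at intro: differentiable_imp_continuous_within)
  next
    case (Suc m)
    show ?case unfolding C_k_Suc_iff
    proof (intro conjI allI ballI diff Suc.prems)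
      fix b :: 'a assume b: "b \<in> Basis"
      obtain D where D: "\<And>x. (\<phi> has_derivative D x) (at x)" "(\<lambda>x. D x b) \<in> S"
        using step[OF Suc.prems b] by blast
      then show "C_k m (\<lambda>x. frechet_derivative \<phi> (at x) b)"
        using Suc.IH[OF D(2)] by (simp add: frechet_derivative_eqI[OF D(1)])
    qed
  }
qed

text \<open>The basic example of a smooth function that is not analytic is \<open>flat 0\<close>; the powers of \<open>t\<close> in the
  denominator make the family stable under differentiation.\<close>

definition flat :: "nat \<Rightarrow> real \<Rightarrow> real" where
  "flat j t = (if t > 0 then exp (- (1 / t)) / t ^ j else 0)"

text \<open>A linear bound for every \<open>j\<close>. As \<open>flat j t / t = flat (j + 1) t\<close>, it also shows that the difference
  quotients at \<open>0\<close> tend to \<open>0\<close>.\<close>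

lemma flat_le: "\<bar>flat j t\<bar> \<le> fact (Suc j) * \<bar>t\<bar>"
proof (cases "t > 0")
  case True
  define N :: real where "N = fact (Suc j)"
  have "(1 / t) ^ Suc j \<le> N * exp (1 / t)"
    unfolding N_def using True by (intro power_le_fact_mult_exp) simp
  then have "1 \<le> N * exp (1 / t) * t ^ Suc j" using True by (simp add: field_simps)
  then have "exp (- (1 / t)) \<le> N * t ^ Suc j"
    by (simp add: exp_minus field_simps)
  then have "exp (- (1 / t)) / t ^ j \<le> N * t" using True by (simp add: field_simps)
  then show ?thesis using True by (simp add: flat_def N_def)
qed (simp add: flat_def mult_nonneg_nonpos not_less del: fact_Suc)

lemma DERIV_flat: "(flat j has_real_derivative (- real j * flat (Suc j) t + flat (Suc (Suc j)) t)) (at t)"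
proof -
  consider "t > 0" | "t < 0" | "t = 0" by linarith
  then show ?thesis
  proof cases
    case 1
    have "((\<lambda>t. exp (- (1 / t)) / t ^ j) has_real_derivative (- real j * flat (Suc j) t + flat (Suc (Suc j)) t)) (at t)"
      using 1 by (auto intro!: derivative_eq_intros simp: flat_def field_simps)
        (cases j; simp add: field_simps)
    then show ?thesis
      by (rule DERIV_cong_ev[THEN iffD1, rotated -1])
        (use 1 in \<open>auto simp: flat_def eventually_nhds intro!: exI[of _ "{0<..}"]\<close>)
  next
    case 2
    have "((\<lambda>t. 0) has_real_derivative (- real j * flat (Suc j) t + flat (Suc (Suc j)) t)) (at t)"
      using 2 by (auto simp: flat_def)
    then show ?thesis
      by (rule DERIV_cong_ev[THEN iffD1, rotated -1])
        (use 2 in \<open>auto simp: flat_def eventually_nhds intro!: exI[of _ "{..<0}"]\<close>)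
  next
    case 3
    have "((\<lambda>h. (flat j (0 + h) - flat j 0) / h) \<longlongrightarrow> 0) (at 0)"
    proof (rule tendsto_norm_zero_cancel, rule tendsto_sandwich[OF _ _ tendsto_const])
      show "\<forall>\<^sub>F h in at 0. norm ((flat j (0 + h) - flat j 0) / h) \<le> fact (Suc (Suc j)) * \<bar>h\<bar>"
      proof (rule always_eventually, rule allI)
        fix h :: real
        have "(flat j (0 + h) - flat j 0) / h = flat (Suc j) h" by (simp add: flat_def)
        then show "norm ((flat j (0 + h) - flat j 0) / h) \<le> fact (Suc (Suc j)) * \<bar>h\<bar>"
          using flat_le[of "Suc j" h] by simp
      qed
      have "((\<lambda>h. fact (Suc (Suc j)) * \<bar>h\<bar>) \<longlongrightarrow> fact (Suc (Suc j)) * \<bar>0::real\<bar>) (at 0)"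
        by (intro tendsto_intros)
      then show "((\<lambda>h. fact (Suc (Suc j)) * \<bar>h::real\<bar>) \<longlongrightarrow> 0) (at 0)" by simp
    qed auto
    then show ?thesis using 3 by (simp add: DERIV_def flat_def)
  qed
qed

text \<open>The algebra generated by affine functions and compositions with \<open>flat j\<close>, a class to which the
  coinduction principle for smoothness applies.\<close>

inductive_set flat_functions :: "('a::euclidean_space \<Rightarrow> real) set" where
  const: "(\<lambda>x. c) \<in> flat_functions"
| inner: "(\<lambda>x. x \<bullet> v) \<in> flat_functions"
| add: "\<phi> \<in> flat_functions \<Longrightarrow> \<psi> \<in> flat_functions \<Longrightarrow> (\<lambda>x. \<phi> x + \<psi> x) \<in> flat_functions"
| mult: "\<phi> \<in> flat_functions \<Longrightarrow> \<psi> \<in> flat_functions \<Longrightarrow> (\<lambda>x. \<phi> x * \<psi> x) \<in> flat_functions"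
| flat: "\<phi> \<in> flat_functions \<Longrightarrow> (\<lambda>x. flat j (\<phi> x)) \<in> flat_functions"

lemma flat_functions_derivative:
  "\<phi> \<in> flat_functions \<Longrightarrow> \<exists>D. (\<forall>x. (\<phi> has_derivative D x) (at x)) \<and> (\<forall>b. (\<lambda>x. D x b) \<in> flat_functions)"
proof (induction rule: flat_functions.induct)
  case (const c)
  then show ?case by (intro exI[of _ "\<lambda>x b. 0"]) (auto intro: flat_functions.intros)
next
  case (inner v)
  then show ?case by (intro exI[of _ "\<lambda>x b. b \<bullet> v"])
    (auto intro: flat_functions.intros bounded_linear_imp_has_derivative bounded_linear_inner_left)
next
  case (add \<phi> \<psi>)
  then obtain D E where "\<forall>x. (\<phi> has_derivative D x) (at x)" "\<forall>b. (\<lambda>x. D x b) \<in> flat_functions"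
    "\<forall>x. (\<psi> has_derivative E x) (at x)" "\<forall>b. (\<lambda>x. E x b) \<in> flat_functions" by blast
  then show ?case by (intro exI[of _ "\<lambda>x b. D x b + E x b"]) (auto intro: flat_functions.intros has_derivative_add)
next
  case (mult \<phi> \<psi>)
  then obtain D E where "\<forall>x. (\<phi> has_derivative D x) (at x)" "\<forall>b. (\<lambda>x. D x b) \<in> flat_functions"
    "\<forall>x. (\<psi> has_derivative E x) (at x)" "\<forall>b. (\<lambda>x. E x b) \<in> flat_functions" by blast
  moreover from this have "(\<lambda>x. \<phi> x * E x b + D x b * \<psi> x) \<in> flat_functions" for b
    using mult.hyps by (intro flat_functions.add flat_functions.mult) auto
  ultimately show ?case by (intro exI[of _ "\<lambda>x b. \<phi> x * E x b + D x b * \<psi> x"]) (auto intro: has_derivative_mult)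
next
  case (flat \<phi> j)
  then obtain D where D: "\<forall>x. (\<phi> has_derivative D x) (at x)" "\<forall>b. (\<lambda>x. D x b) \<in> flat_functions" by blast
  have "((\<lambda>x. flat j (\<phi> x)) has_derivative
      (\<lambda>b. (- real j * flat (Suc j) (\<phi> x) + flat (Suc (Suc j)) (\<phi> x)) * D x b)) (at x)" for x
    using has_derivative_compose[OF D(1)[rule_format, of x] DERIV_flat[of j, unfolded has_field_derivative_def]]
    by (simp add: mult.commute)
  moreover have "(\<lambda>x. (- real j * flat (Suc j) (\<phi> x) + flat (Suc (Suc j)) (\<phi> x)) * D x b) \<in> flat_functions" for b
    using flat.hyps D(2) by (intro flat_functions.intros) auto
  ultimately show ?case
    by (intro exI[of _ "\<lambda>x b. (- real j * flat (Suc j) (\<phi> x) + flat (Suc (Suc j)) (\<phi> x)) * D x b"]) auto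
qed

lemma flat_functions_C_k: "\<phi> \<in> flat_functions \<Longrightarrow> C_k m \<phi>"
  by (rule C_k_coinduct[of _ flat_functions]) (use flat_functions_derivative in blast)+

lemma flat_functions_sum:
  "finite A \<Longrightarrow> (\<And>a. a \<in> A \<Longrightarrow> \<phi> a \<in> flat_functions) \<Longrightarrow> (\<lambda>x. \<Sum>a\<in>A. \<phi> a x) \<in> flat_functions"
proof (induction A rule: finite_induct)
  case empty
  then show ?case by (simp add: flat_functions.const)
next
  case (insert a A)
  then show ?case by (simp add: flat_functions.add)
qed

definition bump :: "real \<Rightarrow> 'a::euclidean_space \<Rightarrow> real" where
  "bump r x = flat 0 (1 - (norm x)\<^sup>2 / r\<^sup>2)"

lemma bump_flat: "(\<lambda>x. bump r (x - a)) \<in> flat_functions"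
proof -
  have "(\<lambda>x. bump r (x - a)) = (\<lambda>x. flat 0 (1 + (- (1 / r\<^sup>2)) * (\<Sum>b\<in>Basis. (x \<bullet> b + (- (a \<bullet> b))) * (x \<bullet> b + (- (a \<bullet> b))))))"
  proof
    fix x :: 'a
    have "(norm (x - a))\<^sup>2 = (\<Sum>b\<in>Basis. (x \<bullet> b + (- (a \<bullet> b))) * (x \<bullet> b + (- (a \<bullet> b))))"
      unfolding power2_norm_eq_inner by (subst euclidean_inner) (simp add: inner_diff_left)
    then show "bump r (x - a) = flat 0 (1 + (- (1 / r\<^sup>2)) * (\<Sum>b\<in>Basis. (x \<bullet> b + (- (a \<bullet> b))) * (x \<bullet> b + (- (a \<bullet> b)))))"
      unfolding bump_def by simp
  qed
  also have "\<dots> \<in> flat_functions"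
    by (intro flat_functions.flat flat_functions.add flat_functions.mult flat_functions.const flat_functions_sum
        flat_functions.inner finite_Basis)
  finally show ?thesis .
qed

lemma bump_bounds: "0 \<le> bump r x" "bump r x \<le> exp (-1)" if "r > 0"
proof -
  show "0 \<le> bump r x" by (simp add: bump_def flat_def)
  show "bump r x \<le> exp (-1)"
  proof (cases "1 - (norm x)\<^sup>2 / r\<^sup>2 > 0")
    case True
    moreover have "1 - (norm x)\<^sup>2 / r\<^sup>2 \<le> 1" by simp
    ultimately show ?thesis by (simp add: bump_def flat_def field_simps)
  qed (simp add: bump_def flat_def)
qed

lemma bump_eq_0: "r > 0 \<Longrightarrow> r \<le> norm x \<Longrightarrow> bump r x = 0"
  by (simp add: bump_def flat_def not_less power_mono)

lemma bump_pos: "r > 0 \<Longrightarrow> norm x < r \<Longrightarrow> bump r x > 0"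
  by (simp add: bump_def flat_def power_strict_mono)

lemma bump_uminus[simp]: "bump r (- x) = bump r x"
  by (simp add: bump_def)

lemma bump_commute: "bump r (x - y) = bump r (y - x)"
  by (simp add: bump_def norm_minus_commute)

lemma test_functionI:
  assumes "\<And>m. C_k m \<phi>" and "\<And>x. norm x > R \<Longrightarrow> \<phi> x = 0"
  shows "test_function \<phi>"
proof -
  have "{x. \<phi> x \<noteq> 0} \<subseteq> cball 0 R" using assms(2) by (auto simp: not_less[symmetric])
  then have "bounded {x. \<phi> x \<noteq> 0}" by (rule bounded_subset[OF bounded_cball])
  then show ?thesis using assms(1) by (simp add: test_function_def compact_closure)
qed

lemma test_functionE:
  assumes "test_function \<phi>"
  obtains R where "R > 0" "\<And>x. norm x > R \<Longrightarrow> \<phi> x = 0"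
proof -
  have "bounded {x. \<phi> x \<noteq> 0}"
    using assms by (metis bounded_subset closure_subset compact_imp_bounded test_function_def)
  then obtain R where "R > 0" "\<forall>x\<in>{x. \<phi> x \<noteq> 0}. norm x \<le> R" using bounded_pos by metis
  then show thesis using that by (metis mem_Collect_eq not_less)
qed

lemma test_function_bump: "r > 0 \<Longrightarrow> test_function (\<lambda>x. bump r (x - (a :: 'a::euclidean_space)))"
proof (rule test_functionI[of _ "norm a + r"])
  fix x :: 'a assume "r > 0" "norm a + r < norm x"
  then show "bump r (x - a) = 0"
    using norm_triangle_ineq2[of x a] by (intro bump_eq_0) auto
qed (rule flat_functions_C_k[OF bump_flat])

lemma test_function_mult:
  assumes "\<And>m. C_k m \<phi>" "test_function \<psi>"
  shows "test_function (\<lambda>x. \<phi> x * \<psi> x)"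
proof -
  obtain R where "\<And>x. norm x > R \<Longrightarrow> \<psi> x = 0" using test_functionE[OF assms(2)] by metis
  then show ?thesis using assms by (intro test_functionI[of _ R] C_k_mult) (auto simp: test_function_def)
qed

lemma test_function_cmult: "test_function \<psi> \<Longrightarrow> test_function (\<lambda>x. c * \<psi> x)"
  by (rule test_function_mult) (auto intro: flat_functions_C_k flat_functions.const)

lemma test_function_differentiable: "test_function \<phi> \<Longrightarrow> \<phi> differentiable at x"
  unfolding test_function_def using C_k_Suc_iff by blast

definition grad :: "('a::euclidean_space \<Rightarrow> real) \<Rightarrow> 'a \<Rightarrow> 'a" where
  "grad \<phi> x = (\<Sum>b\<in>Basis. frechet_derivative \<phi> (at x) b *\<^sub>R b)"

lemma grad_inner:
  assumes "\<phi> differentiable at x"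
  shows "grad \<phi> x \<bullet> v = frechet_derivative \<phi> (at x) v"
proof -
  interpret linear "frechet_derivative \<phi> (at x)" by (rule linear_frechet_derivative[OF assms])
  have "frechet_derivative \<phi> (at x) v = frechet_derivative \<phi> (at x) (\<Sum>b\<in>Basis. (v \<bullet> b) *\<^sub>R b)"
    by (simp add: euclidean_representation)
  also have "\<dots> = (\<Sum>b\<in>Basis. (v \<bullet> b) * frechet_derivative \<phi> (at x) b)" by (simp add: sum scale)
  finally show ?thesis by (simp add: grad_def inner_sum_left mult.commute inner_commute[of v])
qed

lemma grad_has_derivative:
  assumes "\<phi> differentiable at x"
  shows "(\<phi> has_derivative (\<lambda>v. grad \<phi> x \<bullet> v)) (at x)"
  using assms frechet_derivative_works[of \<phi> "at x"] by (simp add: grad_inner)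

lemma frechet_derivative_outside:
  fixes \<phi> :: "'a::euclidean_space \<Rightarrow> real"
  assumes "\<And>x. norm x > R \<Longrightarrow> \<phi> x = 0" "norm x > R"
  shows "frechet_derivative \<phi> (at x) = (\<lambda>v. 0)"
proof (rule frechet_derivative_eqI)
  show "(\<phi> has_derivative (\<lambda>v. 0)) (at x)"
  proof (rule has_derivative_transform_within_open)
    show "((\<lambda>x. 0) has_derivative (\<lambda>v. 0)) (at x)" by (rule has_derivative_const)
    show "open {x::'a. norm x > R}" by (intro open_Collect_less continuous_intros)
  qed (use assms in auto)
qed

lemma test_function_partial:
  assumes "test_function \<phi>" "b \<in> Basis"
  shows "test_function (\<lambda>x. frechet_derivative \<phi> (at x) b)"
proof -
  obtain R where R: "\<And>x. norm x > R \<Longrightarrow> \<phi> x = 0" using test_functionE[OF assms(1)] by metis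
  show ?thesis
  proof (rule test_functionI[of _ R])
    show "C_k m (\<lambda>x. frechet_derivative \<phi> (at x) b)" for m
      using assms C_k_Suc_iff unfolding test_function_def by blast
  qed (simp add: frechet_derivative_outside[OF R])
qed

lemma test_function_bounded:
  assumes "test_function \<phi>"
  obtains B where "B \<ge> 0" "\<And>x. \<bar>\<phi> x\<bar> \<le> B"
proof -
  have c: "continuous_on UNIV \<phi>" using assms C_k_continuous unfolding test_function_def by blast
  obtain R where R: "\<And>x. norm x > R \<Longrightarrow> \<phi> x = 0" using test_functionE[OF assms(1)] by metis
  have "bounded (\<phi> ` cball 0 R)"
    by (intro compact_imp_bounded compact_continuous_image continuous_on_subset[OF c]) auto
  then obtain B where "\<forall>y\<in>\<phi> ` cball 0 R. norm y \<le> B" unfolding bounded_iff by blast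
  then have B: "\<And>x. x \<in> cball 0 R \<Longrightarrow> \<bar>\<phi> x\<bar> \<le> B" by auto
  have "\<bar>\<phi> x\<bar> \<le> \<bar>B\<bar>" for x
    using B[of x] R[of x] by (cases "norm x \<le> R") (auto simp: not_le)
  then show thesis using that[of "\<bar>B\<bar>"] by auto
qed

lemma grad_bounded:
  assumes "test_function \<phi>"
  obtains B where "B \<ge> 0" "\<And>x. norm (grad \<phi> x) \<le> B"
proof -
  have "\<exists>B. \<forall>x. \<bar>frechet_derivative \<phi> (at x) b\<bar> \<le> B" if "b \<in> Basis" for b
    using test_function_bounded[OF test_function_partial[OF assms that]] by metis
  then obtain B where B: "\<And>b x. b \<in> Basis \<Longrightarrow> \<bar>frechet_derivative \<phi> (at x) b\<bar> \<le> B b" by metis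
  have "norm (grad \<phi> x) \<le> (\<Sum>b\<in>Basis. B b)" for x
    unfolding grad_def using B by (intro sum_norm_le) auto
  then show thesis using that[of "\<Sum>b\<in>Basis. B b"] norm_ge_zero order_trans by blast
qed

lemma test_function_lipschitz:
  assumes \<phi>: "test_function \<phi>" and B: "\<And>x. norm (grad \<phi> x) \<le> B"
  shows "\<bar>\<phi> x - \<phi> y\<bar> \<le> B * norm (x - y)"
proof -
  have "norm (\<phi> x - \<phi> y) \<le> B * norm (x - y)"
  proof (rule differentiable_bound[of UNIV])
    show "(\<phi> has_derivative (\<lambda>v. grad \<phi> x \<bullet> v)) (at x within UNIV)" for x
      using grad_has_derivative[OF test_function_differentiable[OF \<phi>]] by simp
    show "onorm (\<lambda>v. grad \<phi> x \<bullet> v) \<le> B" for x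
    proof (rule onorm_le)
      fix v
      have "norm (grad \<phi> x \<bullet> v) \<le> norm (grad \<phi> x) * norm v" by (simp add: Cauchy_Schwarz_ineq2)
      also have "\<dots> \<le> B * norm v" by (intro mult_right_mono B) simp
      finally show "norm (grad \<phi> x \<bullet> v) \<le> B * norm v" .
    qed
  qed auto
  then show ?thesis by simp
qed

text \<open>The partial derivatives are again test functions, hence have bounded gradients and are Lipschitz. The
  first-order Taylor estimate is the mean value inequality for \<open>\<phi>\<close> minus its linearization.\<close>

lemma test_function_C11:
  assumes \<phi>: "test_function \<phi>"
  obtains L where "C11 L \<phi> (grad \<phi>)"
proof -
  obtain B where B: "B \<ge> 0" "\<And>x. norm (grad \<phi> x) \<le> B" using grad_bounded[OF \<phi>] by metis
  have "\<exists>K. \<forall>x y. \<bar>frechet_derivative \<phi> (at x) b - frechet_derivative \<phi> (at y) b\<bar> \<le> K * norm (x - y)"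
    if "b \<in> Basis" for b
  proof -
    note t = test_function_partial[OF \<phi> that]
    obtain K where "\<And>x. norm (grad (\<lambda>x. frechet_derivative \<phi> (at x) b) x) \<le> K" using grad_bounded[OF t] by metis
    then show ?thesis using test_function_lipschitz[OF t] by blast
  qed
  then obtain K where K: "\<And>b x y. b \<in> Basis \<Longrightarrow>
      \<bar>frechet_derivative \<phi> (at x) b - frechet_derivative \<phi> (at y) b\<bar> \<le> K b * norm (x - y)" by metis
  \<comment> \<open>the maximum only makes \<open>M\<close> visibly nonnegative\<close>
  define M where "M = max 0 (\<Sum>b\<in>Basis. K b)"
  have gl: "norm (grad \<phi> x - grad \<phi> y) \<le> M * norm (x - y)" for x y
  proof -
    have "grad \<phi> x - grad \<phi> y = (\<Sum>b\<in>Basis. (frechet_derivative \<phi> (at x) b - frechet_derivative \<phi> (at y) b) *\<^sub>R b)"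
      by (simp add: grad_def sum_subtractf scaleR_diff_left)
    also have "norm \<dots> \<le> (\<Sum>b\<in>Basis. K b * norm (x - y))" using K by (intro sum_norm_le) auto
    also have "\<dots> \<le> M * norm (x - y)"
      unfolding sum_distrib_right[symmetric] M_def by (intro mult_right_mono) auto
    finally show ?thesis .
  qed
  have lin: "\<bar>\<phi> (x + v) - \<phi> x - grad \<phi> x \<bullet> v\<bar> \<le> M * (norm v)\<^sup>2" for x v
  proof -
    have "norm (\<phi> (x + v) - \<phi> x - grad \<phi> x \<bullet> (x + v - x)) \<le> norm (x + v - x) * (M * norm v)"
    proof (rule differentiable_bound_linearization[where S="cball x (norm v)" and f'="\<lambda>x v. grad \<phi> x \<bullet> v"])
      show "x + t *\<^sub>R (x + v - x) \<in> cball x (norm v)" if "t \<in> {0..1}" for t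
        using that by (simp add: dist_norm mult_left_le_one_le)
      show "(\<phi> has_derivative (\<lambda>v. grad \<phi> y \<bullet> v)) (at y within cball x (norm v))" for y
        using grad_has_derivative[OF test_function_differentiable[OF \<phi>]] by (rule has_derivative_at_withinI)
      show "onorm ((\<lambda>v. grad \<phi> y \<bullet> v) - (\<lambda>v. grad \<phi> x \<bullet> v)) \<le> M * norm v" if "y \<in> cball x (norm v)" for y
      proof (rule onorm_le)
        fix w
        have "norm (((\<lambda>v. grad \<phi> y \<bullet> v) - (\<lambda>v. grad \<phi> x \<bullet> v)) w) = \<bar>(grad \<phi> y - grad \<phi> x) \<bullet> w\<bar>"
          by (simp add: inner_diff_left)
        also have "\<dots> \<le> norm (grad \<phi> y - grad \<phi> x) * norm w" by (rule Cauchy_Schwarz_ineq2)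
        also have "\<dots> \<le> (M * norm (y - x)) * norm w" by (intro mult_right_mono gl) simp
        also have "\<dots> \<le> (M * norm v) * norm w"
          using that by (intro mult_right_mono mult_left_mono) (auto simp: M_def dist_norm norm_minus_commute)
        finally show "norm (((\<lambda>v. grad \<phi> y \<bullet> v) - (\<lambda>v. grad \<phi> x \<bullet> v)) w) \<le> M * norm v * norm w" .
      qed
    qed auto
    then show ?thesis by (simp add: power2_eq_square mult_ac)
  qed
  have "C11 (B + M) \<phi> (grad \<phi>)"
    unfolding C11_def
  proof (intro conjI allI)
    fix x y v
    have M0: "M \<ge> 0" by (simp add: M_def)
    show "\<bar>\<phi> (x + v) - \<phi> x - grad \<phi> x \<bullet> v\<bar> \<le> (B + M) * (norm v)\<^sup>2"
      using lin[of x v] B(1) by (simp add: distrib_right add_increasing)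
    show "\<bar>\<phi> x - \<phi> y\<bar> \<le> (B + M) * norm (x - y)"
      using test_function_lipschitz[OF \<phi> B(2), of x y] M0 by (simp add: distrib_right add_increasing2)
    show "norm (grad \<phi> x) \<le> B + M" using B(2)[of x] M0 by simp
    show "norm (grad \<phi> x - grad \<phi> y) \<le> (B + M) * norm (x - y)"
      using gl[of x y] B(1) by (simp add: distrib_right add_increasing)
  qed
  then show thesis by (rule that)
qed

lemma C11_has_derivative:
  assumes "C11 L f D"
  shows "(f has_derivative (\<lambda>v. D x \<bullet> v)) (at x)"
  unfolding has_derivative_at
proof
  show "bounded_linear (\<lambda>v. D x \<bullet> v)" by (rule bounded_linear_inner_right)
  show "(\<lambda>v. norm (f (x + v) - f x - D x \<bullet> v) / norm v) \<midarrow>0\<rightarrow> 0"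
  proof (rule tendsto_sandwich[OF _ _ tendsto_const])
    show "\<forall>\<^sub>F v in at 0. norm (f (x + v) - f x - D x \<bullet> v) / norm v \<le> L * norm v"
    proof (rule always_eventually, rule allI)
      fix v
      show "norm (f (x + v) - f x - D x \<bullet> v) / norm v \<le> L * norm v"
        using C11D(1)[OF assms, of x v]
        by (cases "v = 0") (simp_all add: power2_eq_square divide_le_eq mult.assoc)
    qed
    have "((\<lambda>v::'a. L * norm v) \<longlongrightarrow> L * norm (0::'a)) (at 0)"
      by (rule tendsto_mult[OF tendsto_const tendsto_norm[OF tendsto_ident_at]])
    then show "((\<lambda>v::'a. L * norm v) \<longlongrightarrow> 0) (at 0)" by simp
  qed auto
qed

section \<open>Translation continuity and mollification\<close>

lemma nn_integral_translate:
  assumes [measurable]: "f \<in> borel_measurable borel"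
  shows "(\<integral>\<^sup>+x. f (x + y) \<partial>lborel) = (\<integral>\<^sup>+x. f (x::'a::euclidean_space) \<partial>lborel)"
  using nn_integral_lborel_affine[OF assms, of 1 y] by (simp add: add.commute)

lemma power_sum3_le:
  fixes a b c :: real
  assumes "0 \<le> a" "0 \<le> b" "0 \<le> c"
  shows "(a + b + c) ^ p \<le> 3 ^ p * (a ^ p + b ^ p + c ^ p)"
proof -
  define m where "m = max a (max b c)"
  have "a + b + c \<le> 3 * m" by (simp add: m_def)
  then have "(a + b + c) ^ p \<le> (3 * m) ^ p" using assms by (intro power_mono) auto
  also have "\<dots> = 3 ^ p * m ^ p" by (simp add: power_mult_distrib)
  also have "m ^ p \<le> a ^ p + b ^ p + c ^ p"
    using assms zero_le_power[of a p] zero_le_power[of b p] zero_le_power[of c p]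
    unfolding m_def max_def by (auto split: if_splits)
  finally show ?thesis by simp
qed

lemma nn_integral_power_triangle:
  fixes w g h k :: "'a::euclidean_space \<Rightarrow> 'b::euclidean_space"
  assumes [measurable]: "w \<in> borel_measurable borel" "g \<in> borel_measurable borel"
    "h \<in> borel_measurable borel" "k \<in> borel_measurable borel"
  shows "(\<integral>\<^sup>+x. ennreal (norm (w x - k x) ^ p) \<partial>lborel)
    \<le> ennreal (3 ^ p) * ((\<integral>\<^sup>+x. ennreal (norm (w x - g x) ^ p) \<partial>lborel)
      + (\<integral>\<^sup>+x. ennreal (norm (g x - h x) ^ p) \<partial>lborel) + (\<integral>\<^sup>+x. ennreal (norm (h x - k x) ^ p) \<partial>lborel))"
proof -
  have "ennreal (norm (w x - k x) ^ p)
      \<le> ennreal (3 ^ p) * (ennreal (norm (w x - g x) ^ p) + ennreal (norm (g x - h x) ^ p) + ennreal (norm (h x - k x) ^ p))" for x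
  proof -
    have "norm (w x - k x) \<le> norm (w x - g x) + norm (g x - h x) + norm (h x - k x)"
      using norm_triangle_ineq[of "w x - g x" "g x - h x"] norm_triangle_ineq[of "w x - h x" "h x - k x"] by simp
    then have "norm (w x - k x) ^ p \<le> (norm (w x - g x) + norm (g x - h x) + norm (h x - k x)) ^ p"
      by (intro power_mono) auto
    also have "\<dots> \<le> 3 ^ p * (norm (w x - g x) ^ p + norm (g x - h x) ^ p + norm (h x - k x) ^ p)"
      by (intro power_sum3_le) auto
    finally show ?thesis by (simp add: ennreal_plus[symmetric] ennreal_mult[symmetric] ennreal_leI del: ennreal_plus)
  qed
  then have "(\<integral>\<^sup>+x. ennreal (norm (w x - k x) ^ p) \<partial>lborel)
    \<le> (\<integral>\<^sup>+x. ennreal (3 ^ p) * (ennreal (norm (w x - g x) ^ p) + ennreal (norm (g x - h x) ^ p) + ennreal (norm (h x - k x) ^ p)) \<partial>lborel)"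
    by (rule nn_integral_mono)
  also have "\<dots> = ennreal (3 ^ p) * ((\<integral>\<^sup>+x. ennreal (norm (w x - g x) ^ p) \<partial>lborel)
      + (\<integral>\<^sup>+x. ennreal (norm (g x - h x) ^ p) \<partial>lborel) + (\<integral>\<^sup>+x. ennreal (norm (h x - k x) ^ p) \<partial>lborel))"
    by (simp add: nn_integral_cmult nn_integral_add)
  finally show ?thesis .
qed

lemma Lp_truncate:
  fixes w :: "'a::euclidean_space \<Rightarrow> 'b::euclidean_space"
  assumes [measurable]: "w \<in> borel_measurable borel" and p: "p > 0"
    and fin: "(\<integral>\<^sup>+x. ennreal (norm (w x) ^ p) \<partial>lborel) < \<infinity>" and e: "(0::ennreal) < e"
  obtains n :: nat where
    "(\<integral>\<^sup>+x. ennreal (norm (w x - (if norm x \<le> n \<and> norm (w x) \<le> n then w x else 0)) ^ p) \<partial>lborel) < e"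
proof -
  let ?w = "\<lambda>(n::nat) x. if norm x \<le> n \<and> norm (w x) \<le> n then w x else 0"
  have "(\<lambda>n. \<integral>\<^sup>+x. ennreal (norm (w x - ?w n x) ^ p) \<partial>lborel) \<longlonglongrightarrow> (\<integral>\<^sup>+x. 0 \<partial>(lborel :: 'a measure))"
  proof (rule nn_integral_dominated_convergence[where w="\<lambda>x. ennreal (norm (w x) ^ p)"])
    show "AE x in lborel. ennreal (norm (w x - ?w n x) ^ p) \<le> ennreal (norm (w x) ^ p)" for n
      using p by (intro AE_I2) (auto intro!: ennreal_leI)
    show "AE x in lborel. (\<lambda>n. ennreal (norm (w x - ?w n x) ^ p)) \<longlonglongrightarrow> 0"
    proof (rule AE_I2)
      fix x
      have "\<forall>\<^sub>F n in sequentially. ennreal (norm (w x - ?w n x) ^ p) = 0"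
        using eventually_ge_at_top[of "nat \<lceil>max (norm x) (norm (w x))\<rceil>"]
      proof eventually_elim
        case (elim n)
        then have "norm x \<le> n" "norm (w x) \<le> n" by linarith+
        then show ?case using p by simp
      qed
      then show "(\<lambda>n. ennreal (norm (w x - ?w n x) ^ p)) \<longlonglongrightarrow> 0" by (rule tendsto_eventually)
    qed
  qed (use fin in auto)
  then have "\<forall>\<^sub>F n in sequentially. (\<integral>\<^sup>+x. ennreal (norm (w x - ?w n x) ^ p) \<partial>lborel) < e"
    using e by (intro order_tendstoD) auto
  then show thesis using that by (auto dest: eventually_happens)
qed

text \<open>A measurable function is an almost everywhere limit of continuous ones. Projecting their values to a
  ball and cutting them off outside a compact set provides a dominating function.\<close>

lemma Lp_dense_bounded:
  fixes w :: "'a::euclidean_space \<Rightarrow> 'b::euclidean_space" and n :: real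
  assumes [measurable]: "w \<in> borel_measurable borel" and p: "p > 0" and n: "0 \<le> n"
    and supp: "\<And>x. n < norm x \<Longrightarrow> w x = 0" and bdd: "\<And>x. norm (w x) \<le> n" and e: "(0::ennreal) < e"
  obtains g where "continuous_on UNIV g" "\<And>x. n + 1 < norm x \<Longrightarrow> g x = 0"
    "(\<integral>\<^sup>+x. ennreal (norm (w x - g x) ^ p) \<partial>lborel) < e"
proof -
  have "w measurable_on UNIV"
    by (rule lebesgue_measurable_imp_measurable_on) (auto intro: measurable_completion)
  then obtain N h where N: "negligible N" and h: "\<And>i. continuous_on UNIV (h i)"
    "\<And>x. x \<notin> N \<Longrightarrow> (\<lambda>i. h i x) \<longlonglongrightarrow> w x"
    unfolding measurable_on_def by auto
  let ?clip = "closest_point (cball (0::'b) n)"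
  have clip: "continuous_on UNIV ?clip" "\<And>v. norm (?clip v) \<le> n" "\<And>v. norm v \<le> n \<Longrightarrow> ?clip v = v"
    using n closest_point_in_set[of "cball (0::'b) n"]
    by (auto intro!: continuous_on_closest_point closest_point_self)
  define \<theta> where "\<theta> = (\<lambda>x::'a. max 0 (min 1 (n + 1 - norm x)))"
  define g where "g = (\<lambda>i x. \<theta> x *\<^sub>R ?clip (h i x))"
  have gc: "continuous_on UNIV (g i)" for i
    unfolding g_def \<theta>_def
    by (intro continuous_intros continuous_on_compose2[OF clip(1) h(1)]) auto
  have [measurable]: "g i \<in> borel_measurable borel" for i
    by (rule borel_measurable_continuous_onI[OF gc])
  have th: "0 \<le> \<theta> x" "\<theta> x \<le> 1" for x by (auto simp: \<theta>_def)
  have g0: "g i x = 0" if "n + 1 < norm x" for i x using that by (simp add: g_def \<theta>_def)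
  have gb: "norm (g i x) \<le> n" for i x
    using mult_mono[OF th(2)[of x] clip(2)[of "h i x"]] th(1)[of x] by (simp add: g_def)
  have lim: "(\<lambda>i. g i x) \<longlonglongrightarrow> w x" if "x \<notin> N" for x
  proof -
    have "(\<lambda>i. ?clip (h i x)) \<longlonglongrightarrow> ?clip (w x)"
      using clip(1) h(2)[OF that] by (rule continuous_on_tendsto_compose) auto
    then have "(\<lambda>i. g i x) \<longlonglongrightarrow> \<theta> x *\<^sub>R ?clip (w x)"
      unfolding g_def by (intro tendsto_scaleR tendsto_const)
    also have "\<theta> x *\<^sub>R ?clip (w x) = w x"
    proof -
      have "?clip (w x) = w x" by (rule clip(3)[OF bdd])
      moreover have "\<theta> x *\<^sub>R w x = w x" using supp[of x] by (cases "norm x \<le> n") (auto simp: \<theta>_def)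
      ultimately show ?thesis by (simp only:)
    qed
    finally show ?thesis .
  qed
  have "(\<lambda>i. \<integral>\<^sup>+x. ennreal (norm (w x - g i x) ^ p) \<partial>lborel) \<longlonglongrightarrow> (\<integral>\<^sup>+x. 0 \<partial>(lborel :: 'a measure))"
  proof (rule nn_integral_dominated_convergence[where w="\<lambda>x. ennreal ((2 * n) ^ p) * indicator (cball 0 (n + 1)) x"])
    show "AE x in lborel. ennreal (norm (w x - g i x) ^ p) \<le> ennreal ((2 * n) ^ p) * indicator (cball 0 (n + 1)) x" for i
    proof (rule AE_I2)
      fix x
      have "norm (w x - g i x) \<le> 2 * n"
        using norm_triangle_ineq4[of "w x" "g i x"] bdd[of x] gb[of i x] by simp
      then have "norm (w x - g i x) ^ p \<le> (2 * n) ^ p" by (intro power_mono) auto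
      moreover have "w x - g i x = 0" if "n + 1 < norm x" using that supp[of x] g0[of x i] by simp
      ultimately show "ennreal (norm (w x - g i x) ^ p) \<le> ennreal ((2 * n) ^ p) * indicator (cball 0 (n + 1)) x"
        using p by (cases "norm x \<le> n + 1") (auto intro!: ennreal_leI)
    qed
    show "(\<integral>\<^sup>+x. ennreal ((2 * n) ^ p) * indicator (cball 0 (n + 1)) x \<partial>(lborel :: 'a measure)) < \<infinity>"
      using emeasure_lborel_cball_finite[of "0::'a" "n + 1"]
      by (subst nn_integral_cmult_indicator) (auto simp: ennreal_mult_less_top)
    have "AE x in lebesgue. x \<notin> N"
      using N by (auto simp: negligible_iff_null_sets intro: AE_not_in)
    then have "AE x in lborel. x \<notin> N" by (simp add: AE_completion_iff)
    then show "AE x in lborel. (\<lambda>i. ennreal (norm (w x - g i x) ^ p)) \<longlonglongrightarrow> 0"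
    proof eventually_elim
      case (elim x)
      have "(\<lambda>i. norm (w x - g i x) ^ p) \<longlonglongrightarrow> norm (w x - w x) ^ p"
        by (intro tendsto_power tendsto_norm tendsto_diff tendsto_const lim elim)
      then have "(\<lambda>i. ennreal (norm (w x - g i x) ^ p)) \<longlonglongrightarrow> ennreal (norm (w x - w x) ^ p)"
        by (rule tendsto_ennrealI)
      moreover have "norm (w x - w x) ^ p = 0" using p by simp
      ultimately show ?case by (simp only: ennreal_0)
    qed
  qed (measurable, auto)
  then have "\<forall>\<^sub>F i in sequentially. (\<integral>\<^sup>+x. ennreal (norm (w x - g i x) ^ p) \<partial>lborel) < e"
    using e by (intro order_tendstoD) auto
  then obtain i where "(\<integral>\<^sup>+x. ennreal (norm (w x - g i x) ^ p) \<partial>lborel) < e" by (auto dest: eventually_happens)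
  then show thesis using that[OF gc g0] by blast
qed

lemma Lp_dense:
  fixes w :: "'a::euclidean_space \<Rightarrow> 'b::euclidean_space"
  assumes [measurable]: "w \<in> borel_measurable borel" and p: "p > 0"
    and fin: "(\<integral>\<^sup>+x. ennreal (norm (w x) ^ p) \<partial>lborel) < \<infinity>" and e: "0 < e"
  obtains g and R :: real where "continuous_on UNIV g" "0 \<le> R" "\<And>x. R < norm x \<Longrightarrow> g x = 0"
    "(\<integral>\<^sup>+x. ennreal (norm (w x - g x) ^ p) \<partial>lborel) \<le> ennreal e"
proof -
  define d where "d = e / (2 * 3 ^ p)"
  have d: "0 < ennreal d" using e by (simp add: d_def)
  obtain n :: nat where n: "(\<integral>\<^sup>+x. ennreal (norm (w x - (if norm x \<le> n \<and> norm (w x) \<le> n then w x else 0)) ^ p) \<partial>lborel) < ennreal d"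
    using Lp_truncate[OF assms(1) p fin d] by blast
  define v where "v = (\<lambda>x. if norm x \<le> n \<and> norm (w x) \<le> n then w x else 0)"
  have [measurable]: "v \<in> borel_measurable borel" unfolding v_def by measurable
  obtain g where g: "continuous_on UNIV g" "\<And>x. real n + 1 < norm x \<Longrightarrow> g x = 0"
    "(\<integral>\<^sup>+x. ennreal (norm (v x - g x) ^ p) \<partial>lborel) < ennreal d"
    by (rule Lp_dense_bounded[of v p "real n" "ennreal d"]) (use p d in \<open>auto simp: v_def\<close>)
  have [measurable]: "g \<in> borel_measurable borel" by (rule borel_measurable_continuous_onI[OF g(1)])
  have "(\<integral>\<^sup>+x. ennreal (norm (w x - g x) ^ p) \<partial>lborel)
    \<le> ennreal (3 ^ p) * ((\<integral>\<^sup>+x. ennreal (norm (w x - v x) ^ p) \<partial>lborel)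
      + (\<integral>\<^sup>+x. ennreal (norm (v x - g x) ^ p) \<partial>lborel) + (\<integral>\<^sup>+x. ennreal (norm (g x - g x) ^ p) \<partial>lborel))"
    by (rule nn_integral_power_triangle) measurable
  also have "\<dots> \<le> ennreal (3 ^ p) * (ennreal d + ennreal d + 0)"
    using n g(3) p by (intro mult_left_mono add_mono) (auto simp: v_def)
  also have "\<dots> = ennreal e"
    using e by (simp add: d_def ennreal_plus[symmetric] ennreal_mult[symmetric] del: ennreal_plus)
  finally show thesis using that[OF g(1), of "real n + 1"] g(2) by simp
qed

text \<open>For continuous functions of compact support this is uniform continuity; translation invariance of
  Lebesgue measure carries it over to \<open>L\<^sup>p\<close> limits.\<close>

lemma Lp_translation_continuous:
  fixes w :: "'a::euclidean_space \<Rightarrow> 'b::euclidean_space"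
  assumes w[measurable]: "w \<in> borel_measurable borel" and p: "p > 0"
    and fin: "(\<integral>\<^sup>+x. ennreal (norm (w x) ^ p) \<partial>lborel) < \<infinity>" and e: "0 < e"
  obtains d where "d > 0" "\<And>y. norm y < d \<Longrightarrow> (\<integral>\<^sup>+x. ennreal (norm (w (x + y) - w x) ^ p) \<partial>lborel) \<le> ennreal e"
proof -
  \<comment> \<open>three error terms, and the factor \<open>3 ^ p\<close> of the triangle inequality for \<open>p\<close>-th powers\<close>
  define e' where "e' = e / (3 * 3 ^ p)"
  have e': "e' > 0" using e by (simp add: e'_def)
  obtain g R where g: "continuous_on UNIV g" "0 \<le> R" "\<And>x. R < norm x \<Longrightarrow> g x = 0"
    "(\<integral>\<^sup>+x. ennreal (norm (w x - g x) ^ p) \<partial>lborel) \<le> ennreal e'"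
    using Lp_dense[OF w p fin e'] by metis
  have [measurable]: "g \<in> borel_measurable borel" by (rule borel_measurable_continuous_onI[OF g(1)])
  define V where "V = measure lborel (cball (0::'a) (R + 1))"
  have V: "V \<ge> 0" "emeasure lborel (cball (0::'a) (R + 1)) = ennreal V"
    unfolding V_def by (auto simp: emeasure_eq_ennreal_measure less_imp_neq[OF emeasure_lborel_cball_finite, unfolded infinity_ennreal_def])
  define \<eta> where "\<eta> = min 1 (e' / (V + 1))"
  have \<eta>: "\<eta> > 0" "\<eta> \<le> 1" "\<eta> * V \<le> e'"
  proof -
    have "\<eta> * V \<le> e' / (V + 1) * V" using V by (intro mult_right_mono) (auto simp: \<eta>_def)
    also have "\<dots> \<le> e'" using V e' by (simp add: field_simps)
    finally show "\<eta> * V \<le> e'" .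
  qed (use V e' in \<open>auto simp: \<eta>_def\<close>)
  have "uniformly_continuous_on (cball 0 (R + 2)) g"
    by (intro compact_uniformly_continuous continuous_on_subset[OF g(1)]) auto
  then obtain d where d: "d > 0" "\<And>x x'. x \<in> cball 0 (R + 2) \<Longrightarrow> x' \<in> cball 0 (R + 2) \<Longrightarrow> dist x' x < d \<Longrightarrow> dist (g x') (g x) < \<eta>"
    using \<eta>(1) unfolding uniformly_continuous_on_def by metis
  show thesis
  proof (rule that[of "min 1 d"])
    show "min 1 d > 0" using d by simp
    fix y :: 'a assume y: "norm y < min 1 d"
    have pt: "ennreal (norm (g (x + y) - g x) ^ p) \<le> ennreal \<eta> * indicator (cball 0 (R + 1)) x" for x
    proof (cases "norm x \<le> R + 1")
      case True
      have "norm (x + y) \<le> R + 2" using norm_triangle_ineq[of x y] True y by simp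
      then have "x + y \<in> cball 0 (R + 2)" "x \<in> cball 0 (R + 2)" using True by (auto simp only: mem_cball dist_0_norm)
      moreover have "dist (x + y) x < d" using y by (simp add: dist_norm)
      ultimately have "dist (g (x + y)) (g x) < \<eta>" using d(2) by blast
      then have "norm (g (x + y) - g x) < \<eta>" by (simp only: dist_norm)
      then have "norm (g (x + y) - g x) ^ p \<le> \<eta> ^ p" by (intro power_mono) auto
      also have "\<dots> \<le> \<eta> ^ 1" using p \<eta> by (intro power_decreasing) auto
      finally show ?thesis using True by (simp add: ennreal_leI)
    next
      case False
      moreover have "norm x \<le> norm (x + y) + norm y" using norm_triangle_ineq4[of "x + y" y] by simp
      ultimately have "R < norm (x + y)" "R < norm x" using y by auto
      then have "g (x + y) - g x = 0" using g(3) by simp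
      then have "ennreal (norm (g (x + y) - g x) ^ p) = 0" using p by (simp only: norm_zero zero_power ennreal_0)
      then show ?thesis by (rule ssubst) simp
    qed
    have "(\<integral>\<^sup>+x. ennreal (norm (g (x + y) - g x) ^ p) \<partial>lborel) \<le> (\<integral>\<^sup>+x. ennreal \<eta> * indicator (cball 0 (R + 1)) x \<partial>(lborel :: 'a measure))"
      by (rule nn_integral_mono) (rule pt)
    also have "\<dots> = ennreal (\<eta> * V)" using V \<eta>
      by (subst nn_integral_cmult_indicator) (auto simp: ennreal_mult)
    also have "\<dots> \<le> ennreal e'" using \<eta> by (simp add: ennreal_leI)
    finally have m: "(\<integral>\<^sup>+x. ennreal (norm (g (x + y) - g x) ^ p) \<partial>lborel) \<le> ennreal e'" .
    have t: "(\<integral>\<^sup>+x. ennreal (norm (w (x + y) - g (x + y)) ^ p) \<partial>lborel) \<le> ennreal e'"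
      using nn_integral_translate[of "\<lambda>x. ennreal (norm (w x - g x) ^ p)" y] g(4) by simp
    have "(\<integral>\<^sup>+x. ennreal (norm (w (x + y) - w x) ^ p) \<partial>lborel)
      \<le> ennreal (3 ^ p) * ((\<integral>\<^sup>+x. ennreal (norm (w (x + y) - g (x + y)) ^ p) \<partial>lborel)
        + (\<integral>\<^sup>+x. ennreal (norm (g (x + y) - g x) ^ p) \<partial>lborel) + (\<integral>\<^sup>+x. ennreal (norm (g x - w x) ^ p) \<partial>lborel))"
      by (rule nn_integral_power_triangle) measurable
    also have "\<dots> \<le> ennreal (3 ^ p) * (ennreal e' + ennreal e' + ennreal e')"
      using m t g(4) by (intro mult_left_mono add_mono) (auto simp: norm_minus_commute)
    also have "\<dots> = ennreal e"
      using e e' by (simp add: ennreal_plus[symmetric] ennreal_mult[symmetric] del: ennreal_plus) (simp add: e'_def)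
    finally show "(\<integral>\<^sup>+x. ennreal (norm (w (x + y) - w x) ^ p) \<partial>lborel) \<le> ennreal e" .
  qed
qed


lemma bump_measurable[measurable]: "bump r \<in> borel_measurable borel"
  unfolding bump_def flat_def by measurable

lemma integrable_bump: "r > 0 \<Longrightarrow> integrable lborel (bump r :: 'a::euclidean_space \<Rightarrow> real)"
proof (rule Bochner_Integration.integrable_bound[of _ "\<lambda>x. exp (-1) * indicator (cball (0::'a) r) x :: real"])
  show "integrable lborel (\<lambda>x. exp (-1) * indicator (cball (0::'a) r) x :: real)"
    using emeasure_lborel_cball_finite[of "0::'a" r] by (intro integrable_mult_right integrable_real_indicator) auto
  assume r: "r > 0"
  show "AE x in lborel. norm (bump r (x::'a)) \<le> norm (exp (-1) * indicator (cball 0 r) x :: real)"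
  proof (rule AE_I2)
    fix x :: 'a
    show "norm (bump r x) \<le> norm (exp (-1) * indicator (cball 0 r) x :: real)"
      using bump_bounds[OF r, of x] bump_eq_0[OF r, of x] by (cases "norm x \<le> r") auto
  qed
qed measurable

lemma integral_bump_pos: "r > 0 \<Longrightarrow> 0 < (LINT x|lborel. bump r (x::'a::euclidean_space))"
proof -
  assume r: "r > 0"
  have "(LINT x|lborel. bump r (x::'a)) \<noteq> 0"
  proof
    assume "(LINT x|lborel. bump r (x::'a)) = 0"
    then have "AE x in lborel. bump r (x::'a) = 0"
      using integral_nonneg_eq_0_iff_AE[OF integrable_bump[OF r, where 'a='a]] bump_bounds(1)[OF r] by auto
    then have "{x::'a. bump r x \<noteq> 0} \<in> null_sets lborel" by (subst (asm) AE_iff_null) auto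
    then have "negligible {x::'a. bump r x \<noteq> 0}" by (simp add: negligible_iff_null_sets null_sets_completionI)
    then have "negligible (ball (0::'a) r)" by (rule negligible_subset) (use bump_pos[OF r] in force)
    then show False using r open_not_negligible[of "ball (0::'a) r"] by auto
  qed
  moreover have "0 \<le> (LINT x|lborel. bump r (x::'a))" using bump_bounds(1)[OF r] by (intro integral_nonneg_AE) auto
  ultimately show ?thesis by simp
qed

text \<open>The standard mollifier, supported in the ball of radius \<open>r\<close>.\<close>

definition moll :: "real \<Rightarrow> 'a::euclidean_space \<Rightarrow> real" where
  "moll r x = 1 / (LINT x|lborel. bump r (x::'a)) * bump r x"

lemma moll_measurable[measurable]: "moll r \<in> borel_measurable borel"
  unfolding moll_def by measurable

lemma moll_nonneg: "r > 0 \<Longrightarrow> 0 \<le> moll r (x::'a::euclidean_space)"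
  using integral_bump_pos[of r, where 'a='a] bump_bounds(1)[of r x] by (simp add: moll_def)

lemma moll_eq_0: "r > 0 \<Longrightarrow> r \<le> norm x \<Longrightarrow> moll r x = 0"
  by (simp add: moll_def bump_eq_0)

lemma moll_commute: "moll r (x - y) = moll r (y - x)"
  by (simp add: moll_def bump_commute)

lemma test_function_moll: "r > 0 \<Longrightarrow> test_function (\<lambda>x. moll r (x - a))"
  unfolding moll_def by (intro test_function_cmult test_function_bump)

lemma nn_integral_moll: "r > 0 \<Longrightarrow> (\<integral>\<^sup>+x. ennreal (moll r (x::'a::euclidean_space)) \<partial>lborel) = 1"
proof -
  assume r: "r > 0"
  have "(\<integral>\<^sup>+x. ennreal (moll r (x::'a)) \<partial>lborel) = ennreal (LINT x|lborel. moll r (x::'a))"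
    using moll_nonneg[OF r] integrable_bump[OF r, where 'a='a]
    by (intro nn_integral_eq_integral) (auto simp: moll_def intro!: integrable_mult_right)
  also have "(LINT x|lborel. moll r (x::'a)) = 1"
    using integral_bump_pos[OF r, where 'a='a] unfolding moll_def by (subst integral_mult_right_zero) simp
  finally show ?thesis by simp
qed

text \<open>Jensen's inequality for the two exponents in use, also when the right-hand side is infinite. Exponent
  \<open>1\<close> serves locally integrable weak gradients, exponent \<open>2\<close> the approximation in \<open>W\<^sup>1\<^sup>,\<^sup>2\<close>.\<close>

lemma (in prob_space) norm_integral_power_le:
  fixes h :: "'a \<Rightarrow> 'b::euclidean_space"
  assumes [measurable]: "h \<in> borel_measurable M" and p: "p = 1 \<or> p = 2"
  shows "ennreal (norm (LINT x|M. h x) ^ p) \<le> (\<integral>\<^sup>+x. ennreal (norm (h x) ^ p) \<partial>M)"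
proof (cases "(\<integral>\<^sup>+x. ennreal (norm (h x) ^ p) \<partial>M) = \<infinity>")
  case False
  then have ip: "integrable M (\<lambda>x. norm (h x) ^ p)"
    by (intro integrableI_nonneg) (auto simp: less_top)
  have ih: "integrable M h"
  proof (rule Bochner_Integration.integrable_bound[of _ "\<lambda>x. 1 + norm (h x) ^ p"])
    show "AE x in M. norm (h x) \<le> norm (1 + norm (h x) ^ p)"
    proof (rule AE_I2)
      fix x
      show "norm (h x) \<le> norm (1 + norm (h x) ^ p)"
        using p sum_squares_bound[of 1 "norm (h x)"] norm_ge_zero[of "h x"]
        by (auto simp del: norm_ge_zero)
    qed
  qed (use ip in auto)
  then have il: "integrable M (\<lambda>x. norm (h x))" by (rule integrable_norm)
  have "norm (LINT x|M. h x) ^ p \<le> (LINT x|M. norm (h x)) ^ p"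
    by (intro power_mono integral_norm_bound) simp
  also have "\<dots> \<le> (LINT x|M. norm (h x) ^ p)"
  proof (cases "p = 1")
    case False
    then have p2: "p = 2" using p by simp
    define m where "m = (LINT x|M. norm (h x))"
    have "0 \<le> (LINT x|M. (norm (h x) - m)\<^sup>2)" by (rule integral_nonneg_AE) simp
    also have "\<dots> = (LINT x|M. norm (h x) ^ 2 - 2 * m * norm (h x) + m\<^sup>2)"
      by (rule Bochner_Integration.integral_cong) (simp_all add: power2_diff algebra_simps)
    also have "\<dots> = (LINT x|M. norm (h x) ^ 2) - 2 * m * m + m\<^sup>2"
      using ip il p2 by (simp add: m_def prob_space)
    finally show ?thesis by (simp add: p2 m_def power2_eq_square)
  qed simp
  also have "ennreal (LINT x|M. norm (h x) ^ p) = (\<integral>\<^sup>+x. ennreal (norm (h x) ^ p) \<partial>M)"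
    by (rule nn_integral_eq_integral[symmetric, OF ip]) simp
  finally show ?thesis by (simp add: ennreal_leI)
qed simp

definition mollify :: "real \<Rightarrow> ('a::euclidean_space \<Rightarrow> 'b::euclidean_space) \<Rightarrow> 'a \<Rightarrow> 'b" where
  "mollify r w x = (LINT y|lborel. moll r (x - y) *\<^sub>R w y)"

lemma mollify_real: "mollify r w = (\<lambda>x. LINT y|lborel. (w y :: real) * moll r (x - y))"
  unfolding mollify_def by (simp add: mult.commute)

lemma mollify_measurable[measurable]:
  assumes [measurable]: "w \<in> borel_measurable borel"
  shows "mollify r w \<in> borel_measurable borel"
  unfolding mollify_def by measurable

lemma
  fixes f :: "'a::euclidean_space \<Rightarrow> 'b::{banach, second_countable_topology}"
  assumes [measurable]: "f \<in> borel_measurable borel"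
  shows integral_reflect: "(LINT y|lborel. f (x - y)) = (LINT y|lborel. f y)"
    and integrable_reflect: "integrable lborel (\<lambda>y. f (x - y)) \<longleftrightarrow> integrable lborel f"
proof -
  have d: "lborel = distr lborel borel (\<lambda>y::'a. x - y)"
    using lborel_affine[of "-1" x] by (simp add: density_1 one_ennreal_def[symmetric])
  have "(LINT y|lborel. f y) = (LINT y|(distr lborel borel (\<lambda>y::'a. x - y)). f y)" by (simp flip: d)
  then show "(LINT y|lborel. f (x - y)) = (LINT y|lborel. f y)" by (subst (asm) integral_distr) auto
  have "integrable lborel f \<longleftrightarrow> integrable (distr lborel borel (\<lambda>y::'a. x - y)) f" by (simp flip: d)
  then show "integrable lborel (\<lambda>y. f (x - y)) \<longleftrightarrow> integrable lborel f" by (subst (asm) integrable_distr_eq) auto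
qed

lemma moll_bounded:
  assumes "r > 0"
  obtains B where "B \<ge> 0" "\<And>x::'a::euclidean_space. \<bar>moll r x\<bar> \<le> B"
  using test_function_bounded[OF test_function_moll[OF assms, of "0::'a"]] by auto

lemma integrable_moll_times:
  fixes w :: "'a::euclidean_space \<Rightarrow> 'b::euclidean_space"
  assumes w: "integrable lborel w" and r: "r > 0"
  shows "integrable lborel (\<lambda>y. moll r (x - y) *\<^sub>R w y)"
proof -
  have [measurable]: "w \<in> borel_measurable borel" using borel_measurable_integrable[OF w] by simp
  obtain B where B: "\<And>x::'a. \<bar>moll r x\<bar> \<le> B" using moll_bounded[OF r] by metis
  show ?thesis
  proof (rule Bochner_Integration.integrable_bound[OF integrable_scaleR_right[OF w, of B]])
    show "AE y in lborel. norm (moll r (x - y) *\<^sub>R w y) \<le> norm (B *\<^sub>R w y)"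
      by (intro AE_I2) (auto intro!: mult_right_mono order_trans[OF B abs_ge_self])
  qed measurable
qed

text \<open>The mollification is an average of translates by vectors shorter than \<open>r\<close>, so by Jensen's inequality
  its \<open>L\<^sup>p\<close> distance from \<open>w\<close> is at most the largest one among these translates.\<close>

lemma mollify_tendsto_Lp:
  fixes w :: "'a::euclidean_space \<Rightarrow> 'b::euclidean_space"
  assumes w: "integrable lborel w" and p: "p = 1 \<or> p = 2"
    and fin: "(\<integral>\<^sup>+x. ennreal (norm (w x) ^ p) \<partial>lborel) < \<infinity>" and e: "0 < e"
  obtains d where "d > 0" "\<And>r. 0 < r \<Longrightarrow> r < d \<Longrightarrow> (\<integral>\<^sup>+x. ennreal (norm (mollify r w x - w x) ^ p) \<partial>lborel) \<le> ennreal e"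
proof -
  have wm[measurable]: "w \<in> borel_measurable borel" using borel_measurable_integrable[OF w] by simp
  have p0: "p > 0" using p by auto
  obtain d where d: "d > 0" "\<And>y. norm y < d \<Longrightarrow> (\<integral>\<^sup>+x. ennreal (norm (w (x + y) - w x) ^ p) \<partial>lborel) \<le> ennreal e"
    using Lp_translation_continuous[OF wm p0 fin e] by metis
  show thesis
  proof (rule that[OF d(1)])
    fix r assume r: "0 < r" "r < d"
    define \<mu> where "\<mu> = density lborel (\<lambda>z::'a. ennreal (moll r z))"
    interpret \<mu>: prob_space \<mu>
      by (rule prob_spaceI) (simp add: \<mu>_def emeasure_density nn_integral_moll[OF r(1)])
    have [measurable_cong]: "sets \<mu> = sets borel" by (simp add: \<mu>_def)
    have nonneg: "AE x in lborel. 0 \<le> moll r (x::'a)" using moll_nonneg[OF r(1)] by (intro AE_I2)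
    have iw: "integrable \<mu> (\<lambda>z. w (x - z))" for x
    proof -
      have "integrable lborel (\<lambda>z. moll r z *\<^sub>R w (x - z))"
        using integrable_moll_times[OF w r(1), of x] integrable_reflect[of "\<lambda>z. moll r z *\<^sub>R w (x - z)" x] by simp
      then show ?thesis
        unfolding \<mu>_def by (subst integrable_density) (use nonneg in auto)
    qed
    have conv_eq: "mollify r w x = (LINT z|\<mu>. w (x - z))" for x
    proof -
      have "mollify r w x = (LINT z|lborel. moll r z *\<^sub>R w (x - z))"
        unfolding mollify_def using integral_reflect[of "\<lambda>z. moll r z *\<^sub>R w (x - z)" x] by simp
      also have "\<dots> = (LINT z|\<mu>. w (x - z))"
        unfolding \<mu>_def by (subst integral_density) (use nonneg in auto)
      finally show ?thesis .
    qed
    have "(\<integral>\<^sup>+x. ennreal (norm (mollify r w x - w x) ^ p) \<partial>lborel)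
        \<le> (\<integral>\<^sup>+x. (\<integral>\<^sup>+z. ennreal (norm (w (x - z) - w x) ^ p) \<partial>\<mu>) \<partial>lborel)"
    proof (rule nn_integral_mono)
      fix x
      have "mollify r w x - w x = (LINT z|\<mu>. w (x - z) - w x)"
        using iw by (simp add: conv_eq \<mu>.prob_space)
      then show "ennreal (norm (mollify r w x - w x) ^ p) \<le> (\<integral>\<^sup>+z. ennreal (norm (w (x - z) - w x) ^ p) \<partial>\<mu>)"
        using \<mu>.norm_integral_power_le[of "\<lambda>z. w (x - z) - w x", OF _ p] by simp
    qed
    also have "\<dots> = (\<integral>\<^sup>+x. (\<integral>\<^sup>+z. ennreal (moll r z) * ennreal (norm (w (x - z) - w x) ^ p) \<partial>lborel) \<partial>lborel)"
      unfolding \<mu>_def by (subst nn_integral_density) auto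
    also have "\<dots> = (\<integral>\<^sup>+z. (\<integral>\<^sup>+x. ennreal (moll r z) * ennreal (norm (w (x - z) - w x) ^ p) \<partial>lborel) \<partial>lborel)"
      by (rule lborel_pair.Fubini') measurable
    also have "\<dots> = (\<integral>\<^sup>+z. ennreal (moll r z) * (\<integral>\<^sup>+x. ennreal (norm (w (x - z) - w x) ^ p) \<partial>lborel) \<partial>lborel)"
      by (simp add: nn_integral_cmult)
    also have "\<dots> \<le> (\<integral>\<^sup>+z. ennreal (moll r (z::'a)) * ennreal e \<partial>lborel)"
    proof (rule nn_integral_mono)
      fix z :: 'a
      show "ennreal (moll r z) * (\<integral>\<^sup>+x. ennreal (norm (w (x - z) - w x) ^ p) \<partial>lborel) \<le> ennreal (moll r z) * ennreal e"
      proof (cases "norm z < r")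
        case True
        then show ?thesis using d(2)[of "- z"] r by (intro mult_left_mono) auto
      qed (simp add: moll_eq_0[OF r(1)])
    qed
    also have "\<dots> = ennreal e" by (simp add: nn_integral_multc nn_integral_moll[OF r(1)])
    finally show "(\<integral>\<^sup>+x. ennreal (norm (mollify r w x - w x) ^ p) \<partial>lborel) \<le> ennreal e" .
  qed
qed

text \<open>Regularity of mollifications: the inequalities that define \<open>C11\<close> pass from \<open>\<psi>\<close> to superpositions of
  its translates.\<close>

lemma C11_convolution:
  fixes w :: "'a::euclidean_space \<Rightarrow> real"
  assumes w: "integrable lborel w" and \<psi>: "C11 L \<psi> D" and B: "\<And>x. \<bar>\<psi> x\<bar> \<le> B"
  shows "C11 (L * (LINT y|lborel. \<bar>w y\<bar>)) (\<lambda>x. LINT y|lborel. w y * \<psi> (x - y)) (\<lambda>x. LINT y|lborel. w y *\<^sub>R D (x - y))"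
    (is "C11 ?M ?F ?G")
proof -
  note c = C11D[OF \<psi>]
  have [measurable]: "w \<in> borel_measurable borel" "\<psi> \<in> borel_measurable borel" "D \<in> borel_measurable borel"
    using borel_measurable_integrable[OF w] C11_measurable[OF \<psi>] by auto
  have i1: "integrable lborel (\<lambda>y. w y * \<psi> (x - y))" for x
  proof (rule Bochner_Integration.integrable_bound[OF integrable_mult_left[OF integrable_norm[OF w]]])
    show "AE y in lborel. norm (w y * \<psi> (x - y)) \<le> norm (norm (w y) * B)"
      by (intro AE_I2) (auto simp: abs_mult intro!: mult_left_mono order_trans[OF B abs_ge_self])
  qed measurable
  have i2: "integrable lborel (\<lambda>y. w y *\<^sub>R D (x - y))" for x
  proof (rule Bochner_Integration.integrable_bound[OF integrable_mult_left[OF integrable_norm[OF w]]])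
    show "AE y in lborel. norm (w y *\<^sub>R D (x - y)) \<le> norm (norm (w y) * L)"
      by (intro AE_I2) (auto simp: abs_mult intro!: mult_left_mono order_trans[OF c(3) abs_ge_self])
  qed measurable
  have bound: "norm (LINT y|lborel. h y) \<le> ?M * s"
    if "integrable lborel h" "\<And>y. norm (h y) \<le> \<bar>w y\<bar> * (L * s)" for h :: "'a \<Rightarrow> 'b::{banach, second_countable_topology}" and s
  proof -
    have "norm (LINT y|lborel. h y) \<le> (LINT y|lborel. norm (h y))" by (rule integral_norm_bound)
    also have "\<dots> \<le> (LINT y|lborel. \<bar>w y\<bar> * (L * s))"
      using that integrable_abs[OF w] by (intro integral_mono integrable_norm integrable_mult_left) auto
    finally show ?thesis by (simp add: mult_ac)
  qed
  show ?thesis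
    unfolding C11_def
  proof (intro conjI allI)
    fix x y v :: 'a
    have "?F (x + v) - ?F x - ?G x \<bullet> v = (LINT y|lborel. w y * \<psi> (x + v - y) - w y * \<psi> (x - y) - (w y *\<^sub>R D (x - y)) \<bullet> v)"
      using i1[of "x + v"] i1[of x] i2[of x] integrable_inner_left[OF i2[of x], of v]
      by (simp del: inner_scaleR_left)
    also have "norm \<dots> \<le> ?M * (norm v)\<^sup>2"
    proof (rule bound)
      show "integrable lborel (\<lambda>y. w y * \<psi> (x + v - y) - w y * \<psi> (x - y) - (w y *\<^sub>R D (x - y)) \<bullet> v)"
        by (intro Bochner_Integration.integrable_diff i1 integrable_inner_left i2)
      fix y
      have "w y * \<psi> (x + v - y) - w y * \<psi> (x - y) - (w y *\<^sub>R D (x - y)) \<bullet> v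
          = w y * (\<psi> ((x - y) + v) - \<psi> (x - y) - D (x - y) \<bullet> v)"
        by (simp add: algebra_simps)
      then show "norm (w y * \<psi> (x + v - y) - w y * \<psi> (x - y) - (w y *\<^sub>R D (x - y)) \<bullet> v) \<le> \<bar>w y\<bar> * (L * (norm v)\<^sup>2)"
        using c(1)[of "x - y" v] by (simp add: abs_mult mult_left_mono)
    qed
    finally show "\<bar>?F (x + v) - ?F x - ?G x \<bullet> v\<bar> \<le> ?M * (norm v)\<^sup>2" by simp
    have "?F x - ?F y = (LINT z|lborel. w z * \<psi> (x - z) - w z * \<psi> (y - z))"
      using i1[of x] i1[of y] by simp
    also have "norm \<dots> \<le> ?M * norm (x - y)"
    proof (rule bound)
      show "integrable lborel (\<lambda>z. w z * \<psi> (x - z) - w z * \<psi> (y - z))"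
        by (intro Bochner_Integration.integrable_diff i1)
      show "norm (w z * \<psi> (x - z) - w z * \<psi> (y - z)) \<le> \<bar>w z\<bar> * (L * norm (x - y))" for z
        using c(2)[of "x - z" "y - z"] by (simp add: abs_mult mult_left_mono flip: right_diff_distrib)
    qed
    finally show "\<bar>?F x - ?F y\<bar> \<le> ?M * norm (x - y)" by simp
    show "norm (?G x) \<le> ?M"
      using bound[OF i2, of x 1] c(3) by (simp add: mult_left_mono)
    have "?G x - ?G y = (LINT z|lborel. w z *\<^sub>R D (x - z) - w z *\<^sub>R D (y - z))"
      using i2[of x] i2[of y] by simp
    also have "norm \<dots> \<le> ?M * norm (x - y)"
    proof (rule bound)
      show "integrable lborel (\<lambda>z. w z *\<^sub>R D (x - z) - w z *\<^sub>R D (y - z))"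
        by (intro Bochner_Integration.integrable_diff i2)
      show "norm (w z *\<^sub>R D (x - z) - w z *\<^sub>R D (y - z)) \<le> \<bar>w z\<bar> * (L * norm (x - y))" for z
        using c(4)[of "x - z" "y - z"] by (simp add: mult_left_mono flip: scaleR_diff_right)
    qed
    finally show "norm (?G x - ?G y) \<le> ?M * norm (x - y)" .
  qed
qed

section \<open>Weak gradients\<close>

lemma cball_in_borel[measurable]: "cball (x::'a::euclidean_space) r \<in> sets borel"
  by simp

lemma locally_integrable_measurable:
  fixes u :: "'a::euclidean_space \<Rightarrow> 'b::euclidean_space"
  assumes "locally_integrable u"
  shows "u \<in> borel_measurable borel"
proof (rule borel_measurable_LIMSEQ_metric)
  show "(\<lambda>x. indicator (cball 0 (real n)) x *\<^sub>R u x) \<in> borel_measurable borel" for n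
    using assms borel_measurable_integrable[of lborel "\<lambda>x. indicator (cball 0 (real n)) x *\<^sub>R u x"]
    unfolding locally_integrable_def set_integrable_def by simp
  fix x
  have "\<forall>\<^sub>F n in sequentially. indicator (cball 0 (real n)) x *\<^sub>R u x = u x"
    using eventually_ge_at_top[of "nat \<lceil>norm x\<rceil>"] by eventually_elim (simp add: nat_ceiling_le_eq)
  then show "(\<lambda>n. indicator (cball 0 (real n)) x *\<^sub>R u x) \<longlonglongrightarrow> u x" by (rule tendsto_eventually)
qed

lemma locally_integrable_cball:
  "locally_integrable u \<Longrightarrow> integrable lborel (\<lambda>x. indicator (cball 0 R) x *\<^sub>R u x)"
  unfolding locally_integrable_def set_integrable_def by simp

lemma locally_integrableI_cball:
  fixes u :: "'a::euclidean_space \<Rightarrow> 'b::euclidean_space"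
  assumes "u \<in> borel_measurable borel" "\<And>R. integrable lborel (\<lambda>x. indicator (cball 0 R) x *\<^sub>R u x)"
  shows "locally_integrable u"
  unfolding locally_integrable_def set_integrable_def
proof (intro allI impI)
  fix K :: "'a set" assume K: "compact K"
  obtain R where "\<forall>x\<in>K. norm x \<le> R" using compact_imp_bounded[OF K] unfolding bounded_iff by blast
  then have R: "K \<subseteq> cball 0 R" by auto
  note [measurable] = assms(1) borel_compact[OF K]
  show "integrable lborel (\<lambda>x. indicator K x *\<^sub>R u x)"
  proof (rule Bochner_Integration.integrable_bound[OF assms(2)[of R]])
    show "AE x in lborel. norm (indicator K x *\<^sub>R u x) \<le> norm (indicator (cball 0 R) x *\<^sub>R u x)"
    proof (rule AE_I2)
      fix x
      show "norm (indicator K x *\<^sub>R u x) \<le> norm (indicator (cball 0 R) x *\<^sub>R u x)"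
        using R by (cases "x \<in> K") (auto simp: subset_iff)
    qed
  qed measurable
qed

lemma integrable_locally_times:
  fixes u :: "'a::euclidean_space \<Rightarrow> 'b::euclidean_space"
  assumes u: "locally_integrable u" and [measurable]: "h \<in> borel_measurable borel"
    and B: "\<And>x. \<bar>h x\<bar> \<le> B" and R: "\<And>x. R < norm x \<Longrightarrow> h x = 0"
  shows "integrable lborel (\<lambda>x. h x *\<^sub>R u x)"
proof (rule Bochner_Integration.integrable_bound[OF integrable_scaleR_right[OF locally_integrable_cball[OF u, of R], of B]])
  note [measurable] = locally_integrable_measurable[OF u]
  show "(\<lambda>x. h x *\<^sub>R u x) \<in> borel_measurable lborel" by measurable
  show "AE x in lborel. norm (h x *\<^sub>R u x) \<le> norm (B *\<^sub>R indicator (cball 0 R) x *\<^sub>R u x)"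
  proof (rule AE_I2)
    fix x
    show "norm (h x *\<^sub>R u x) \<le> norm (B *\<^sub>R indicator (cball 0 R) x *\<^sub>R u x)"
      using R[of x] order_trans[OF B[of x] abs_ge_self] by (cases "norm x \<le> R") (auto intro!: mult_right_mono)
  qed
qed

lemma test_function_measurable: "test_function \<phi> \<Longrightarrow> \<phi> \<in> borel_measurable borel"
  unfolding test_function_def by (meson C_k_continuous borel_measurable_continuous_onI)

lemma integrable_test_times:
  fixes u :: "'a::euclidean_space \<Rightarrow> 'b::euclidean_space"
  assumes u: "locally_integrable u" and \<phi>: "test_function \<phi>"
  shows "integrable lborel (\<lambda>x. \<phi> x *\<^sub>R u x)"
proof -
  obtain R where "\<And>x. R < norm x \<Longrightarrow> \<phi> x = 0" using test_functionE[OF \<phi>] by metis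
  moreover obtain B where "\<And>x. \<bar>\<phi> x\<bar> \<le> B" using test_function_bounded[OF \<phi>] by metis
  ultimately show ?thesis by (intro integrable_locally_times[OF u test_function_measurable[OF \<phi>]])
qed

lemma has_weak_gradientD:
  assumes "has_weak_gradient u G"
  shows "locally_integrable u" "locally_integrable G"
    and "test_function \<phi> \<Longrightarrow> b \<in> Basis \<Longrightarrow>
      (LINT x|lborel. u x * frechet_derivative \<phi> (at x) b) = - (LINT x|lborel. (G x \<bullet> b) * \<phi> x)"
  using assms unfolding has_weak_gradient_def by auto

lemma frechet_derivative_translate:
  fixes \<phi> :: "'a::euclidean_space \<Rightarrow> real"
  assumes "\<phi> differentiable at (y - a)"
  shows "frechet_derivative (\<lambda>y. \<phi> (y - a)) (at y) = frechet_derivative \<phi> (at (y - a))"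
proof (rule frechet_derivative_eqI)
  have "((\<lambda>y. y - a) has_derivative (\<lambda>v. v)) (at y)" by (auto intro!: derivative_eq_intros)
  from has_derivative_compose[OF this assms[unfolded frechet_derivative_works]]
  show "((\<lambda>y. \<phi> (y - a)) has_derivative frechet_derivative \<phi> (at (y - a))) (at y)" by simp
qed

lemma test_function_moll0: "r > 0 \<Longrightarrow> test_function (moll r)"
  using test_function_moll[of r 0] by simp

lemma grad_moll_uminus:
  assumes "r > 0"
  shows "grad (moll r) (- x) = - grad (moll r) (x :: 'a::euclidean_space)"
proof (rule euclidean_eqI)
  fix b :: 'a assume "b \<in> Basis"
  note d = test_function_differentiable[OF test_function_moll0[OF assms]]
  have e: "(\<lambda>x::'a. moll r (- x)) = moll r" by (simp add: moll_def fun_eq_iff)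
  have "((\<lambda>x. moll r (- x)) has_derivative (\<lambda>v. grad (moll r) (- x) \<bullet> (- v))) (at x)"
    using has_derivative_compose[OF has_derivative_minus[OF has_derivative_ident] grad_has_derivative[OF d]] by simp
  then have "frechet_derivative (moll r) (at x) = (\<lambda>v. grad (moll r) (- x) \<bullet> (- v))"
    unfolding e by (rule frechet_derivative_eqI)
  then have "grad (moll r) x \<bullet> b = - (grad (moll r) (- x) \<bullet> b)" by (simp add: grad_inner[OF d])
  then show "grad (moll r) (- x) \<bullet> b = - grad (moll r) x \<bullet> b" by simp
qed

text \<open>Testing the weak gradient with \<open>y \<mapsto> moll r (x - y)\<close> shows that the gradient of a mollification is the
  mollification of the weak gradient. The sign in the definition of the weak gradient cancels against
  the one from differentiating in \<open>y\<close> instead of \<open>x\<close>.\<close>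

lemma weak_gradient_moll:
  fixes u :: "'a::euclidean_space \<Rightarrow> real"
  assumes G: "has_weak_gradient u G" and r: "r > 0" and b: "b \<in> Basis"
  shows "(LINT y|lborel. u y * (grad (moll r) (x - y) \<bullet> b)) = (LINT y|lborel. moll r (x - y) * (G y \<bullet> b))"
proof -
  note t = test_function_moll[OF r, of x] and d = test_function_differentiable[OF test_function_moll0[OF r]]
  have "grad (moll r) (x - y) \<bullet> b = - frechet_derivative (\<lambda>y. moll r (y - x)) (at y) b" for y
    using grad_moll_uminus[OF r, of "y - x"] by (simp add: frechet_derivative_translate[OF d] grad_inner[OF d])
  then have "(LINT y|lborel. u y * (grad (moll r) (x - y) \<bullet> b))
      = - (LINT y|lborel. u y * frechet_derivative (\<lambda>y. moll r (y - x)) (at y) b)" by simp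
  also have "\<dots> = (LINT y|lborel. (G y \<bullet> b) * moll r (y - x))"
    using has_weak_gradientD(3)[OF G t b] by simp
  finally show ?thesis by (simp add: moll_commute[of r x] mult.commute)
qed

lemma AE_eq_0_of_mollify_eq_0:
  fixes H :: "'a::euclidean_space \<Rightarrow> 'b::euclidean_space"
  assumes H: "integrable lborel H" and z: "\<And>r x. 0 < r \<Longrightarrow> r < 1 \<Longrightarrow> norm x \<le> R \<Longrightarrow> mollify r H x = 0"
  shows "AE x in lborel. norm x \<le> R \<longrightarrow> H x = 0"
proof -
  have [measurable]: "H \<in> borel_measurable borel" using borel_measurable_integrable[OF H] by simp
  have fin: "(\<integral>\<^sup>+x. ennreal (norm (H x) ^ 1) \<partial>lborel) < \<infinity>"
    using H by (simp add: integrable_iff_bounded)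
  have "(\<integral>\<^sup>+x. ennreal (norm (H x)) * indicator (cball 0 R) x \<partial>lborel) \<le> 0 + ennreal e" if e: "e > 0" for e
  proof -
    obtain d where d: "d > 0" "\<And>r. 0 < r \<Longrightarrow> r < d \<Longrightarrow> (\<integral>\<^sup>+x. ennreal (norm (mollify r H x - H x) ^ 1) \<partial>lborel) \<le> ennreal e"
      by (rule mollify_tendsto_Lp[OF H _ fin e]) auto
    define r where "r = min d 1 / 2"
    have r: "0 < r" "r < d" "r < 1" using d(1) by (auto simp: r_def)
    have "(\<integral>\<^sup>+x. ennreal (norm (H x)) * indicator (cball 0 R) x \<partial>lborel)
        \<le> (\<integral>\<^sup>+x. ennreal (norm (mollify r H x - H x) ^ 1) \<partial>lborel)"
      by (rule nn_integral_mono) (use z[OF r(1,3)] in \<open>auto split: split_indicator\<close>)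
    also have "\<dots> \<le> ennreal e" by (rule d(2)[OF r(1,2)])
    finally show ?thesis by simp
  qed
  then have "(\<integral>\<^sup>+x. ennreal (norm (H x)) * indicator (cball 0 R) x \<partial>lborel) \<le> 0"
    by (rule ennreal_le_epsilon)
  then have "AE x in lborel. ennreal (norm (H x)) * indicator (cball 0 R) x = 0"
    by (subst (asm) le_zero_eq, subst (asm) nn_integral_0_iff_AE) measurable
  then show ?thesis by eventually_elim (auto split: split_indicator_asm)
qed

text \<open>The difference of two weak gradients has vanishing mollifications, and these converge to it in \<open>L\<^sup>1\<close> on
  every ball.\<close>

lemma weak_gradient_unique:
  fixes u :: "'a::euclidean_space \<Rightarrow> real"
  assumes G: "has_weak_gradient u G" "has_weak_gradient u G'"
  shows "AE x in lborel. G x = G' x"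
proof -
  note l = has_weak_gradientD(2)[OF G(1)] has_weak_gradientD(2)[OF G(2)]
  have "AE x in lborel. norm x \<le> real n \<longrightarrow> G x - G' x = 0" for n
  proof -
    \<comment> \<open>the margin of \<open>1\<close> contains the support of every mollifier of radius below \<open>1\<close> centered in the ball\<close>
    define H where "H = (\<lambda>x. indicator (cball 0 (real n + 1)) x *\<^sub>R (G x - G' x))"
    have "AE x in lborel. norm x \<le> real n \<longrightarrow> H x = 0"
    proof (rule AE_eq_0_of_mollify_eq_0)
      show "integrable lborel H"
        using locally_integrable_cball[OF l(1)] locally_integrable_cball[OF l(2)]
        unfolding H_def scaleR_diff_right by (rule Bochner_Integration.integrable_diff)
      fix r :: real and x :: 'a assume r: "0 < r" "r < 1" "norm x \<le> real n"
      have i: "integrable lborel (\<lambda>y. moll r (x - y) *\<^sub>R G y)" "integrable lborel (\<lambda>y. moll r (x - y) *\<^sub>R G' y)"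
        using integrable_test_times[OF l(1) test_function_moll[OF r(1)]] integrable_test_times[OF l(2) test_function_moll[OF r(1)]]
        by (simp_all add: moll_commute[of r x])
      have "mollify r H x = (LINT y|lborel. moll r (x - y) *\<^sub>R G y - moll r (x - y) *\<^sub>R G' y)"
        unfolding mollify_def
      proof (rule Bochner_Integration.integral_cong[OF refl])
        fix y
        show "moll r (x - y) *\<^sub>R H y = moll r (x - y) *\<^sub>R G y - moll r (x - y) *\<^sub>R G' y"
        proof (cases "norm (x - y) < r")
          case True
          then have "norm y \<le> real n + 1" using norm_triangle_ineq4[of x "x - y"] r by simp
          then show ?thesis by (simp add: H_def scaleR_diff_right)
        qed (simp add: moll_eq_0[OF r(1)])
      qed
      also have "\<dots> = (LINT y|lborel. moll r (x - y) *\<^sub>R G y) - (LINT y|lborel. moll r (x - y) *\<^sub>R G' y)"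
        using i by simp
      also have "\<dots> = 0"
      proof (rule euclidean_eqI)
        fix b :: 'a assume b: "b \<in> Basis"
        have "(LINT y|lborel. moll r (x - y) *\<^sub>R G y) \<bullet> b = (LINT y|lborel. moll r (x - y) * (G y \<bullet> b))"
          using integral_inner_left[OF i(1), of b] by simp
        moreover have "(LINT y|lborel. moll r (x - y) *\<^sub>R G' y) \<bullet> b = (LINT y|lborel. moll r (x - y) * (G' y \<bullet> b))"
          using integral_inner_left[OF i(2), of b] by simp
        ultimately show "((LINT y|lborel. moll r (x - y) *\<^sub>R G y) - (LINT y|lborel. moll r (x - y) *\<^sub>R G' y)) \<bullet> b = 0 \<bullet> b"
          using weak_gradient_moll[OF G(1) r(1) b, of x] weak_gradient_moll[OF G(2) r(1) b, of x]
          by (simp add: inner_diff_left)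
      qed
      finally show "mollify r H x = 0" .
    qed
    then show ?thesis by eventually_elim (auto simp: H_def)
  qed
  then have "AE x in lborel. \<forall>n::nat. norm x \<le> real n \<longrightarrow> G x - G' x = 0" by (subst AE_all_countable) blast
  then show ?thesis
  proof eventually_elim
    case (elim x)
    then show ?case using real_arch_simple[of "norm x"] by auto
  qed
qed

lemma mult_le_weighted_squares:
  fixes a b s :: real
  assumes "s > 0"
  shows "\<bar>a * b\<bar> \<le> s * a\<^sup>2 + b\<^sup>2 / s"
proof -
  have "0 \<le> (s * \<bar>a\<bar> - \<bar>b\<bar>)\<^sup>2" by simp
  then have "2 * s * (\<bar>a\<bar> * \<bar>b\<bar>) \<le> s\<^sup>2 * a\<^sup>2 + b\<^sup>2" by (simp add: power2_diff power_mult_distrib mult_ac)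
  moreover have "0 \<le> s * (\<bar>a\<bar> * \<bar>b\<bar>)" using assms by simp
  ultimately have "s * \<bar>a * b\<bar> \<le> s\<^sup>2 * a\<^sup>2 + b\<^sup>2" unfolding abs_mult by linarith
  then show ?thesis using assms by (simp add: field_simps power2_eq_square)
qed

lemma mollify_tendsto_L2:
  fixes w :: "'a::euclidean_space \<Rightarrow> 'b::euclidean_space"
  assumes w: "integrable lborel w" "integrable lborel (\<lambda>x. (norm (w x))\<^sup>2)" and e: "0 < e"
  obtains d where "d > 0" "\<And>r. 0 < r \<Longrightarrow> r < d \<Longrightarrow> integrable lborel (\<lambda>x. (norm (mollify r w x - w x))\<^sup>2)"
    "\<And>r. 0 < r \<Longrightarrow> r < d \<Longrightarrow> (LINT x|lborel. (norm (mollify r w x - w x))\<^sup>2) \<le> e"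
proof -
  have [measurable]: "w \<in> borel_measurable borel" using borel_measurable_integrable[OF w(1)] by simp
  have fin: "(\<integral>\<^sup>+x. ennreal (norm (w x) ^ 2) \<partial>lborel) < \<infinity>"
    using w(2) by (simp add: integrable_iff_bounded)
  obtain d where d: "d > 0" "\<And>r. 0 < r \<Longrightarrow> r < d \<Longrightarrow> (\<integral>\<^sup>+x. ennreal (norm (mollify r w x - w x) ^ 2) \<partial>lborel) \<le> ennreal e"
    by (rule mollify_tendsto_Lp[OF w(1) _ fin e]) auto
  show thesis
  proof (rule that[OF d(1)])
    fix r assume r: "0 < r" "r < d"
    show "integrable lborel (\<lambda>x. (norm (mollify r w x - w x))\<^sup>2)"
      using le_less_trans[OF d(2)[OF r] ennreal_less_top] by (intro integrableI_nonneg) auto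
    have "(LINT x|lborel. (norm (mollify r w x - w x))\<^sup>2) = enn2real (\<integral>\<^sup>+x. ennreal (norm (mollify r w x - w x) ^ 2) \<partial>lborel)"
      by (intro integral_eq_nn_integral) auto
    also have "\<dots> \<le> e" using d(2)[OF r] e by (intro enn2real_leI) auto
    finally show "(LINT x|lborel. (norm (mollify r w x - w x))\<^sup>2) \<le> e" .
  qed
qed

lemma integrable_mult_inner_L2:
  fixes A :: "'a::euclidean_space \<Rightarrow> real" and w :: "'a \<Rightarrow> 'b::euclidean_space"
  assumes [measurable]: "A \<in> borel_measurable borel" "w \<in> borel_measurable borel"
    and i: "integrable lborel (\<lambda>x. (A x)\<^sup>2)" "integrable lborel (\<lambda>x. (norm (w x))\<^sup>2)" and s: "s > 0" and c: "norm c \<le> 1"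
  shows "integrable lborel (\<lambda>x. A x * (w x \<bullet> c))"
    and "\<bar>LINT x|lborel. A x * (w x \<bullet> c)\<bar> \<le> s * (LINT x|lborel. (A x)\<^sup>2) + (LINT x|lborel. (norm (w x))\<^sup>2) / s"
proof -
  have le: "\<bar>A x * (w x \<bullet> c)\<bar> \<le> s * (A x)\<^sup>2 + (norm (w x))\<^sup>2 / s" for x
  proof -
    have "\<bar>w x \<bullet> c\<bar> \<le> norm (w x) * 1"
      using Cauchy_Schwarz_ineq2[of "w x" c] c by (meson mult_left_mono norm_ge_zero order_trans)
    then have "\<bar>A x * (w x \<bullet> c)\<bar> \<le> \<bar>A x * norm (w x)\<bar>" by (simp add: abs_mult mult_left_mono)
    then show ?thesis using mult_le_weighted_squares[OF s, of "A x" "norm (w x)"] by simp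
  qed
  have i2: "integrable lborel (\<lambda>x. s * (A x)\<^sup>2 + (norm (w x))\<^sup>2 / s)" using i by auto
  show i3: "integrable lborel (\<lambda>x. A x * (w x \<bullet> c))"
  proof (rule Bochner_Integration.integrable_bound[OF i2])
    show "AE x in lborel. norm (A x * (w x \<bullet> c)) \<le> norm (s * (A x)\<^sup>2 + (norm (w x))\<^sup>2 / s)"
      using le by (intro AE_I2) (auto intro: order_trans[OF _ abs_ge_self])
  qed measurable
  have "\<bar>LINT x|lborel. A x * (w x \<bullet> c)\<bar> \<le> (LINT x|lborel. s * (A x)\<^sup>2 + (norm (w x))\<^sup>2 / s)"
    by (rule order_trans[OF integral_abs_bound integral_mono[OF integrable_abs[OF i3] i2 le]])
  then show "\<bar>LINT x|lborel. A x * (w x \<bullet> c)\<bar> \<le> s * (LINT x|lborel. (A x)\<^sup>2) + (LINT x|lborel. (norm (w x))\<^sup>2) / s"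
    using i by simp
qed

text \<open>Mollification converges weakly when tested with square integrable functions, by the weighted
  inequality \<open>|A d| \<le> s A\<^sup>2 + d\<^sup>2 / s\<close> with a small \<open>s\<close> chosen before the radius of the mollifier.\<close>

lemma mollify_pairing_tendsto:
  fixes A :: "'a::euclidean_space \<Rightarrow> real" and w :: "'a \<Rightarrow> 'b::euclidean_space"
  assumes A[measurable]: "A \<in> borel_measurable borel" and iA: "integrable lborel (\<lambda>x. (A x)\<^sup>2)"
    and w: "integrable lborel w" "integrable lborel (\<lambda>x. (norm (w x))\<^sup>2)" and c: "norm c \<le> 1" and e: "0 < e"
  obtains d where "d > 0" "\<And>r. 0 < r \<Longrightarrow> r < d \<Longrightarrow> integrable lborel (\<lambda>x. A x * (mollify r w x \<bullet> c))"
    "\<And>r. 0 < r \<Longrightarrow> r < d \<Longrightarrow> \<bar>(LINT x|lborel. A x * (mollify r w x \<bullet> c)) - (LINT x|lborel. A x * (w x \<bullet> c))\<bar> \<le> e"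
proof -
  have wm[measurable]: "w \<in> borel_measurable borel" using borel_measurable_integrable[OF w(1)] by simp
  define I where "I = (LINT x|lborel. (A x)\<^sup>2)"
  have I: "I \<ge> 0" unfolding I_def by (rule integral_nonneg_AE) simp
  define s where "s = e / (2 * (I + 1))"
  have s: "s > 0" "s * I \<le> e / 2"
    using I e by (auto simp: s_def field_simps)
  have es: "0 < e * s / 2" using e s by simp
  obtain d where d: "d > 0" "\<And>r. 0 < r \<Longrightarrow> r < d \<Longrightarrow> integrable lborel (\<lambda>x. (norm (mollify r w x - w x))\<^sup>2)"
    "\<And>r. 0 < r \<Longrightarrow> r < d \<Longrightarrow> (LINT x|lborel. (norm (mollify r w x - w x))\<^sup>2) \<le> e * s / 2"
    by (rule mollify_tendsto_L2[OF w es]) blast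
  show thesis
  proof (rule that[OF d(1)])
    fix r assume r: "0 < r" "r < d"
    have m: "(\<lambda>x. mollify r w x - w x) \<in> borel_measurable borel" by measurable
    note i1 = integrable_mult_inner_L2(1)[OF A wm iA w(2) s(1) c]
    note i2 = integrable_mult_inner_L2[OF A m iA d(2)[OF r] s(1) c]
    have eq: "A x * (mollify r w x \<bullet> c) = A x * ((mollify r w x - w x) \<bullet> c) + A x * (w x \<bullet> c)" for x
      by (simp add: inner_diff_left algebra_simps)
    show "integrable lborel (\<lambda>x. A x * (mollify r w x \<bullet> c))"
      unfolding eq by (intro Bochner_Integration.integrable_add i1 i2(1))
    have "(LINT x|lborel. A x * (mollify r w x \<bullet> c)) - (LINT x|lborel. A x * (w x \<bullet> c))
        = (LINT x|lborel. A x * ((mollify r w x - w x) \<bullet> c))"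
      unfolding eq Bochner_Integration.integral_add[OF i2(1) i1] by simp
    also have "\<bar>\<dots>\<bar> \<le> s * I + (LINT x|lborel. (norm (mollify r w x - w x))\<^sup>2) / s"
      using i2(2) by (simp add: I_def)
    also have "\<dots> \<le> e / 2 + (e * s / 2) / s"
      using s d(3)[OF r] by (intro add_mono divide_right_mono) auto
    also have "\<dots> = e" using s by simp
    finally show "\<bar>(LINT x|lborel. A x * (mollify r w x \<bullet> c)) - (LINT x|lborel. A x * (w x \<bullet> c))\<bar> \<le> e" .
  qed
qed

lemma convolution_has_derivative:
  fixes w :: "'a::euclidean_space \<Rightarrow> real"
  assumes w: "integrable lborel w" and \<psi>: "test_function \<psi>"
  shows "((\<lambda>x. LINT y|lborel. w y * \<psi> (x - y)) has_derivative (\<lambda>v. (LINT y|lborel. w y *\<^sub>R grad \<psi> (x - y)) \<bullet> v)) (at x)"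
    and "(LINT y|lborel. w y *\<^sub>R grad \<psi> (x - y)) \<bullet> b = (LINT y|lborel. w y * (grad \<psi> (x - y) \<bullet> b))"
proof -
  obtain L where L: "C11 L \<psi> (grad \<psi>)" using test_function_C11[OF \<psi>] by metis
  obtain B where B: "\<And>x. \<bar>\<psi> x\<bar> \<le> B" using test_function_bounded[OF \<psi>] by metis
  show "((\<lambda>x. LINT y|lborel. w y * \<psi> (x - y)) has_derivative (\<lambda>v. (LINT y|lborel. w y *\<^sub>R grad \<psi> (x - y)) \<bullet> v)) (at x)"
    by (rule C11_has_derivative[OF C11_convolution[OF w L B]])
  have [measurable]: "w \<in> borel_measurable borel" "grad \<psi> \<in> borel_measurable borel"
    using borel_measurable_integrable[OF w] C11_measurable[OF L] by auto
  have "integrable lborel (\<lambda>y. w y *\<^sub>R grad \<psi> (x - y))"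
  proof (rule Bochner_Integration.integrable_bound[OF integrable_mult_left[OF integrable_norm[OF w], of L]])
    show "AE y in lborel. norm (w y *\<^sub>R grad \<psi> (x - y)) \<le> norm (norm (w y) * L)"
      by (intro AE_I2) (auto simp: abs_mult intro!: mult_left_mono order_trans[OF C11D(3)[OF L] abs_ge_self])
  qed measurable
  from integral_inner_left[OF this, of b]
  show "(LINT y|lborel. w y *\<^sub>R grad \<psi> (x - y)) \<bullet> b = (LINT y|lborel. w y * (grad \<psi> (x - y) \<bullet> b))" by simp
qed

lemma convolution_C_k:
  fixes w :: "'a::euclidean_space \<Rightarrow> real"
  assumes w: "integrable lborel w" and \<psi>: "test_function \<psi>"
  shows "C_k m (\<lambda>x. LINT y|lborel. w y * \<psi> (x - y))"
proof (rule C_k_coinduct[where S="{\<lambda>x. LINT y|lborel. w y * \<psi> (x - y) |\<psi>. test_function \<psi>}"])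
  show "(\<lambda>x. LINT y|lborel. w y * \<psi> (x - y)) \<in> {\<lambda>x. LINT y|lborel. w y * \<psi> (x - y) |\<psi>. test_function \<psi>}"
    using \<psi> by blast
  fix \<phi> and b :: 'a assume "\<phi> \<in> {\<lambda>x. LINT y|lborel. w y * \<psi> (x - y) |\<psi>. test_function \<psi>}" and b: "b \<in> Basis"
  then obtain \<psi> where t: "test_function \<psi>" and \<phi>: "\<phi> = (\<lambda>x. LINT y|lborel. w y * \<psi> (x - y))" by blast
  have "(\<lambda>x. (LINT y|lborel. w y *\<^sub>R grad \<psi> (x - y)) \<bullet> b)
      = (\<lambda>x. LINT y|lborel. w y * frechet_derivative \<psi> (at (x - y)) b)"
    by (simp add: convolution_has_derivative(2)[OF w t] grad_inner[OF test_function_differentiable[OF t]])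
  moreover have "test_function (\<lambda>x. frechet_derivative \<psi> (at x) b)" by (rule test_function_partial[OF t b])
  ultimately have "(\<lambda>x. (LINT y|lborel. w y *\<^sub>R grad \<psi> (x - y)) \<bullet> b) \<in> {\<lambda>x. LINT y|lborel. w y * \<psi> (x - y) |\<psi>. test_function \<psi>}"
    by auto
  then show "\<exists>D. (\<forall>x. (\<phi> has_derivative D x) (at x))
      \<and> (\<lambda>x. D x b) \<in> {\<lambda>x. LINT y|lborel. w y * \<psi> (x - y) |\<psi>. test_function \<psi>}"
    using convolution_has_derivative(1)[OF w t] unfolding \<phi>
    by (intro exI[of _ "\<lambda>x v. (LINT y|lborel. w y *\<^sub>R grad \<psi> (x - y)) \<bullet> v"]) auto
qed


lemma grad_moll_eq_0: "r > 0 \<Longrightarrow> r < norm x \<Longrightarrow> grad (moll r) x = 0"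
  unfolding grad_def by (subst frechet_derivative_outside[of r]) (auto simp: moll_eq_0)

lemma eq_0_if_abs_le_epsilon:
  fixes x :: real
  assumes "\<And>e. e > 0 \<Longrightarrow> \<bar>x\<bar> \<le> 3 * e"
  shows "x = 0"
proof (rule ccontr)
  assume "x \<noteq> 0"
  then show False using assms[of "\<bar>x\<bar> / 6"] by simp
qed

text \<open>The chain rule for the square. A test function \<open>\<phi>\<close> is multiplied by a mollification \<open>u\<^sub>r\<close> of \<open>u\<close>, and
  the weak gradient of \<open>u\<close> is tested with \<open>\<phi> u\<^sub>r\<close>. As the gradient of \<open>u\<^sub>r\<close> is the mollification of \<open>V\<close>,
  all terms converge for \<open>r \<rightarrow> 0\<close> if \<open>u\<close> and \<open>V\<close> are locally square integrable.\<close>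

lemma has_weak_gradient_square:
  fixes u :: "'a::euclidean_space \<Rightarrow> real"
  assumes [measurable]: "u \<in> borel_measurable borel" "V \<in> borel_measurable borel"
    and G: "has_weak_gradient u V"
    and u2: "locally_integrable (\<lambda>x. (u x)\<^sup>2)" and V2: "locally_integrable (\<lambda>x. (norm (V x))\<^sup>2)"
  shows "has_weak_gradient (\<lambda>x. (u x)\<^sup>2) (\<lambda>x. (2 * u x) *\<^sub>R V x)"
proof -
  note lu = has_weak_gradientD(1)[OF G] and lV = has_weak_gradientD(2)[OF G]
  have luV: "locally_integrable (\<lambda>x. (2 * u x) *\<^sub>R V x)"
  proof (rule locally_integrableI_cball)
    fix R
    have i: "integrable lborel (\<lambda>x. indicator (cball 0 R) x *\<^sub>R (u x)\<^sup>2 + indicator (cball 0 R) x *\<^sub>R (norm (V x))\<^sup>2)"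
      by (intro Bochner_Integration.integrable_add locally_integrable_cball u2 V2)
    show "integrable lborel (\<lambda>x. indicator (cball 0 R) x *\<^sub>R (2 * u x) *\<^sub>R V x)"
    proof (rule Bochner_Integration.integrable_bound[OF i])
      show "AE x in lborel. norm (indicator (cball 0 R) x *\<^sub>R (2 * u x) *\<^sub>R V x)
          \<le> norm (indicator (cball 0 R) x *\<^sub>R (u x)\<^sup>2 + indicator (cball 0 R) x *\<^sub>R (norm (V x))\<^sup>2)"
      proof (rule AE_I2)
        fix x
        have "2 * \<bar>u x\<bar> * norm (V x) \<le> (u x)\<^sup>2 + (norm (V x))\<^sup>2"
          using sum_squares_bound[of "\<bar>u x\<bar>" "norm (V x)"] by simp
        then show "norm (indicator (cball 0 R) x *\<^sub>R (2 * u x) *\<^sub>R V x)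
          \<le> norm (indicator (cball 0 R) x *\<^sub>R (u x)\<^sup>2 + indicator (cball 0 R) x *\<^sub>R (norm (V x))\<^sup>2)"
          by (cases "norm x \<le> R") (auto simp: abs_mult)
      qed
    qed measurable
  qed measurable
  show ?thesis
    unfolding has_weak_gradient_def
  proof (intro conjI u2 luV allI impI ballI)
    fix \<phi> :: "'a \<Rightarrow> real" and b :: 'a assume \<phi>: "test_function \<phi>" and b: "b \<in> Basis"
    let ?d = "\<lambda>x. frechet_derivative \<phi> (at x) b"
    note \<phi>b = test_function_partial[OF \<phi> b]
    note [measurable] = test_function_measurable[OF \<phi>] test_function_measurable[OF \<phi>b]
    have b1: "norm b \<le> 1" using b by simp
    obtain R where R: "R > 0" "\<And>x. R < norm x \<Longrightarrow> \<phi> x = 0" using test_functionE[OF \<phi>] by metis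
    have Rd: "?d x = 0" if "R < norm x" for x
      using frechet_derivative_outside[OF R(2) that] by simp
    obtain B where B: "B \<ge> 0" "\<And>x. \<bar>\<phi> x\<bar> \<le> B" using test_function_bounded[OF \<phi>] by metis
    obtain B' where B': "B' \<ge> 0" "\<And>x. \<bar>?d x\<bar> \<le> B'" using test_function_bounded[OF \<phi>b] by metis
    \<comment> \<open>on the support of \<open>\<phi>\<close>, mollification with radius below \<open>1\<close> does not notice the truncation\<close>
    define w where "w = (\<lambda>x. indicator (cball 0 (R + 1)) x *\<^sub>R u x)"
    define W where "W = (\<lambda>x. indicator (cball 0 (R + 1)) x *\<^sub>R V x)"
    have wm[measurable]: "w \<in> borel_measurable borel" "W \<in> borel_measurable borel" unfolding w_def W_def by measurable
    have iw: "integrable lborel w" "integrable lborel W"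
      unfolding w_def W_def by (rule locally_integrable_cball[OF lu], rule locally_integrable_cball[OF lV])
    have "(\<lambda>x. (norm (w x))\<^sup>2) = (\<lambda>x. indicator (cball 0 (R + 1)) x *\<^sub>R (u x)\<^sup>2)"
      "(\<lambda>x. (norm (W x))\<^sup>2) = (\<lambda>x. indicator (cball 0 (R + 1)) x *\<^sub>R (norm (V x))\<^sup>2)"
      by (auto simp: fun_eq_iff w_def W_def split: split_indicator)
    then have iw2: "integrable lborel (\<lambda>x. (norm (w x))\<^sup>2)" "integrable lborel (\<lambda>x. (norm (W x))\<^sup>2)"
      using locally_integrable_cball[OF u2] locally_integrable_cball[OF V2] by simp_all
    define A1 where "A1 = (\<lambda>x. \<phi> x * u x)"
    define A2 where "A2 = (\<lambda>x. ?d x * u x)"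
    define A3 where "A3 = (\<lambda>x. \<phi> x * (V x \<bullet> b))"
    have Am[measurable]: "A1 \<in> borel_measurable borel" "A2 \<in> borel_measurable borel" "A3 \<in> borel_measurable borel"
      unfolding A1_def A2_def A3_def by measurable
    have iA1: "integrable lborel (\<lambda>x. (A1 x)\<^sup>2)"
    proof -
      have "integrable lborel (\<lambda>x. (\<phi> x)\<^sup>2 *\<^sub>R (u x)\<^sup>2)"
        using B R by (intro integrable_locally_times[OF u2, of _ "B\<^sup>2" R]) (auto simp: abs_le_square_iff[symmetric] abs_of_nonneg)
      then show ?thesis by (simp add: A1_def power_mult_distrib)
    qed
    have iA2: "integrable lborel (\<lambda>x. (A2 x)\<^sup>2)"
    proof -
      have "integrable lborel (\<lambda>x. (?d x)\<^sup>2 *\<^sub>R (u x)\<^sup>2)"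
        using B' Rd by (intro integrable_locally_times[OF u2, of _ "B'\<^sup>2" R]) (auto simp: abs_le_square_iff[symmetric] abs_of_nonneg)
      then show ?thesis by (simp add: A2_def power_mult_distrib)
    qed
    have iA3: "integrable lborel (\<lambda>x. (A3 x)\<^sup>2)"
    proof -
      have i: "integrable lborel (\<lambda>x. (\<phi> x)\<^sup>2 *\<^sub>R (norm (V x))\<^sup>2)"
        using B R by (intro integrable_locally_times[OF V2, of _ "B\<^sup>2" R]) (auto simp: abs_le_square_iff[symmetric] abs_of_nonneg)
      show ?thesis
      proof (rule Bochner_Integration.integrable_bound[OF i])
        have "(V x \<bullet> b)\<^sup>2 \<le> (norm (V x))\<^sup>2" for x
          using Basis_le_norm[OF b, of "V x"] by (simp add: abs_le_square_iff[symmetric])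
        then show "AE x in lborel. norm ((A3 x)\<^sup>2) \<le> norm ((\<phi> x)\<^sup>2 *\<^sub>R (norm (V x))\<^sup>2)"
          by (intro AE_I2) (auto simp: A3_def power_mult_distrib intro!: mult_left_mono)
      qed measurable
    qed
    \<comment> \<open>the weak gradient of \<open>u\<close>, tested with \<open>\<phi>\<close> times the mollification of \<open>u\<close>\<close>
    have key: "(LINT x|lborel. A2 x * (mollify r w x \<bullet> 1) + A1 x * (mollify r W x \<bullet> b)) = - (LINT x|lborel. A3 x * (mollify r w x \<bullet> 1))"
      if r: "0 < r" "r < 1" for r
    proof -
      note t = test_function_moll0[OF r(1)]
      note cw = mollify_real[of r w]
      note C = convolution_C_k[OF iw(1) t, folded cw]
      have D: "(mollify r w has_derivative (\<lambda>v. (LINT y|lborel. w y *\<^sub>R grad (moll r) (x - y)) \<bullet> v)) (at x)" for x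
        unfolding cw by (rule convolution_has_derivative(1)[OF iw(1) t])
      have Dd: "mollify r w differentiable at x" for x using D unfolding differentiable_def by blast
      have Db: "frechet_derivative (mollify r w) (at x) b = mollify r W x \<bullet> b" if x: "norm x \<le> R" for x
      proof -
        have inK: "y \<in> cball 0 (R + 1)" if "norm (x - y) \<le> r" for y
          using that x r norm_triangle_ineq4[of x "x - y"] by simp
        have "frechet_derivative (mollify r w) (at x) b = (LINT y|lborel. w y * (grad (moll r) (x - y) \<bullet> b))"
          unfolding frechet_derivative_eqI[OF D] by (rule convolution_has_derivative(2)[OF iw(1) t])
        also have "\<dots> = (LINT y|lborel. u y * (grad (moll r) (x - y) \<bullet> b))"
        proof (rule Bochner_Integration.integral_cong[OF refl])
          fix y
          show "w y * (grad (moll r) (x - y) \<bullet> b) = u y * (grad (moll r) (x - y) \<bullet> b)"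
            using inK[of y] grad_moll_eq_0[OF r(1), of "x - y"] by (cases "norm (x - y) \<le> r") (auto simp: w_def)
        qed
        also have "\<dots> = (LINT y|lborel. moll r (x - y) * (V y \<bullet> b))"
          by (rule weak_gradient_moll[OF G r(1) b])
        also have "\<dots> = (LINT y|lborel. (moll r (x - y) *\<^sub>R W y) \<bullet> b)"
        proof (rule Bochner_Integration.integral_cong[OF refl])
          fix y
          show "moll r (x - y) * (V y \<bullet> b) = (moll r (x - y) *\<^sub>R W y) \<bullet> b"
            using inK[of y] moll_eq_0[OF r(1), of "x - y"] by (cases "norm (x - y) \<le> r") (auto simp: W_def)
        qed
        also have "\<dots> = mollify r W x \<bullet> b"
        proof -
          have "integrable lborel (\<lambda>y. moll r (x - y) *\<^sub>R W y)" by (rule integrable_moll_times[OF iw(2) r(1)])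
          then show ?thesis unfolding mollify_def by (rule integral_inner_left)
        qed
        finally show ?thesis .
      qed
      have t\<phi>: "test_function (\<lambda>x. mollify r w x * \<phi> x)" by (rule test_function_mult[OF C \<phi>])
      have "u x * frechet_derivative (\<lambda>x. mollify r w x * \<phi> x) (at x) b = A2 x * (mollify r w x \<bullet> 1) + A1 x * (mollify r W x \<bullet> b)" for x
        unfolding frechet_derivative_times[OF Dd test_function_differentiable[OF \<phi>]]
        using Db[of x] R(2)[of x] by (cases "norm x \<le> R") (auto simp: A1_def A2_def algebra_simps)
      then have "(LINT x|lborel. A2 x * (mollify r w x \<bullet> 1) + A1 x * (mollify r W x \<bullet> b))
          = (LINT x|lborel. u x * frechet_derivative (\<lambda>x. mollify r w x * \<phi> x) (at x) b)" by simp
      also have "\<dots> = - (LINT x|lborel. (V x \<bullet> b) * (mollify r w x * \<phi> x))"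
        by (rule has_weak_gradientD(3)[OF G t\<phi> b])
      finally show ?thesis by (simp add: A3_def mult_ac)
    qed
    have "(LINT x|lborel. A2 x * (w x \<bullet> 1)) + (LINT x|lborel. A1 x * (W x \<bullet> b)) + (LINT x|lborel. A3 x * (w x \<bullet> 1)) = 0"
    proof (rule eq_0_if_abs_le_epsilon)
      fix e :: real assume e: "e > 0"
      have n1: "norm (1::real) \<le> 1" by simp
      obtain d1 where d1: "d1 > 0" "\<And>r. 0 < r \<Longrightarrow> r < d1 \<Longrightarrow> integrable lborel (\<lambda>x. A2 x * (mollify r w x \<bullet> 1))"
        "\<And>r. 0 < r \<Longrightarrow> r < d1 \<Longrightarrow> \<bar>(LINT x|lborel. A2 x * (mollify r w x \<bullet> 1)) - (LINT x|lborel. A2 x * (w x \<bullet> 1))\<bar> \<le> e"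
        by (rule mollify_pairing_tendsto[OF Am(2) iA2 iw(1) iw2(1) n1 e]) blast
      obtain d2 where d2: "d2 > 0" "\<And>r. 0 < r \<Longrightarrow> r < d2 \<Longrightarrow> integrable lborel (\<lambda>x. A1 x * (mollify r W x \<bullet> b))"
        "\<And>r. 0 < r \<Longrightarrow> r < d2 \<Longrightarrow> \<bar>(LINT x|lborel. A1 x * (mollify r W x \<bullet> b)) - (LINT x|lborel. A1 x * (W x \<bullet> b))\<bar> \<le> e"
        by (rule mollify_pairing_tendsto[OF Am(1) iA1 iw(2) iw2(2) b1 e]) blast
      obtain d3 where d3: "d3 > 0" "\<And>r. 0 < r \<Longrightarrow> r < d3 \<Longrightarrow> integrable lborel (\<lambda>x. A3 x * (mollify r w x \<bullet> 1))"
        "\<And>r. 0 < r \<Longrightarrow> r < d3 \<Longrightarrow> \<bar>(LINT x|lborel. A3 x * (mollify r w x \<bullet> 1)) - (LINT x|lborel. A3 x * (w x \<bullet> 1))\<bar> \<le> e"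
        by (rule mollify_pairing_tendsto[OF Am(3) iA3 iw(1) iw2(1) n1 e]) blast
      define r where "r = min (min d1 d2) (min d3 1) / 2"
      have r: "0 < r" "r < d1" "r < d2" "r < d3" "r < 1" using d1(1) d2(1) d3(1) by (auto simp: r_def)
      have "(LINT x|lborel. A2 x * (mollify r w x \<bullet> 1)) + (LINT x|lborel. A1 x * (mollify r W x \<bullet> b)) = - (LINT x|lborel. A3 x * (mollify r w x \<bullet> 1))"
        using key[OF r(1,5)] Bochner_Integration.integral_add[OF d1(2)[OF r(1,2)] d2(2)[OF r(1,3)]] by simp
      then show "\<bar>(LINT x|lborel. A2 x * (w x \<bullet> 1)) + (LINT x|lborel. A1 x * (W x \<bullet> b)) + (LINT x|lborel. A3 x * (w x \<bullet> 1))\<bar> \<le> 3 * e"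
        using d1(3)[OF r(1,2)] d2(3)[OF r(1,3)] d3(3)[OF r(1,4)] by linarith
    qed
    moreover have "A2 x * (w x \<bullet> 1) = (u x)\<^sup>2 * ?d x" for x
      using Rd[of x] by (cases "norm x \<le> R") (auto simp: A2_def w_def power2_eq_square)
    moreover have "A1 x * (W x \<bullet> b) = u x * (V x \<bullet> b) * \<phi> x" for x
      using R(2)[of x] by (cases "norm x \<le> R") (auto simp: A1_def W_def)
    moreover have "A3 x * (w x \<bullet> 1) = u x * (V x \<bullet> b) * \<phi> x" for x
      using R(2)[of x] by (cases "norm x \<le> R") (auto simp: A3_def w_def)
    ultimately have "(LINT x|lborel. (u x)\<^sup>2 * ?d x) = - (2 * (LINT x|lborel. u x * (V x \<bullet> b) * \<phi> x))" by simp
    also have "2 * (LINT x|lborel. u x * (V x \<bullet> b) * \<phi> x) = (LINT x|lborel. ((2 * u x) *\<^sub>R V x) \<bullet> b * \<phi> x)"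
      by (simp add: mult_ac flip: integral_mult_right_zero)
    finally show "(LINT x|lborel. (u x)\<^sup>2 * ?d x) = - (LINT x|lborel. ((2 * u x) *\<^sub>R V x) \<bullet> b * \<phi> x)" .
  qed
qed

lemma has_weak_gradient_cong_AE:
  fixes u :: "'a::euclidean_space \<Rightarrow> real"
  assumes G: "has_weak_gradient u G" and ae: "AE x in lborel. u x = v x" and v: "v \<in> borel_measurable borel"
  shows "has_weak_gradient v G"
proof -
  note [measurable] = v locally_integrable_measurable[OF has_weak_gradientD(1)[OF G]]
  have "locally_integrable v"
  proof (rule locally_integrableI_cball[OF v])
    fix R
    have "integrable lborel (\<lambda>x. indicator (cball 0 R) x *\<^sub>R v x) \<longleftrightarrow> integrable lborel (\<lambda>x. indicator (cball 0 R) x *\<^sub>R u x)"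
    proof (rule integrable_cong_AE)
      show "AE x in lborel. indicator (cball 0 R) x *\<^sub>R v x = indicator (cball 0 R) x *\<^sub>R u x"
        using ae by eventually_elim simp
    qed measurable
    then show "integrable lborel (\<lambda>x. indicator (cball 0 R) x *\<^sub>R v x)"
      using locally_integrable_cball[OF has_weak_gradientD(1)[OF G]] by simp
  qed
  moreover have "(LINT x|lborel. v x * frechet_derivative \<phi> (at x) b) = (LINT x|lborel. u x * frechet_derivative \<phi> (at x) b)"
    if "test_function \<phi>" "b \<in> Basis" for \<phi> b
  proof (rule integral_cong_AE)
    note [measurable] = test_function_measurable[OF test_function_partial[OF that]]
    show "(\<lambda>x. v x * frechet_derivative \<phi> (at x) b) \<in> borel_measurable lborel"
      "(\<lambda>x. u x * frechet_derivative \<phi> (at x) b) \<in> borel_measurable lborel" by measurable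
  qed (use ae in auto)
  ultimately show ?thesis using G unfolding has_weak_gradient_def by auto
qed

text \<open>Translation invariance makes the integrals of \<open>\<phi> (x + t b)\<close> and \<open>\<phi> x\<close> equal; the first-order term of
  their difference is \<open>t\<close> times the integral in question, and the remainder is \<open>O(t\<^sup>2)\<close> on a fixed ball.\<close>

lemma integral_partial_test_function:
  assumes \<phi>: "test_function \<phi>" and b: "b \<in> Basis"
  shows "(LINT x|lborel. frechet_derivative \<phi> (at x) b) = 0"
proof -
  let ?d = "\<lambda>x. frechet_derivative \<phi> (at x) b"
  obtain L where L: "C11 L \<phi> (grad \<phi>)" using test_function_C11[OF \<phi>] by metis
  obtain R where R: "R > 0" "\<And>x. R < norm x \<Longrightarrow> \<phi> x = 0" using test_functionE[OF \<phi>] by metis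
  have l1: "locally_integrable (\<lambda>x::'a. 1::real)"
    using emeasure_lborel_cball_finite[where ?'a='a] by (intro locally_integrableI_cball) auto
  have i\<phi>: "integrable lborel \<phi>" and id: "integrable lborel ?d"
    using integrable_test_times[OF l1 \<phi>] integrable_test_times[OF l1 test_function_partial[OF \<phi> b]] by simp_all
  note [measurable] = test_function_measurable[OF \<phi>]
  define V where "V = measure lborel (cball (0::'a) (R + 1))"
  have ip: "integrable lborel (\<lambda>x. \<phi> (x + t *\<^sub>R b))" "(LINT x|lborel. \<phi> (x + t *\<^sub>R b)) = (LINT x|lborel. \<phi> x)" for t
  proof -
    have e: "\<phi> (x + t *\<^sub>R b) = (\<lambda>z. \<phi> (- z)) (- (t *\<^sub>R b) - x)" for x by (simp add: algebra_simps)
    show "integrable lborel (\<lambda>x. \<phi> (x + t *\<^sub>R b))"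
      unfolding e by (subst integrable_reflect) (use integrable_reflect[of \<phi> 0] i\<phi> in auto)
    show "(LINT x|lborel. \<phi> (x + t *\<^sub>R b)) = (LINT x|lborel. \<phi> x)"
      unfolding e by (subst integral_reflect) (use integral_reflect[of \<phi> 0] in auto)
  qed
  have "\<bar>LINT x|lborel. ?d x\<bar> \<le> L * V * t" if t: "0 < t" "t < 1" for t
  proof -
    have pt: "\<bar>\<phi> (x + t *\<^sub>R b) - \<phi> x - t * ?d x\<bar> \<le> (L * t\<^sup>2) * indicator (cball 0 (R + 1)) x" for x
    proof (cases "norm x \<le> R + 1")
      case True
      then show ?thesis
        using C11D(1)[OF L, of x "t *\<^sub>R b"] b t by (simp add: grad_inner[OF test_function_differentiable[OF \<phi>]])
    next
      case False
      have "norm x \<le> norm (x + t *\<^sub>R b) + norm (t *\<^sub>R b)" using norm_triangle_ineq4[of "x + t *\<^sub>R b" "t *\<^sub>R b"] by simp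
      then have n: "R < norm (x + t *\<^sub>R b)" "R < norm x" using False b t by auto
      have "?d x = 0" using frechet_derivative_outside[OF R(2) n(2)] by simp
      then show ?thesis using R(2) n False by simp
    qed
    have "t * (LINT x|lborel. ?d x) = - (LINT x|lborel. \<phi> (x + t *\<^sub>R b) - \<phi> x - t * ?d x)"
      using ip i\<phi> id by simp
    also have "\<bar>\<dots>\<bar> \<le> (LINT x|lborel. (L * t\<^sup>2) * indicator (cball (0::'a) (R + 1)) x)"
      unfolding abs_minus_cancel
    proof (rule order_trans[OF integral_abs_bound integral_mono[OF _ _ pt]])
      show "integrable lborel (\<lambda>x. \<bar>\<phi> (x + t *\<^sub>R b) - \<phi> x - t * ?d x\<bar>)"
        by (intro integrable_abs Bochner_Integration.integrable_diff ip i\<phi> integrable_mult_right id)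
      show "integrable lborel (\<lambda>x. (L * t\<^sup>2) * indicator (cball (0::'a) (R + 1)) x)"
        using emeasure_lborel_cball_finite[of "0::'a" "R + 1"] by (intro integrable_mult_right integrable_real_indicator) auto
    qed
    also have "\<dots> = t * (L * V * t)" by (simp add: V_def power2_eq_square)
    finally have "t * \<bar>LINT x|lborel. ?d x\<bar> \<le> t * (L * V * t)" using t by (simp add: abs_mult)
    then show ?thesis using t by simp
  qed
  note small = this
  have LV: "0 \<le> L * V" using C11D(5)[OF L] by (simp add: V_def)
  show ?thesis
  proof (rule eq_0_if_abs_le_epsilon)
    fix e :: real assume e: "e > 0"
    define t where "t = min (1/2) (e / (L * V + 1))"
    have t: "0 < t" "t < 1" using e LV by (auto simp: t_def)
    have "L * V * t \<le> L * V * (e / (L * V + 1))" using LV by (intro mult_left_mono) (auto simp: t_def)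
    also have "\<dots> \<le> 1 * e" using LV e by (simp add: field_simps)
    finally show "\<bar>LINT x|lborel. ?d x\<bar> \<le> 3 * e" using small[OF t] e by simp
  qed
qed

section \<open>Approximation in the Gaussian Sobolev space\<close>

lemma gdens_le: "gdens (x::'a::euclidean_space) \<le> gdens (0::'a)"
  by (simp add: gdens_def)

lemma integrable_gauss_iff:
  fixes h :: "'a::euclidean_space \<Rightarrow> real"
  assumes "h \<in> borel_measurable borel"
  shows "integrable gauss h \<longleftrightarrow> integrable lborel (\<lambda>x. gdens x * h x)"
  unfolding gauss_eq using assms by (subst integrable_density) (auto simp: less_imp_le[OF gdens_pos])

lemma integral_gauss:
  fixes h :: "'a::euclidean_space \<Rightarrow> real"
  assumes "h \<in> borel_measurable borel"
  shows "(LINT x|gauss. h x) = (LINT x|lborel. gdens x * h x)"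
  unfolding gauss_eq using assms by (subst integral_density) (auto simp: less_imp_le[OF gdens_pos])

lemma gauss_integral_le_lborel:
  fixes q :: "'a::euclidean_space \<Rightarrow> real"
  assumes i: "integrable lborel q" and q: "\<And>x. 0 \<le> q x"
  shows "integrable gauss q" "(LINT x|gauss. q x) \<le> gdens (0::'a) * (LINT x|lborel. q x)"
proof -
  have [measurable]: "q \<in> borel_measurable borel" using borel_measurable_integrable[OF i] by simp
  have le: "gdens x * q x \<le> gdens (0::'a) * q x" for x by (rule mult_right_mono[OF gdens_le q])
  have i2: "integrable lborel (\<lambda>x. gdens x * q x)"
  proof (rule Bochner_Integration.integrable_bound[OF integrable_mult_right[OF i, of "gdens (0::'a)"]])
    show "AE x in lborel. norm (gdens x * q x) \<le> norm (gdens (0::'a) * q x)"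
      using le q gdens_pos by (intro AE_I2) (simp add: abs_mult less_imp_le[OF gdens_pos])
  qed measurable
  then show "integrable gauss q" by (simp add: integrable_gauss_iff)
  have "(LINT x|gauss. q x) = (LINT x|lborel. gdens x * q x)" by (rule integral_gauss) simp
  also have "\<dots> \<le> (LINT x|lborel. gdens (0::'a) * q x)"
    using i i2 le by (intro integral_mono integrable_mult_right) auto
  finally show "(LINT x|gauss. q x) \<le> gdens (0::'a) * (LINT x|lborel. q x)" by simp
qed

text \<open>The Gaussian density is bounded below on every ball.\<close>

lemma gauss_integrable_imp_locally_integrable:
  fixes h :: "'a::euclidean_space \<Rightarrow> real"
  assumes [measurable]: "h \<in> borel_measurable borel" and i: "integrable gauss h"
  shows "locally_integrable h"
proof (rule locally_integrableI_cball)
  fix R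
  define m where "m = (2 * pi) powr (- real DIM('a) / 2) * exp (- R\<^sup>2 / 2)"
  have m: "m > 0" by (simp add: m_def)
  have i2: "integrable lborel (\<lambda>x. gdens x * h x)" using i by (simp add: integrable_gauss_iff)
  show "integrable lborel (\<lambda>x. indicator (cball 0 R) x *\<^sub>R h x)"
  proof (rule Bochner_Integration.integrable_bound[OF integrable_mult_right[OF i2, of "1 / m"]])
    show "AE x in lborel. norm (indicator (cball 0 R) x *\<^sub>R h x) \<le> norm (1 / m * (gdens x * h x))"
    proof (rule AE_I2)
      fix x :: 'a
      have "m \<le> gdens x" if "norm x \<le> R"
        using that by (simp add: m_def gdens_def power_mono)
      then have "norm x \<le> R \<Longrightarrow> 1 * \<bar>h x\<bar> \<le> (gdens x / m) * \<bar>h x\<bar>"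
        using m by (intro mult_right_mono) auto
      then show "norm (indicator (cball 0 R) x *\<^sub>R h x) \<le> norm (1 / m * (gdens x * h x))"
        using m by (cases "norm x \<le> R") (auto simp: abs_mult less_imp_le[OF gdens_pos])
    qed
  qed measurable
qed measurable

lemma locally_integrable_bounded_times:
  fixes u :: "'a::euclidean_space \<Rightarrow> 'b::euclidean_space"
  assumes u: "locally_integrable u" and [measurable]: "h \<in> borel_measurable borel" and B: "\<And>x. \<bar>h x\<bar> \<le> B"
  shows "locally_integrable (\<lambda>x. h x *\<^sub>R u x)"
proof (rule locally_integrableI_cball)
  note [measurable] = locally_integrable_measurable[OF u]
  show "(\<lambda>x. h x *\<^sub>R u x) \<in> borel_measurable borel" by measurable
  fix R
  have "integrable lborel (\<lambda>x. (indicator (cball 0 R) x * h x) *\<^sub>R u x)"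
    using order_trans[OF abs_ge_zero B] B
    by (intro integrable_locally_times[OF u, of _ B R]) (auto split: split_indicator)
  then show "integrable lborel (\<lambda>x. indicator (cball 0 R) x *\<^sub>R h x *\<^sub>R u x)" by simp
qed

lemma locally_integrable_add:
  fixes u v :: "'a::euclidean_space \<Rightarrow> 'b::euclidean_space"
  assumes "locally_integrable u" "locally_integrable v"
  shows "locally_integrable (\<lambda>x. u x + v x)"
  using assms unfolding locally_integrable_def by auto

lemma locally_integrable_const: "locally_integrable (\<lambda>x::'a::euclidean_space. c :: real)"
  using emeasure_lborel_cball_finite[where ?'a='a] by (intro locally_integrableI_cball) auto

text \<open>Product rule with a smooth factor. Subtracting the constant \<open>\<kappa>\<close> before the cutoff keeps the product
  nonnegative when \<open>u \<ge> \<kappa>\<close>.\<close>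

lemma has_weak_gradient_cutoff:
  fixes u :: "'a::euclidean_space \<Rightarrow> real"
  assumes G: "has_weak_gradient u V" and \<xi>: "test_function \<xi>"
  shows "has_weak_gradient (\<lambda>x. \<xi> x * (u x - \<kappa>)) (\<lambda>x. \<xi> x *\<^sub>R V x + (u x - \<kappa>) *\<^sub>R grad \<xi> x)"
proof -
  note lu = has_weak_gradientD(1)[OF G] and lV = has_weak_gradientD(2)[OF G]
  obtain L where L: "C11 L \<xi> (grad \<xi>)" using test_function_C11[OF \<xi>] by metis
  obtain B where B: "\<And>x. \<bar>\<xi> x\<bar> \<le> B" using test_function_bounded[OF \<xi>] by metis
  note [measurable] = C11_measurable[OF L] locally_integrable_measurable[OF lu] locally_integrable_measurable[OF lV]
  have luk: "locally_integrable (\<lambda>x. u x - \<kappa>)"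
    using locally_integrable_add[OF lu locally_integrable_const[of "- \<kappa>"]] by simp
  have l1: "locally_integrable (\<lambda>x. \<xi> x * (u x - \<kappa>))"
    using locally_integrable_bounded_times[OF luk _ B] by simp
  have l2: "locally_integrable (\<lambda>x. (u x - \<kappa>) *\<^sub>R grad \<xi> x)"
  proof (rule locally_integrableI_cball)
    fix R
    show "integrable lborel (\<lambda>x. indicator (cball 0 R) x *\<^sub>R (u x - \<kappa>) *\<^sub>R grad \<xi> x)"
    proof (rule Bochner_Integration.integrable_bound[OF integrable_scaleR_right[OF locally_integrable_cball[OF luk], of L]])
      show "AE x in lborel. norm (indicator (cball 0 R) x *\<^sub>R (u x - \<kappa>) *\<^sub>R grad \<xi> x)
          \<le> norm (L *\<^sub>R indicator (cball 0 R) x *\<^sub>R (u x - \<kappa>))"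
        using C11D(3)[OF L] C11D(5)[OF L]
        by (intro AE_I2) (auto simp: abs_mult mult_ac intro!: mult_right_mono)
    qed measurable
  qed measurable
  have l3: "locally_integrable (\<lambda>x. \<xi> x *\<^sub>R V x + (u x - \<kappa>) *\<^sub>R grad \<xi> x)"
    by (intro locally_integrable_add l2 locally_integrable_bounded_times[OF lV _ B]) measurable
  show ?thesis
    unfolding has_weak_gradient_def
  proof (intro conjI l1 l3 allI impI ballI)
    fix \<phi> :: "'a \<Rightarrow> real" and b :: 'a assume \<phi>: "test_function \<phi>" and b: "b \<in> Basis"
    let ?d = "\<lambda>x. frechet_derivative \<phi> (at x) b"
    note \<phi>b = test_function_partial[OF \<phi> b]
    note dc = test_function_differentiable[OF \<xi>] and d\<phi> = test_function_differentiable[OF \<phi>]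
    have t: "test_function (\<lambda>x. \<xi> x * \<phi> x)"
      using \<xi> by (intro test_function_mult[OF _ \<phi>]) (simp add: test_function_def)
    have fd: "frechet_derivative (\<lambda>x. \<xi> x * \<phi> x) (at x) b = \<xi> x * ?d x + (grad \<xi> x \<bullet> b) * \<phi> x" for x
      by (simp add: frechet_derivative_times[OF dc d\<phi>] grad_inner[OF dc])
    note tb = test_function_partial[OF t b]
    have a1: "integrable lborel (\<lambda>x. u x * frechet_derivative (\<lambda>x. \<xi> x * \<phi> x) (at x) b)"
      using integrable_test_times[OF lu tb] by (simp add: mult.commute)
    have a2: "integrable lborel (\<lambda>x. \<kappa> * frechet_derivative (\<lambda>x. \<xi> x * \<phi> x) (at x) b)"
      using integrable_test_times[OF locally_integrable_const[of \<kappa>] tb] by (simp add: mult.commute)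
    have a3: "integrable lborel (\<lambda>x. \<xi> x * (u x - \<kappa>) * ?d x)"
      using integrable_test_times[OF l1 \<phi>b] by (simp add: mult_ac)
    have a4: "integrable lborel (\<lambda>x. (u x - \<kappa>) * (grad \<xi> x \<bullet> b) * \<phi> x)"
      using integrable_inner_left[OF integrable_test_times[OF l2 \<phi>], of b] by (simp add: mult_ac)
    have a5: "integrable lborel (\<lambda>x. (V x \<bullet> b) * (\<xi> x * \<phi> x))"
      using integrable_inner_left[OF integrable_test_times[OF lV t], of b] by (simp add: mult_ac)
    have "(LINT x|lborel. \<xi> x * (u x - \<kappa>) * ?d x) + (LINT x|lborel. (u x - \<kappa>) * (grad \<xi> x \<bullet> b) * \<phi> x)
       = (LINT x|lborel. u x * frechet_derivative (\<lambda>x. \<xi> x * \<phi> x) (at x) b - \<kappa> * frechet_derivative (\<lambda>x. \<xi> x * \<phi> x) (at x) b)"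
      unfolding Bochner_Integration.integral_add[OF a3 a4, symmetric] fd
      by (rule Bochner_Integration.integral_cong) (simp_all add: algebra_simps)
    also have "\<dots> = (LINT x|lborel. u x * frechet_derivative (\<lambda>x. \<xi> x * \<phi> x) (at x) b)"
      unfolding Bochner_Integration.integral_diff[OF a1 a2] by (simp add: integral_partial_test_function[OF t b])
    also have "\<dots> = - (LINT x|lborel. (V x \<bullet> b) * (\<xi> x * \<phi> x))" by (rule has_weak_gradientD(3)[OF G t b])
    finally have "(LINT x|lborel. \<xi> x * (u x - \<kappa>) * ?d x)
        = - ((LINT x|lborel. (V x \<bullet> b) * (\<xi> x * \<phi> x)) + (LINT x|lborel. (u x - \<kappa>) * (grad \<xi> x \<bullet> b) * \<phi> x))" by simp
    also have "\<dots> = - (LINT x|lborel. (\<xi> x *\<^sub>R V x + (u x - \<kappa>) *\<^sub>R grad \<xi> x) \<bullet> b * \<phi> x)"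
      unfolding Bochner_Integration.integral_add[OF a5 a4, symmetric]
      by (simp add: inner_add_left algebra_simps)
    finally show "(LINT x|lborel. \<xi> x * (u x - \<kappa>) * ?d x)
        = - (LINT x|lborel. (\<xi> x *\<^sub>R V x + (u x - \<kappa>) *\<^sub>R grad \<xi> x) \<bullet> b * \<phi> x)" .
  qed
qed

text \<open>The factor normalizes the value at the origin to \<open>1\<close>; dilating the bump makes its gradient small.\<close>

definition cutoff :: "real \<Rightarrow> 'a::euclidean_space \<Rightarrow> real" where
  "cutoff R x = exp 1 * bump R x"

lemma test_function_cutoff: "R > 0 \<Longrightarrow> test_function (cutoff R)"
  using test_function_cmult[OF test_function_bump[of R 0], of "exp 1"] by (simp add: cutoff_def[abs_def])

lemma cutoff_bounds: "R > 0 \<Longrightarrow> 0 \<le> cutoff R x" "R > 0 \<Longrightarrow> cutoff R x \<le> 1"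
proof -
  assume R: "R > 0"
  show "0 \<le> cutoff R x" using bump_bounds(1)[OF R, of x] by (simp add: cutoff_def)
  have "cutoff R x \<le> exp 1 * exp (-1)" unfolding cutoff_def by (intro mult_left_mono bump_bounds(2)[OF R]) simp
  then show "cutoff R x \<le> 1" by (simp flip: exp_add)
qed

lemma cutoff_tendsto: "(\<lambda>n. cutoff (real (Suc n)) x) \<longlonglongrightarrow> 1"
proof -
  have "(\<lambda>n. (norm x * inverse (real (Suc n)))\<^sup>2) \<longlonglongrightarrow> (norm x * 0)\<^sup>2"
    by (intro tendsto_power tendsto_mult tendsto_const LIMSEQ_inverse_real_of_nat)
  then have q: "(\<lambda>n. 1 - (norm x)\<^sup>2 / (real (Suc n))\<^sup>2) \<longlonglongrightarrow> 1 - 0"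
    by (intro tendsto_diff tendsto_const) (simp add: power_mult_distrib divide_inverse power_inverse)
  have "isCont (flat 0) 1" using DERIV_flat by (rule DERIV_isCont)
  then have "(\<lambda>n. flat 0 (1 - (norm x)\<^sup>2 / (real (Suc n))\<^sup>2)) \<longlonglongrightarrow> flat 0 1"
    by (rule isCont_tendsto_compose) (use q in simp)
  then have "(\<lambda>n. exp 1 * flat 0 (1 - (norm x)\<^sup>2 / (real (Suc n))\<^sup>2)) \<longlonglongrightarrow> exp 1 * flat 0 1"
    by (intro tendsto_mult tendsto_const)
  then show ?thesis by (simp add: cutoff_def bump_def flat_def flip: exp_add)
qed

lemma grad_cutoff_le:
  obtains C where "C \<ge> 0" "\<And>R x. R > 0 \<Longrightarrow> norm (grad (cutoff R) (x::'a::euclidean_space)) \<le> C / R"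
proof -
  have t1: "test_function (cutoff 1 :: 'a \<Rightarrow> real)" by (rule test_function_cutoff) simp
  obtain C where C: "C \<ge> 0" "\<And>x::'a. norm (grad (cutoff 1) x) \<le> C" using grad_bounded[OF t1] by metis
  have "norm (grad (cutoff R) x) \<le> C / R" if R: "R > 0" for R and x :: 'a
  proof -
    note d = test_function_differentiable[OF test_function_cutoff[OF R]]
    have e: "cutoff R = (\<lambda>x::'a. cutoff 1 (x /\<^sub>R R))"
      by (simp add: fun_eq_iff cutoff_def bump_def power_mult_distrib divide_inverse power_inverse mult.commute)
    have "((\<lambda>x::'a. x /\<^sub>R R) has_derivative (\<lambda>v. v /\<^sub>R R)) (at x)"
      by (auto intro!: derivative_eq_intros)
    from has_derivative_compose[OF this grad_has_derivative[OF test_function_differentiable[OF t1]]]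
    have "(cutoff R has_derivative (\<lambda>v. grad (cutoff 1) (x /\<^sub>R R) \<bullet> (v /\<^sub>R R))) (at x)" unfolding e by simp
    then have fd: "frechet_derivative (cutoff R) (at x) = (\<lambda>v. grad (cutoff 1) (x /\<^sub>R R) \<bullet> (v /\<^sub>R R))"
      by (rule frechet_derivative_eqI)
    have "grad (cutoff R) x = grad (cutoff 1) (x /\<^sub>R R) /\<^sub>R R"
    proof (rule euclidean_eqI)
      fix b :: 'a
      show "grad (cutoff R) x \<bullet> b = (grad (cutoff 1) (x /\<^sub>R R) /\<^sub>R R) \<bullet> b"
        by (simp add: grad_inner[OF d] fd)
    qed
    then show ?thesis using C(2)[of "x /\<^sub>R R"] R by (simp add: divide_inverse mult.commute mult_left_mono)
  qed
  then show thesis using C(1) that by blast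
qed

lemma truncate_W12:
  fixes u :: "'a::euclidean_space \<Rightarrow> real" and V :: "'a \<Rightarrow> 'a"
  assumes [measurable]: "u \<in> borel_measurable borel" "V \<in> borel_measurable borel"
    and iu: "integrable gauss (\<lambda>x. (u x)\<^sup>2)" and iV: "integrable gauss (\<lambda>x. (norm (V x))\<^sup>2)" and e: "e > 0"
  obtains \<xi> where "test_function \<xi>" "\<And>x. 0 \<le> \<xi> x"
    "integrable gauss (\<lambda>x. (\<xi> x * u x - u x)\<^sup>2)"
    "(LINT x|gauss. (\<xi> x * u x - u x)\<^sup>2) \<le> e"
    "integrable gauss (\<lambda>x. (norm (\<xi> x *\<^sub>R V x + u x *\<^sub>R grad \<xi> x - V x))\<^sup>2)"
    "(LINT x|gauss. (norm (\<xi> x *\<^sub>R V x + u x *\<^sub>R grad \<xi> x - V x))\<^sup>2) \<le> e"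
proof -
  obtain C where C: "C \<ge> 0" "\<And>R x. R > 0 \<Longrightarrow> norm (grad (cutoff R) (x::'a)) \<le> C / R" using grad_cutoff_le by metis
  let ?c = "\<lambda>n. cutoff (real (Suc n)) :: 'a \<Rightarrow> real"
  have t: "test_function (?c n)" for n by (rule test_function_cutoff) simp
  have [measurable]: "?c n \<in> borel_measurable borel" "grad (?c n) \<in> borel_measurable borel" for n
  proof -
    obtain L where "C11 L (?c n) (grad (?c n))" using test_function_C11[OF t] by metis
    then show "?c n \<in> borel_measurable borel" "grad (?c n) \<in> borel_measurable borel" by (auto dest: C11_measurable)
  qed
  have c01: "0 \<le> ?c n x" "?c n x \<le> 1" for n x using cutoff_bounds[of "real (Suc n)" x] by auto
  let ?A = "\<lambda>n x. (?c n x * u x - u x)\<^sup>2"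
  let ?B = "\<lambda>n x. (norm (?c n x *\<^sub>R V x + u x *\<^sub>R grad (?c n) x - V x))\<^sup>2"
  have leA: "?A n x \<le> (u x)\<^sup>2" for n x
  proof -
    have "?A n x = (1 - ?c n x)\<^sup>2 * (u x)\<^sup>2" by (simp add: power2_eq_square algebra_simps)
    also have "\<dots> \<le> 1 * (u x)\<^sup>2" using c01[of n x] by (intro mult_right_mono power_le_one) auto
    finally show ?thesis by simp
  qed
  have leB: "?B n x \<le> 2 * (norm ((1 - ?c n x) *\<^sub>R V x))\<^sup>2 + 2 * ((u x)\<^sup>2 * (C / real (Suc n))\<^sup>2)" for n x
  proof -
    have "?B n x \<le> 2 * (norm (- ((1 - ?c n x) *\<^sub>R V x)))\<^sup>2 + 2 * (norm (u x *\<^sub>R grad (?c n) x))\<^sup>2"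
      using norm_add_square_le[of "- ((1 - ?c n x) *\<^sub>R V x)" "u x *\<^sub>R grad (?c n) x"] by (simp add: algebra_simps)
    moreover have "(norm (u x *\<^sub>R grad (?c n) x))\<^sup>2 \<le> (u x)\<^sup>2 * (C / real (Suc n))\<^sup>2"
      using C(2)[of "real (Suc n)" x] by (auto simp: power_mult_distrib intro!: mult_left_mono power_mono)
    ultimately show ?thesis by simp
  qed
  have leB2: "?B n x \<le> 2 * (norm (V x))\<^sup>2 + 2 * C\<^sup>2 * (u x)\<^sup>2" for n x
  proof -
    have "(norm ((1 - ?c n x) *\<^sub>R V x))\<^sup>2 \<le> (norm (V x))\<^sup>2"
      using c01[of n x] by (intro power_mono) (auto simp: mult_left_le_one_le)
    moreover have "(C / real (Suc n))\<^sup>2 \<le> C\<^sup>2"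
      using C(1) by (intro power_mono) (auto simp: divide_le_eq mult_le_cancel_left1 intro: order_trans[OF _ mult_left_mono])
    then have "(u x)\<^sup>2 * (C / real (Suc n))\<^sup>2 \<le> (u x)\<^sup>2 * C\<^sup>2" by (intro mult_left_mono) auto
    moreover have "2 * C\<^sup>2 * (u x)\<^sup>2 = 2 * ((u x)\<^sup>2 * C\<^sup>2)" by simp
    ultimately show ?thesis using leB[of n x] by linarith
  qed
  have i2: "integrable gauss (\<lambda>x. 2 * (norm (V x))\<^sup>2 + 2 * C\<^sup>2 * (u x)\<^sup>2)"
    by (intro Bochner_Integration.integrable_add integrable_mult_right iu iV)
  have iA: "integrable gauss (?A n)" for n
    by (rule Bochner_Integration.integrable_bound[OF iu]) (measurable, use leA in auto)
  have iB: "integrable gauss (?B n)" for n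
  proof (rule Bochner_Integration.integrable_bound[OF i2])
    show "AE x in gauss. norm (?B n x) \<le> norm (2 * (norm (V x))\<^sup>2 + 2 * C\<^sup>2 * (u x)\<^sup>2)"
      using leB2[of n] by (intro AE_I2) (auto intro: order_trans[OF _ abs_ge_self])
  qed measurable
  have "(\<lambda>n. LINT x|gauss. ?A n x) \<longlonglongrightarrow> (LINT x|(gauss :: 'a measure). 0)"
  proof (rule integral_dominated_convergence[OF _ _ iu])
    show "AE x in gauss. (\<lambda>n. ?A n x) \<longlonglongrightarrow> 0"
    proof (rule AE_I2)
      fix x
      have "(\<lambda>n. ?A n x) \<longlonglongrightarrow> (1 * u x - u x)\<^sup>2"
        by (intro tendsto_power tendsto_diff tendsto_mult tendsto_const cutoff_tendsto)
      then show "(\<lambda>n. ?A n x) \<longlonglongrightarrow> 0" by simp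
    qed
    show "AE x in gauss. norm (?A n x) \<le> (u x)\<^sup>2" for n using leA by (intro AE_I2) simp
  qed measurable
  then have "(\<lambda>n. LINT x|gauss. ?A n x) \<longlonglongrightarrow> 0" by simp
  then have evA: "\<forall>\<^sub>F n in sequentially. (LINT x|gauss. ?A n x) < e" using e by (rule order_tendstoD)
  have "(\<lambda>n. LINT x|gauss. ?B n x) \<longlonglongrightarrow> (LINT x|(gauss :: 'a measure). 0)"
  proof (rule integral_dominated_convergence[OF _ _ i2])
    show "AE x in gauss. (\<lambda>n. ?B n x) \<longlonglongrightarrow> 0"
    proof (rule AE_I2, rule tendsto_sandwich[OF _ _ tendsto_const])
      fix x
      show "\<forall>\<^sub>F n in sequentially. ?B n x \<le> 2 * (norm ((1 - ?c n x) *\<^sub>R V x))\<^sup>2 + 2 * ((u x)\<^sup>2 * (C * inverse (real (Suc n)))\<^sup>2)"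
        using leB by (simp add: divide_inverse)
      have "(\<lambda>n. 2 * (norm ((1 - ?c n x) *\<^sub>R V x))\<^sup>2 + 2 * ((u x)\<^sup>2 * (C * inverse (real (Suc n)))\<^sup>2))
          \<longlonglongrightarrow> 2 * (norm ((1 - 1) *\<^sub>R V x))\<^sup>2 + 2 * ((u x)\<^sup>2 * (C * 0)\<^sup>2)"
        by (intro tendsto_add tendsto_mult tendsto_const tendsto_power tendsto_norm tendsto_scaleR tendsto_diff
            cutoff_tendsto LIMSEQ_inverse_real_of_nat)
      then show "(\<lambda>n. 2 * (norm ((1 - ?c n x) *\<^sub>R V x))\<^sup>2 + 2 * ((u x)\<^sup>2 * (C * inverse (real (Suc n)))\<^sup>2)) \<longlonglongrightarrow> 0"
        by simp
    qed simp
    show "AE x in gauss. norm (?B n x) \<le> 2 * (norm (V x))\<^sup>2 + 2 * C\<^sup>2 * (u x)\<^sup>2" for n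
      using leB2 by (intro AE_I2) simp
  qed measurable
  then have "(\<lambda>n. LINT x|gauss. ?B n x) \<longlonglongrightarrow> 0" by simp
  then have evB: "\<forall>\<^sub>F n in sequentially. (LINT x|gauss. ?B n x) < e" using e by (rule order_tendstoD)
  obtain n where "(LINT x|gauss. ?A n x) < e" "(LINT x|gauss. ?B n x) < e"
    using eventually_happens[OF eventually_conj[OF evA evB]] by auto
  then show thesis using that[OF t c01(1) iA _ iB] by (auto intro: less_imp_le)
qed

text \<open>The approximant is \<open>\<kappa>\<close> plus a mollification of \<open>\<xi> (u - \<kappa>)\<close> with a cutoff \<open>\<xi>\<close>. The lower bound \<open>\<kappa>\<close> survives
  because mollifiers and cutoffs are nonnegative. On the compactly supported product, Gaussian norms are
  controlled by Lebesgue norms, for which mollification converges.\<close>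

theorem C11_dense_W12:
  fixes u :: "'a::euclidean_space \<Rightarrow> real"
  assumes um[measurable]: "u \<in> borel_measurable borel" "V \<in> borel_measurable borel"
    and G: "has_weak_gradient u V"
    and iu: "integrable gauss (\<lambda>x. (u x)\<^sup>2)" and iV: "integrable gauss (\<lambda>x. (norm (V x))\<^sup>2)"
    and lower: "AE x in lborel. \<kappa> \<le> u x" and e: "e > 0"
  obtains v D L \<beta> where "C11 L v D" "\<And>x. \<kappa> \<le> v x" "\<And>x. v x \<le> \<beta>"
    "(LINT x|gauss. (v x - u x)\<^sup>2) \<le> e" "(LINT x|gauss. (norm (D x - V x))\<^sup>2) \<le> e"
proof -
  let ?u = "\<lambda>x. u x - \<kappa>"
  have iuk: "integrable gauss (\<lambda>x. (?u x)\<^sup>2)"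
  proof (rule Bochner_Integration.integrable_bound[of _ "\<lambda>x. 2 * (u x)\<^sup>2 + 2 * \<kappa>\<^sup>2"])
    show "integrable gauss (\<lambda>x. 2 * (u x)\<^sup>2 + 2 * \<kappa>\<^sup>2)" using iu by simp
    show "AE x in gauss. norm ((?u x)\<^sup>2) \<le> norm (2 * (u x)\<^sup>2 + 2 * \<kappa>\<^sup>2)"
      using norm_add_square_le[of "u _" "- \<kappa>"] by (intro AE_I2) simp
  qed measurable
  have e4: "e / 4 > 0" using e by simp
  have ukm: "?u \<in> borel_measurable borel" by measurable
  obtain \<xi> where \<xi>: "test_function \<xi>" "\<And>x. 0 \<le> \<xi> x"
    and A: "integrable gauss (\<lambda>x. (\<xi> x * ?u x - ?u x)\<^sup>2)" "(LINT x|gauss. (\<xi> x * ?u x - ?u x)\<^sup>2) \<le> e / 4"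
    and B: "integrable gauss (\<lambda>x. (norm (\<xi> x *\<^sub>R V x + ?u x *\<^sub>R grad \<xi> x - V x))\<^sup>2)"
      "(LINT x|gauss. (norm (\<xi> x *\<^sub>R V x + ?u x *\<^sub>R grad \<xi> x - V x))\<^sup>2) \<le> e / 4"
    by (rule truncate_W12[OF ukm um(2) iuk iV e4]) blast
  define w where "w = (\<lambda>x. \<xi> x * ?u x)"
  define W where "W = (\<lambda>x. \<xi> x *\<^sub>R V x + ?u x *\<^sub>R grad \<xi> x)"
  have G': "has_weak_gradient w W" unfolding w_def W_def by (rule has_weak_gradient_cutoff[OF G \<xi>(1)])
  obtain L where L: "C11 L \<xi> (grad \<xi>)" using test_function_C11[OF \<xi>(1)] by metis
  obtain M where M: "\<And>x. \<bar>\<xi> x\<bar> \<le> M" using test_function_bounded[OF \<xi>(1)] by metis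
  obtain R where R: "R > 0" "\<And>x. R < norm x \<Longrightarrow> \<xi> x = 0" using test_functionE[OF \<xi>(1)] by metis
  have gR: "grad \<xi> x = 0" if "R < norm x" for x
    using frechet_derivative_outside[OF R(2) that] by (simp add: grad_def)
  note [measurable] = C11_measurable[OF L]
  have wm[measurable]: "w \<in> borel_measurable borel" "W \<in> borel_measurable borel" unfolding w_def W_def by measurable
  have supp: "w x = 0" "W x = 0" if "R < norm x" for x using R(2)[OF that] gR[OF that] by (auto simp: w_def W_def)
  have "(\<lambda>x. indicator (cball 0 R) x *\<^sub>R w x) = w" "(\<lambda>x. indicator (cball 0 R) x *\<^sub>R W x) = W"
    using supp by (auto simp: fun_eq_iff not_le split: split_indicator)
  then have iw: "integrable lborel w" "integrable lborel W"
    using locally_integrable_cball[OF has_weak_gradientD(1)[OF G'], of R]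
      locally_integrable_cball[OF has_weak_gradientD(2)[OF G'], of R] by simp_all
  note lu2 = gauss_integrable_imp_locally_integrable[OF _ iuk]
  note lV2 = gauss_integrable_imp_locally_integrable[OF _ iV]
  have sq: "(\<xi> x)\<^sup>2 \<le> M\<^sup>2" "(norm (grad \<xi> x))\<^sup>2 \<le> L\<^sup>2" for x
    using power_mono[OF M, of x 2] power_mono[OF C11D(3)[OF L], of x 2] by auto
  have q1: "integrable lborel (\<lambda>x. (\<xi> x)\<^sup>2 *\<^sub>R (?u x)\<^sup>2)"
    by (rule integrable_locally_times[OF lu2, of _ "M\<^sup>2" R]) (use sq R in auto)
  have q2: "integrable lborel (\<lambda>x. (\<xi> x)\<^sup>2 *\<^sub>R (norm (V x))\<^sup>2)"
    by (rule integrable_locally_times[OF lV2, of _ "M\<^sup>2" R]) (use sq R in auto)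
  have q3: "integrable lborel (\<lambda>x. (norm (grad \<xi> x))\<^sup>2 *\<^sub>R (?u x)\<^sup>2)"
    by (rule integrable_locally_times[OF lu2, of _ "L\<^sup>2" R]) (use sq gR in auto)
  have iw2: "integrable lborel (\<lambda>x. (norm (w x))\<^sup>2)" using q1 by (simp add: w_def power_mult_distrib)
  have iW2: "integrable lborel (\<lambda>x. (norm (W x))\<^sup>2)"
  proof (rule Bochner_Integration.integrable_bound)
    show "integrable lborel (\<lambda>x. 2 * ((\<xi> x)\<^sup>2 *\<^sub>R (norm (V x))\<^sup>2) + 2 * ((norm (grad \<xi> x))\<^sup>2 *\<^sub>R (?u x)\<^sup>2))"
      by (intro Bochner_Integration.integrable_add integrable_mult_right q2 q3)
    show "AE x in lborel. norm ((norm (W x))\<^sup>2) \<le> norm (2 * ((\<xi> x)\<^sup>2 *\<^sub>R (norm (V x))\<^sup>2) + 2 * ((norm (grad \<xi> x))\<^sup>2 *\<^sub>R (?u x)\<^sup>2))"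
    proof (rule AE_I2)
      fix x
      show "norm ((norm (W x))\<^sup>2) \<le> norm (2 * ((\<xi> x)\<^sup>2 *\<^sub>R (norm (V x))\<^sup>2) + 2 * ((norm (grad \<xi> x))\<^sup>2 *\<^sub>R (?u x)\<^sup>2))"
        using norm_add_square_le[of "\<xi> x *\<^sub>R V x" "?u x *\<^sub>R grad \<xi> x"]
        by (simp add: W_def power_mult_distrib mult_ac)
    qed
  qed measurable
  \<comment> \<open>passing from Lebesgue to Gaussian integrals costs at most the factor \<open>gdens 0\<close>\<close>
  define \<eta> where "\<eta> = e / (4 * gdens (0::'a))"
  have \<eta>: "\<eta> > 0" "gdens (0::'a) * \<eta> = e / 4" using e gdens_pos[of "0::'a"] by (auto simp: \<eta>_def)
  obtain d1 where d1: "d1 > 0" "\<And>r. 0 < r \<Longrightarrow> r < d1 \<Longrightarrow> integrable lborel (\<lambda>x. (norm (mollify r w x - w x))\<^sup>2)"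
    "\<And>r. 0 < r \<Longrightarrow> r < d1 \<Longrightarrow> (LINT x|lborel. (norm (mollify r w x - w x))\<^sup>2) \<le> \<eta>"
    by (rule mollify_tendsto_L2[OF iw(1) iw2 \<eta>(1)]) blast
  obtain d2 where d2: "d2 > 0" "\<And>r. 0 < r \<Longrightarrow> r < d2 \<Longrightarrow> integrable lborel (\<lambda>x. (norm (mollify r W x - W x))\<^sup>2)"
    "\<And>r. 0 < r \<Longrightarrow> r < d2 \<Longrightarrow> (LINT x|lborel. (norm (mollify r W x - W x))\<^sup>2) \<le> \<eta>"
    by (rule mollify_tendsto_L2[OF iw(2) iW2 \<eta>(1)]) blast
  define r where "r = min d1 d2 / 2"
  have r: "0 < r" "r < d1" "r < d2" using d1(1) d2(1) by (auto simp: r_def)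
  note tm = test_function_moll0[OF r(1), where 'a='a]
  obtain K where K: "C11 K (moll r :: 'a \<Rightarrow> real) (grad (moll r))" using test_function_C11[OF tm] by metis
  obtain N where N: "N \<ge> 0" "\<And>z::'a. \<bar>moll r z\<bar> \<le> N" using moll_bounded[OF r(1)] by metis
  note cw = mollify_real[of r w]
  have cW: "(\<lambda>x. LINT y|lborel. w y *\<^sub>R grad (moll r) (x - y)) = mollify r W"
  proof
    fix x
    have iW: "integrable lborel (\<lambda>y. moll r (x - y) *\<^sub>R W y)" by (rule integrable_moll_times[OF iw(2) r(1)])
    show "(LINT y|lborel. w y *\<^sub>R grad (moll r) (x - y)) = mollify r W x"
    proof (rule euclidean_eqI)
      fix b :: 'a assume b: "b \<in> Basis"
      show "(LINT y|lborel. w y *\<^sub>R grad (moll r) (x - y)) \<bullet> b = mollify r W x \<bullet> b"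
        unfolding convolution_has_derivative(2)[OF iw(1) tm] weak_gradient_moll[OF G' r(1) b] mollify_def
        using integral_inner_left[OF iW, of b] by simp
    qed
  qed
  have C: "C11 (K * (LINT y|lborel. \<bar>w y\<bar>)) (mollify r w) (mollify r W)"
    using C11_convolution[OF iw(1) K N(2)] unfolding cw[symmetric] cW .
  have C': "C11 (K * (LINT y|lborel. \<bar>w y\<bar>)) (\<lambda>x. \<kappa> + mollify r w x) (mollify r W)"
    using C unfolding C11_def by simp
  have im: "integrable lborel (\<lambda>y. w y * moll r (x - y))" for x
    using integrable_moll_times[OF iw(1) r(1), of x] by (simp add: mult.commute)
  have cw0: "0 \<le> mollify r w x" for x
    unfolding cw
  proof (rule integral_nonneg_AE)
    show "AE y in lborel. 0 \<le> w y * moll r (x - y)"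
      using lower by eventually_elim (simp add: w_def \<xi>(2) moll_nonneg[OF r(1)])
  qed
  have cwb: "mollify r w x \<le> (LINT y|lborel. \<bar>w y\<bar>) * N" for x
  proof -
    have "mollify r w x \<le> (LINT y|lborel. \<bar>w y\<bar> * N)"
      unfolding cw
    proof (rule integral_mono[OF im])
      show "integrable lborel (\<lambda>y. \<bar>w y\<bar> * N)" using iw(1) by simp
      show "w y * moll r (x - y) \<le> \<bar>w y\<bar> * N" for y
        using abs_ge_self[of "w y * moll r (x - y)"] mult_left_mono[OF N(2)[of "x - y"] abs_ge_zero[of "w y"]]
        unfolding abs_mult by linarith
    qed
    then show ?thesis by simp
  qed
  note g1 = gauss_integral_le_lborel[OF d1(2)[OF r(1,2)] zero_le_power2]
  note g2 = gauss_integral_le_lborel[OF d2(2)[OF r(1,3)] zero_le_power2]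
  show thesis
  proof (rule that[OF C'])
    show "\<kappa> \<le> \<kappa> + mollify r w x" for x using cw0 by simp
    show "\<kappa> + mollify r w x \<le> \<kappa> + (LINT y|lborel. \<bar>w y\<bar>) * N" for x using cwb by simp
    have "(LINT x|gauss. (\<kappa> + mollify r w x - u x)\<^sup>2) \<le> (LINT x|gauss. 2 * (norm (mollify r w x - w x))\<^sup>2 + 2 * (\<xi> x * ?u x - ?u x)\<^sup>2)"
    proof (rule integral_mono_AE')
      show "integrable gauss (\<lambda>x. 2 * (norm (mollify r w x - w x))\<^sup>2 + 2 * (\<xi> x * ?u x - ?u x)\<^sup>2)"
        by (intro Bochner_Integration.integrable_add integrable_mult_right g1(1) A(1))
      show "AE x in gauss. (\<kappa> + mollify r w x - u x)\<^sup>2 \<le> 2 * (norm (mollify r w x - w x))\<^sup>2 + 2 * (\<xi> x * ?u x - ?u x)\<^sup>2"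
      proof (rule AE_I2)
        fix x
        have "\<kappa> + mollify r w x - u x = (mollify r w x - w x) + (\<xi> x * ?u x - ?u x)" by (simp add: w_def)
        then show "(\<kappa> + mollify r w x - u x)\<^sup>2 \<le> 2 * (norm (mollify r w x - w x))\<^sup>2 + 2 * (\<xi> x * ?u x - ?u x)\<^sup>2"
          using norm_add_square_le[of "mollify r w x - w x" "\<xi> x * ?u x - ?u x"]
          by (simp only: real_norm_def power2_abs)
      qed
    qed auto
    also have "\<dots> = 2 * (LINT x|gauss. (norm (mollify r w x - w x))\<^sup>2) + 2 * (LINT x|gauss. (\<xi> x * ?u x - ?u x)\<^sup>2)"
      using g1(1) A(1) by simp
    also have "\<dots> \<le> 2 * (e / 4) + 2 * (e / 4)"
      using g1(2) mult_left_mono[OF d1(3)[OF r(1,2)], of "gdens (0::'a)"] A(2) \<eta>(2) less_imp_le[OF gdens_pos[of "0::'a"]]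
      by (intro add_mono mult_left_mono) auto
    finally show "(LINT x|gauss. (\<kappa> + mollify r w x - u x)\<^sup>2) \<le> e" by simp
    have "(LINT x|gauss. (norm (mollify r W x - V x))\<^sup>2)
        \<le> (LINT x|gauss. 2 * (norm (mollify r W x - W x))\<^sup>2 + 2 * (norm (\<xi> x *\<^sub>R V x + ?u x *\<^sub>R grad \<xi> x - V x))\<^sup>2)"
    proof (rule integral_mono_AE')
      show "integrable gauss (\<lambda>x. 2 * (norm (mollify r W x - W x))\<^sup>2 + 2 * (norm (\<xi> x *\<^sub>R V x + ?u x *\<^sub>R grad \<xi> x - V x))\<^sup>2)"
        by (intro Bochner_Integration.integrable_add integrable_mult_right g2(1) B(1))
      show "AE x in gauss. (norm (mollify r W x - V x))\<^sup>2
          \<le> 2 * (norm (mollify r W x - W x))\<^sup>2 + 2 * (norm (\<xi> x *\<^sub>R V x + ?u x *\<^sub>R grad \<xi> x - V x))\<^sup>2"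
      proof (rule AE_I2)
        fix x
        show "(norm (mollify r W x - V x))\<^sup>2
          \<le> 2 * (norm (mollify r W x - W x))\<^sup>2 + 2 * (norm (\<xi> x *\<^sub>R V x + ?u x *\<^sub>R grad \<xi> x - V x))\<^sup>2"
          using norm_add_square_le[of "mollify r W x - W x" "W x - V x"] by (simp add: W_def)
      qed
    qed auto
    also have "\<dots> = 2 * (LINT x|gauss. (norm (mollify r W x - W x))\<^sup>2)
        + 2 * (LINT x|gauss. (norm (\<xi> x *\<^sub>R V x + ?u x *\<^sub>R grad \<xi> x - V x))\<^sup>2)"
      using g2(1) B(1) by simp
    also have "\<dots> \<le> 2 * (e / 4) + 2 * (e / 4)"
      using g2(2) mult_left_mono[OF d2(3)[OF r(1,3)], of "gdens (0::'a)"] B(2) \<eta>(2) less_imp_le[OF gdens_pos[of "0::'a"]]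
      by (intro add_mono mult_left_mono) auto
    finally show "(LINT x|gauss. (norm (mollify r W x - V x))\<^sup>2) \<le> e" by simp
  qed
qed

section \<open>Approximation with control of the deficit\<close>

lemma C11_square:
  assumes v: "C11 L v D" and b: "\<And>x. \<bar>v x\<bar> \<le> b"
  shows "C11 (2 * b * L + 2 * L\<^sup>2) (\<lambda>x. (v x)\<^sup>2) (\<lambda>x. (2 * v x) *\<^sub>R D x)"
  unfolding C11_def
proof (intro conjI allI)
  note c = C11D[OF v]
  have b0: "0 \<le> b" using order_trans[OF abs_ge_zero b] .
  fix x y h
  have l: "\<bar>2 * v x * z\<bar> \<le> 2 * b * \<bar>z\<bar>" for z
    unfolding abs_mult using b[of x] by (intro mult_right_mono) auto
  have "(v (x + h))\<^sup>2 - (v x)\<^sup>2 - ((2 * v x) *\<^sub>R D x) \<bullet> h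
      = 2 * v x * (v (x + h) - v x - D x \<bullet> h) + (v (x + h) - v x)\<^sup>2"
    by (simp add: power2_eq_square algebra_simps)
  also have "\<bar>\<dots>\<bar> \<le> \<bar>2 * v x * (v (x + h) - v x - D x \<bullet> h)\<bar> + \<bar>(v (x + h) - v x)\<^sup>2\<bar>"
    by (rule abs_triangle_ineq)
  also have "\<bar>2 * v x * (v (x + h) - v x - D x \<bullet> h)\<bar> \<le> 2 * b * (L * (norm h)\<^sup>2)"
    by (rule order_trans[OF l mult_left_mono[OF c(1)]]) (use b0 in simp)
  also have "\<bar>(v (x + h) - v x)\<^sup>2\<bar> \<le> (L * norm h)\<^sup>2"
    using power_mono[OF c(2)[of "x + h" x], of 2] by simp
  finally have le: "\<bar>(v (x + h))\<^sup>2 - (v x)\<^sup>2 - ((2 * v x) *\<^sub>R D x) \<bullet> h\<bar> \<le> 2 * b * (L * (norm h)\<^sup>2) + (L * norm h)\<^sup>2"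
    by simp
  show "\<bar>(v (x + h))\<^sup>2 - (v x)\<^sup>2 - ((2 * v x) *\<^sub>R D x) \<bullet> h\<bar> \<le> (2 * b * L + 2 * L\<^sup>2) * (norm h)\<^sup>2"
  proof -
    have "(2 * b * L + 2 * L\<^sup>2) * (norm h)\<^sup>2 = 2 * b * (L * (norm h)\<^sup>2) + (L * norm h)\<^sup>2 + (L * norm h)\<^sup>2"
      by (simp add: power_mult_distrib algebra_simps)
    then show ?thesis using le zero_le_power2[of "L * norm h"] by linarith
  qed
  have "(v x)\<^sup>2 - (v y)\<^sup>2 = (v x + v y) * (v x - v y)" by (simp add: power2_eq_square algebra_simps)
  also have "\<bar>\<dots>\<bar> \<le> (2 * b) * (L * norm (x - y))"
    unfolding abs_mult using b[of x] b[of y] c(2)[of x y] b0 by (intro mult_mono) auto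
  also have "\<dots> \<le> (2 * b * L + 2 * L\<^sup>2) * norm (x - y)" by (simp add: algebra_simps)
  finally show "\<bar>(v x)\<^sup>2 - (v y)\<^sup>2\<bar> \<le> (2 * b * L + 2 * L\<^sup>2) * norm (x - y)" .
  have "norm ((2 * v x) *\<^sub>R D x) \<le> (2 * b) * L"
    using b[of x] c(3)[of x] b0 by (simp add: abs_mult mult_mono)
  then show "norm ((2 * v x) *\<^sub>R D x) \<le> 2 * b * L + 2 * L\<^sup>2" using zero_le_power2[of L] by linarith
  have "(2 * v x) *\<^sub>R D x - (2 * v y) *\<^sub>R D y = (2 * v x) *\<^sub>R (D x - D y) + (2 * (v x - v y)) *\<^sub>R D y"
    by (simp add: algebra_simps)
  also have "norm \<dots> \<le> norm ((2 * v x) *\<^sub>R (D x - D y)) + norm ((2 * (v x - v y)) *\<^sub>R D y)"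
    by (rule norm_triangle_ineq)
  also have "norm ((2 * v x) *\<^sub>R (D x - D y)) \<le> (2 * b) * (L * norm (x - y))"
    using b[of x] c(4)[of x y] b0 by (simp add: abs_mult mult_mono)
  also have "norm ((2 * (v x - v y)) *\<^sub>R D y) \<le> (2 * (L * norm (x - y))) * L"
    unfolding norm_scaleR using c(2)[of x y] c(3)[of y] c(5) by (intro mult_mono) (auto simp: abs_mult)
  finally show "norm ((2 * v x) *\<^sub>R D x - (2 * v y) *\<^sub>R D y) \<le> (2 * b * L + 2 * L\<^sup>2) * norm (x - y)"
    by (simp add: algebra_simps power2_eq_square)
qed

lemma gavg_1_0: "gavg 1 \<phi> 0 = (LINT y|gauss. \<phi> y)"
  by (simp add: gavg_def)

lemma xlnx_ge: "x > 0 \<Longrightarrow> -1 \<le> x * ln (x::real)"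
  using xlnx_supporting[of x 1] by simp

text \<open>Lower semicontinuity of the relative entropy: Fatou's lemma for \<open>r ln r + 1 \<ge> 0\<close>. The integrability of
  the limit is part of the conclusion, because the Bochner integral that defines the entropy is \<open>0\<close> for
  functions that are not integrable.\<close>

lemma entropy_fatou:
  fixes F :: "nat \<Rightarrow> 'a::euclidean_space \<Rightarrow> real"
  assumes [measurable]: "\<And>n. F n \<in> borel_measurable borel" "f \<in> borel_measurable borel"
    and F: "\<And>n x. 0 < F n x" and f: "AE x in gauss. 0 < f x"
    and lim: "AE x in gauss. (\<lambda>n. F n x) \<longlonglongrightarrow> f x"
    and i: "\<And>n. integrable gauss (\<lambda>x. F n x * ln (F n x))"
    and le: "\<forall>\<^sub>F n in sequentially. (LINT x|gauss. F n x * ln (F n x)) \<le> c"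
  shows "integrable gauss (\<lambda>x. f x * ln (f x))" and "(LINT x|gauss. f x * ln (f x)) \<le> c"
proof -
  have nn: "(\<integral>\<^sup>+x. ennreal (F n x * ln (F n x) + 1) \<partial>gauss) = ennreal ((LINT x|gauss. F n x * ln (F n x)) + 1)" for n
  proof -
    have "(\<integral>\<^sup>+x. ennreal (F n x * ln (F n x) + 1) \<partial>gauss) = ennreal (LINT x|gauss. F n x * ln (F n x) + 1)"
    proof (rule nn_integral_eq_integral)
      show "integrable gauss (\<lambda>x. F n x * ln (F n x) + 1)" using i[of n] by simp
      have "0 \<le> F n x * ln (F n x) + 1" for x using xlnx_ge[OF F[of n x]] by linarith
      then show "AE x in gauss. 0 \<le> F n x * ln (F n x) + 1" by (intro AE_I2)
    qed
    then show ?thesis using i[of n] by (simp add: gauss.prob_space[simplified])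
  qed
  have "(\<integral>\<^sup>+x. ennreal (f x * ln (f x) + 1) \<partial>gauss) = (\<integral>\<^sup>+x. liminf (\<lambda>n. ennreal (F n x * ln (F n x) + 1)) \<partial>gauss)"
  proof (rule nn_integral_cong_AE)
    show "AE x in gauss. ennreal (f x * ln (f x) + 1) = liminf (\<lambda>n. ennreal (F n x * ln (F n x) + 1))"
      using f lim
    proof eventually_elim
      case (elim x)
      have "(\<lambda>n. F n x * ln (F n x) + 1) \<longlonglongrightarrow> f x * ln (f x) + 1"
        using elim by (intro tendsto_intros) auto
      then have "(\<lambda>n. ennreal (F n x * ln (F n x) + 1)) \<longlonglongrightarrow> ennreal (f x * ln (f x) + 1)" by (rule tendsto_ennrealI)
      then show ?case by (rule lim_imp_Liminf[OF sequentially_bot, symmetric])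
    qed
  qed
  also have "\<dots> \<le> liminf (\<lambda>n. \<integral>\<^sup>+x. ennreal (F n x * ln (F n x) + 1) \<partial>gauss)"
    by (rule nn_integral_liminf) measurable
  also have "\<dots> \<le> ennreal (c + 1)"
  proof (rule Liminf_le)
    show "\<forall>\<^sub>F n in sequentially. (\<integral>\<^sup>+x. ennreal (F n x * ln (F n x) + 1) \<partial>gauss) \<le> ennreal (c + 1)"
      using le by eventually_elim (simp add: nn ennreal_leI)
  qed simp
  finally have fin: "(\<integral>\<^sup>+x. ennreal (f x * ln (f x) + 1) \<partial>gauss) \<le> ennreal (c + 1)" .
  have f1: "AE x in gauss. 0 \<le> f x * ln (f x) + 1" using f by eventually_elim (use xlnx_ge in force)
  have i1: "integrable gauss (\<lambda>x. f x * ln (f x) + 1)"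
    using f1 fin by (intro integrableI_nonneg) (auto intro: le_less_trans)
  from Bochner_Integration.integrable_diff[OF i1, of "\<lambda>x. 1"]
  show i2: "integrable gauss (\<lambda>x. f x * ln (f x))" by simp
  have "0 \<le> c + 1"
  proof -
    obtain n where "(LINT x|gauss. F n x * ln (F n x)) \<le> c" using eventually_happens'[OF sequentially_bot le] by blast
    moreover have "(LINT x|(gauss :: 'a measure). -1) \<le> (LINT x|gauss. F n x * ln (F n x))"
      using i xlnx_ge[OF F] by (intro integral_mono) auto
    ultimately show ?thesis by (simp add: gauss.prob_space[simplified])
  qed
  then have "(LINT x|gauss. f x * ln (f x) + 1) \<le> c + 1"
    using fin f1 by (subst integral_eq_nn_integral) (auto intro!: enn2real_leI)
  then show "(LINT x|gauss. f x * ln (f x)) \<le> c" using i2 by (simp add: gauss.prob_space[simplified])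
qed

text \<open>The mixed term in \<open>|A|\<^sup>2 - |B|\<^sup>2 = |A - B|\<^sup>2 + 2 B \<bullet> (A - B)\<close> is split by a weighted inequality. With \<open>\<eta>\<close> as
  the weight, both parts are of order \<open>\<eta>\<close>.\<close>

lemma integral_square_perturb:
  fixes A B :: "'a::euclidean_space \<Rightarrow> 'b::euclidean_space"
  assumes [measurable]: "A \<in> borel_measurable borel" "B \<in> borel_measurable borel"
    and i: "integrable gauss (\<lambda>x. (norm (B x))\<^sup>2)" "integrable gauss (\<lambda>x. (norm (A x - B x))\<^sup>2)"
    and le: "(LINT x|gauss. (norm (A x - B x))\<^sup>2) \<le> \<eta>\<^sup>2" and \<eta>: "\<eta> > 0"
  shows "(LINT x|gauss. \<bar>(norm (A x))\<^sup>2 - (norm (B x))\<^sup>2\<bar>) \<le> \<eta>\<^sup>2 + 2 * \<eta> + 2 * \<eta> * (LINT x|gauss. (norm (B x))\<^sup>2)"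
proof -
  have pt: "\<bar>(norm (A x))\<^sup>2 - (norm (B x))\<^sup>2\<bar> \<le> (norm (A x - B x))\<^sup>2 + 2 * (\<eta> * (norm (B x))\<^sup>2 + (norm (A x - B x))\<^sup>2 / \<eta>)" for x
  proof -
    have "(norm (A x))\<^sup>2 - (norm (B x))\<^sup>2 = (norm (A x - B x))\<^sup>2 + 2 * (B x \<bullet> (A x - B x))"
      by (simp add: power2_norm_eq_inner inner_simps inner_commute)
    moreover have "\<bar>B x \<bullet> (A x - B x)\<bar> \<le> \<bar>norm (B x) * norm (A x - B x)\<bar>"
      using Cauchy_Schwarz_ineq2[of "B x" "A x - B x"] by simp
    moreover have "\<bar>norm (B x) * norm (A x - B x)\<bar> \<le> \<eta> * (norm (B x))\<^sup>2 + (norm (A x - B x))\<^sup>2 / \<eta>"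
      by (rule mult_le_weighted_squares[OF \<eta>])
    moreover have "\<bar>a - b\<bar> \<le> d + 2 * z" if "a - b = d + 2 * i" "\<bar>i\<bar> \<le> \<bar>p\<bar>" "\<bar>p\<bar> \<le> z" "0 \<le> d"
      for a b d i p z :: real using that by linarith
    ultimately show ?thesis using zero_le_power2 by blast
  qed
  have "(LINT x|gauss. \<bar>(norm (A x))\<^sup>2 - (norm (B x))\<^sup>2\<bar>)
      \<le> (LINT x|gauss. (norm (A x - B x))\<^sup>2 + 2 * (\<eta> * (norm (B x))\<^sup>2 + (norm (A x - B x))\<^sup>2 / \<eta>))"
  proof (rule integral_mono_AE')
    show "integrable gauss (\<lambda>x. (norm (A x - B x))\<^sup>2 + 2 * (\<eta> * (norm (B x))\<^sup>2 + (norm (A x - B x))\<^sup>2 / \<eta>))"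
      using i by auto
    show "AE x in gauss. 0 \<le> (norm (A x - B x))\<^sup>2 + 2 * (\<eta> * (norm (B x))\<^sup>2 + (norm (A x - B x))\<^sup>2 / \<eta>)"
      by (rule AE_I2) (rule order_trans[OF abs_ge_zero pt])
  qed (intro AE_I2 pt)
  also have "\<dots> = (LINT x|gauss. (norm (A x - B x))\<^sup>2) + 2 * (\<eta> * (LINT x|gauss. (norm (B x))\<^sup>2) + (LINT x|gauss. (norm (A x - B x))\<^sup>2) / \<eta>)"
    using i by simp
  also have "\<dots> \<le> \<eta>\<^sup>2 + 2 * (\<eta> * (LINT x|gauss. (norm (B x))\<^sup>2) + \<eta>\<^sup>2 / \<eta>)"
    using le \<eta> by (intro add_mono mult_left_mono divide_right_mono) auto
  also have "\<dots> = \<eta>\<^sup>2 + 2 * \<eta> + 2 * \<eta> * (LINT x|gauss. (norm (B x))\<^sup>2)"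
    using \<eta> by (simp add: power2_eq_square algebra_simps)
  finally show ?thesis .
qed

text \<open>By the chain rule \<open>2 \<surd>f V\<close> is a weak gradient of \<open>f\<close>, and weak gradients are unique up to null sets,
  so the one selected by \<open>weak_gradient\<close> agrees with it almost everywhere.\<close>

lemma fisher_information_eq:
  fixes f :: "'a::euclidean_space \<Rightarrow> real"
  assumes f[measurable]: "f \<in> borel_measurable borel" and fpos: "AE x in lborel. 0 < f x"
    and V[measurable]: "V \<in> borel_measurable borel"
    and G: "has_weak_gradient (\<lambda>x. sqrt (f x)) V"
    and u2: "integrable gauss (\<lambda>x. (sqrt (f x))\<^sup>2)" and V2: "integrable gauss (\<lambda>x. (norm (V x))\<^sup>2)"
  shows "fisher_information f = 4 * (LINT x|gauss. (norm (V x))\<^sup>2)"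
proof -
  have "has_weak_gradient (\<lambda>x. (sqrt (f x))\<^sup>2) (\<lambda>x. (2 * sqrt (f x)) *\<^sub>R V x)"
    by (rule has_weak_gradient_square[OF _ V G gauss_integrable_imp_locally_integrable[OF _ u2]
          gauss_integrable_imp_locally_integrable[OF _ V2]]) measurable
  then have w: "has_weak_gradient f (\<lambda>x. (2 * sqrt (f x)) *\<^sub>R V x)"
    by (rule has_weak_gradient_cong_AE) (use fpos in auto)
  then have W: "has_weak_gradient f (weak_gradient f)" unfolding weak_gradient_def by (rule someI[of "has_weak_gradient f"])
  note [measurable] = locally_integrable_measurable[OF has_weak_gradientD(2)[OF W]]
  have ae: "AE x in gauss. (norm (weak_gradient f x))\<^sup>2 / f x = 4 * (norm (V x))\<^sup>2"
    unfolding AE_gauss_iff using weak_gradient_unique[OF W w] fpos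
  proof eventually_elim
    case (elim x)
    then show ?case by (simp add: power_mult_distrib)
  qed
  have "fisher_information f = (LINT x|gauss. 4 * (norm (V x))\<^sup>2)"
    unfolding fisher_information_def by (rule integral_cong_AE) (use ae in auto)
  then show ?thesis by simp
qed

text \<open>The square of a \<open>W\<^sup>1\<^sup>,\<^sup>2\<close> approximant of \<open>\<surd>f\<close>. Fisher informations converge up to a small error, and by lower
  semicontinuity the entropies of the approximants are not much smaller than that of \<open>f\<close> infinitely
  often, so that the deficit of some approximant exceeds that of \<open>f\<close> only slightly.\<close>

theorem C11_approximation:
  fixes f :: "'a::euclidean_space \<Rightarrow> real"
  assumes f[measurable]: "f \<in> borel_measurable borel" and lower: "AE x in gauss. \<alpha> \<le> f x" and \<alpha>: "0 < \<alpha>"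
    and intf: "integrable gauss f" "(LINT x|gauss. f x) = 1"
    and W: "(\<lambda>x. sqrt (f x)) \<in> W12_gauss" and e: "e > 0"
  obtains F D L \<beta> where "C11 L F D" "\<And>x. \<alpha> \<le> F x" "\<And>x. F x \<le> \<beta>"
    "C11_deficit F D \<le> deficit f + e" "(LINT x|gauss. \<bar>F x - f x\<bar>) \<le> e" "gavg 1 F 0 \<le> 2"
proof -
  let ?u = "\<lambda>x. sqrt (f x)" and ?\<kappa> = "sqrt \<alpha>"
  obtain V where V[measurable]: "V \<in> borel_measurable borel" and G: "has_weak_gradient ?u V"
    and u2: "integrable gauss (\<lambda>x. (?u x)\<^sup>2)" and V2: "integrable gauss (\<lambda>x. (norm (V x))\<^sup>2)"
    using W unfolding W12_gauss_def by blast
  have lo: "AE x in lborel. ?\<kappa> \<le> ?u x" using lower unfolding AE_gauss_iff by eventually_elim simp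
  have fpos: "AE x in gauss. 0 < f x" using lower by eventually_elim (use \<alpha> in simp)
  define I where "I = (LINT x|gauss. (norm (V x))\<^sup>2)"
  have fisher: "fisher_information f = 4 * I"
    unfolding I_def by (rule fisher_information_eq[OF f fpos[unfolded AE_gauss_iff] V G u2 V2])
  define \<eta> where "\<eta> = (\<lambda>n. inverse (real (Suc n)))"
  have \<eta>: "\<eta> n > 0" for n by (simp add: \<eta>_def)
  have \<eta>0: "\<eta> \<longlonglongrightarrow> 0" unfolding \<eta>_def by (rule LIMSEQ_inverse_real_of_nat)
  define P where "P = (\<lambda>n v D L \<beta>. C11 L v D \<and> (\<forall>x. ?\<kappa> \<le> v x) \<and> (\<forall>x. v x \<le> \<beta>)
    \<and> (LINT x|gauss. (v x - ?u x)\<^sup>2) \<le> (\<eta> n)\<^sup>2 \<and> (LINT x|gauss. (norm (D x - V x))\<^sup>2) \<le> (\<eta> n)\<^sup>2)"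
  have "\<exists>v D L \<beta>. P n v D L \<beta>" for n
  proof -
    have um: "?u \<in> borel_measurable borel" by measurable
    have "0 < (\<eta> n)\<^sup>2" using \<eta>[of n] by simp
    then show ?thesis by (rule C11_dense_W12[OF um V G u2 V2 lo]) (unfold P_def, blast)
  qed
  then obtain v D L \<beta> where "\<And>n. P n (v n) (D n) (L n) (\<beta> n)" by metis
  then have C: "\<And>n. C11 (L n) (v n) (D n)" and vlo: "\<And>n x. ?\<kappa> \<le> v n x" and vup: "\<And>n x. v n x \<le> \<beta> n"
    and v2: "\<And>n. (LINT x|gauss. (v n x - ?u x)\<^sup>2) \<le> (\<eta> n)\<^sup>2"
    and D2: "\<And>n. (LINT x|gauss. (norm (D n x - V x))\<^sup>2) \<le> (\<eta> n)\<^sup>2"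
    unfolding P_def by blast+
  note [measurable] = C11_measurable[OF C]
  have vpos: "0 < v n x" for n x using vlo[of n x] \<alpha> by (auto intro: less_le_trans[of 0 ?\<kappa>])
  have vb: "\<bar>v n x\<bar> \<le> \<beta> n" for n x using vup[of n x] vpos[of n x] by simp
  define F where "F = (\<lambda>n x. (v n x)\<^sup>2)"
  define E where "E = (\<lambda>n x. (2 * v n x) *\<^sub>R D n x)"
  have CF: "C11 (2 * \<beta> n * L n + 2 * (L n)\<^sup>2) (F n) (E n)" for n
    unfolding F_def E_def by (rule C11_square[OF C vb])
  have Flo: "\<alpha> \<le> F n x" for n x
    using power_mono[OF vlo[of n x], of 2] \<alpha> by (simp add: F_def)
  have Fup: "F n x \<le> (\<beta> n)\<^sup>2" for n x using power_mono[OF vb, of n x 2] by (simp add: F_def)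
  have Fpos: "0 < F n x" for n x using vpos[of n x] by (simp add: F_def)
  have Fm[measurable]: "F n \<in> borel_measurable borel" for n unfolding F_def by measurable
  have iF: "integrable gauss (F n)" for n
    using quad_growth_integrable[OF C11_quad_growth(1)[OF CF[of n]], of 0 1] by simp
  have en: "(norm (E n x))\<^sup>2 / F n x = 4 * (norm (D n x))\<^sup>2" for n x
    using vpos[of n x] by (simp add: E_def F_def power_mult_distrib)
  have iv: "integrable gauss (\<lambda>x. (norm (v n x - ?u x))\<^sup>2)" for n
  proof (rule Bochner_Integration.integrable_bound[of _ "\<lambda>x. 2 * F n x + 2 * (?u x)\<^sup>2"])
    show "integrable gauss (\<lambda>x. 2 * F n x + 2 * (?u x)\<^sup>2)" using iF u2 by (intro Bochner_Integration.integrable_add integrable_mult_right)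
    show "AE x in gauss. norm ((norm (v n x - ?u x))\<^sup>2) \<le> norm (2 * F n x + 2 * (?u x)\<^sup>2)"
    proof (rule AE_I2)
      fix x
      show "norm ((norm (v n x - ?u x))\<^sup>2) \<le> norm (2 * F n x + 2 * (?u x)\<^sup>2)"
        using norm_add_square_le[of "v n x" "- ?u x"] by (simp add: F_def)
    qed
  qed measurable
  have iDn: "integrable gauss (\<lambda>x. (norm (D n x))\<^sup>2)" for n
    using quad_growth_integrable[OF C11_quad_growth(3)[OF C[of n]], of 0 1] by simp
  have iD: "integrable gauss (\<lambda>x. (norm (D n x - V x))\<^sup>2)" for n
  proof (rule Bochner_Integration.integrable_bound[of _ "\<lambda>x. 2 * (norm (D n x))\<^sup>2 + 2 * (norm (V x))\<^sup>2"])
    show "integrable gauss (\<lambda>x. 2 * (norm (D n x))\<^sup>2 + 2 * (norm (V x))\<^sup>2)"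
      using iDn V2 by (intro Bochner_Integration.integrable_add integrable_mult_right)
    show "AE x in gauss. norm ((norm (D n x - V x))\<^sup>2) \<le> norm (2 * (norm (D n x))\<^sup>2 + 2 * (norm (V x))\<^sup>2)"
    proof (rule AE_I2)
      fix x
      show "norm ((norm (D n x - V x))\<^sup>2) \<le> norm (2 * (norm (D n x))\<^sup>2 + 2 * (norm (V x))\<^sup>2)"
        using norm_add_square_le[of "D n x" "- V x"] by simp
    qed
  qed measurable
  have uu: "(LINT x|gauss. (norm (?u x))\<^sup>2) = 1"
  proof -
    have "(LINT x|gauss. (norm (?u x))\<^sup>2) = (LINT x|gauss. f x)"
      by (rule integral_cong_AE) (use fpos in auto)
    then show ?thesis using intf by simp
  qed
  have L1: "(LINT x|gauss. \<bar>F n x - f x\<bar>) \<le> (\<eta> n)\<^sup>2 + 4 * \<eta> n" for n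
  proof -
    have "(LINT x|gauss. \<bar>F n x - f x\<bar>) = (LINT x|gauss. \<bar>(norm (v n x))\<^sup>2 - (norm (?u x))\<^sup>2\<bar>)"
      by (rule integral_cong_AE) (use fpos in \<open>auto simp: F_def\<close>)
    also have "\<dots> \<le> (\<eta> n)\<^sup>2 + 2 * \<eta> n + 2 * \<eta> n * (LINT x|gauss. (norm (?u x))\<^sup>2)"
      by (rule integral_square_perturb[OF _ _ _ iv _ \<eta>]) (use u2 v2 in auto)
    finally show ?thesis unfolding uu by simp
  qed
  have DI: "(LINT x|gauss. (norm (D n x))\<^sup>2) \<le> I + ((\<eta> n)\<^sup>2 + 2 * \<eta> n + 2 * \<eta> n * I)" for n
  proof -
    have "(LINT x|gauss. (norm (D n x))\<^sup>2) - I = (LINT x|gauss. (norm (D n x))\<^sup>2 - (norm (V x))\<^sup>2)"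
      using iDn V2 by (simp add: I_def)
    also have "\<dots> \<le> (LINT x|gauss. \<bar>(norm (D n x))\<^sup>2 - (norm (V x))\<^sup>2\<bar>)"
      using iDn V2 by (intro integral_mono) auto
    also have "\<dots> \<le> (\<eta> n)\<^sup>2 + 2 * \<eta> n + 2 * \<eta> n * I"
      unfolding I_def by (rule integral_square_perturb[OF _ V V2 iD D2 \<eta>]) measurable
    finally show ?thesis by simp
  qed
  have lim1: "(\<lambda>n. (\<eta> n)\<^sup>2 + 4 * \<eta> n) \<longlonglongrightarrow> 0"
    using tendsto_add[OF tendsto_power[OF \<eta>0, of 2] tendsto_mult[OF tendsto_const \<eta>0, of 4]] by simp
  have limL1: "(\<lambda>n. LINT x|gauss. \<bar>F n x - f x\<bar>) \<longlonglongrightarrow> 0"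
    by (rule tendsto_sandwich[OF _ _ tendsto_const lim1]) (auto intro!: always_eventually L1 integral_nonneg_AE)
  have iFf: "integrable gauss (\<lambda>x. F n x - f x)" for n by (intro Bochner_Integration.integrable_diff iF intf)
  have "(\<lambda>n. LINT x|gauss. norm (F n x - f x)) \<longlonglongrightarrow> 0" using limL1 by simp
  from tendsto_L1_AE_subseq[OF iFf this] obtain r where r: "strict_mono r"
    "AE x in gauss. (\<lambda>n. F (r n) x - f x) \<longlonglongrightarrow> 0" by auto
  have aeF: "AE x in gauss. (\<lambda>n. F (r n) x) \<longlonglongrightarrow> f x"
    using r(2) by eventually_elim (simp add: LIM_zero_iff)
  have sub: "(\<lambda>n. X (r n)) \<longlonglongrightarrow> l" if "X \<longlonglongrightarrow> l" for X :: "nat \<Rightarrow> real" and l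
    using LIMSEQ_subseq_LIMSEQ[OF that r(1)] by (simp add: o_def)
  define m where "m = (\<lambda>n. LINT x|gauss. F n x)"
  have m1: "m \<longlonglongrightarrow> 1"
  proof (rule LIM_zero_cancel, rule tendsto_rabs_zero_cancel, rule tendsto_sandwich[OF _ _ tendsto_const limL1])
    show "\<forall>\<^sub>F n in sequentially. \<bar>m n - 1\<bar> \<le> (LINT x|gauss. \<bar>F n x - f x\<bar>)"
    proof (rule always_eventually, rule allI)
      fix n
      have "m n - 1 = (LINT x|gauss. F n x - f x)" using iF intf by (simp add: m_def)
      then show "\<bar>m n - 1\<bar> \<le> (LINT x|gauss. \<bar>F n x - f x\<bar>)" using integral_abs_bound[of gauss "\<lambda>x. F n x - f x"] by simp
    qed
  qed simp
  have lm: "(\<lambda>n. m n * ln (m n)) \<longlonglongrightarrow> 0"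
    using tendsto_mult[OF m1 tendsto_ln[OF m1]] by simp
  define a where "a = (\<lambda>n. LINT x|gauss. F n x * ln (F n x))"
  note LS = log_sobolev_C11[OF CF Flo Fup \<alpha> zero_less_one]
  have ia: "integrable gauss (\<lambda>x. F n x * ln (F n x))" for n
    using quad_growth_integrable[OF LS(1)[of n], of 0 1] by simp
  define J where "J = (\<lambda>n. LINT x|gauss. (norm (D n x))\<^sup>2)"
  have gE: "gavg 1 (\<lambda>x. (norm (E n x))\<^sup>2 / F n x) 0 = 4 * J n" for n
    unfolding gavg_1_0 en J_def by simp
  have lJ: "(\<lambda>n. (\<eta> n)\<^sup>2 + 2 * \<eta> n + 2 * \<eta> n * I) \<longlonglongrightarrow> 0"
    using tendsto_add[OF tendsto_add[OF tendsto_power[OF \<eta>0, of 2] tendsto_mult[OF tendsto_const \<eta>0, of 2]]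
        tendsto_mult[OF tendsto_mult[OF tendsto_const \<eta>0, of 2] tendsto_const, of I]] by simp
  have evJ: "\<forall>\<^sub>F n in sequentially. J n \<le> I + s" if "s > 0" for s
    using order_tendstoD(2)[OF lJ that] 
  proof eventually_elim
    case (elim n)
    then show ?case using DI[of n] unfolding J_def by linarith
  qed
  have evm: "\<forall>\<^sub>F n in sequentially. m n * ln (m n) < s" if "s > 0" for s
    using order_tendstoD(2)[OF lm that] .
  \<comment> \<open>if the entropies stayed below this level, so would their lower limit, contradicting lower semicontinuity\<close>
  have freq: "\<exists>\<^sub>F n in sequentially. relative_entropy f - s < a (r n)" if s: "s > 0" for s
  proof (rule ccontr)
    assume "\<not> (\<exists>\<^sub>F n in sequentially. relative_entropy f - s < a (r n))"
    then have ev: "\<forall>\<^sub>F n in sequentially. a (r n) \<le> relative_entropy f - s" by (simp add: frequently_def not_less)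
    have "(LINT x|gauss. f x * ln (f x)) \<le> relative_entropy f - s"
      by (rule entropy_fatou(2)[where F="\<lambda>n. F (r n)", OF _ f Fpos fpos aeF ia]) (use ev in \<open>auto simp: a_def\<close>)
    then show False using s by (simp add: relative_entropy_def)
  qed
  have e4: "e / 4 > 0" using e by simp
  have two: "(1::real) < 2" by simp
  have ev: "\<forall>\<^sub>F n in sequentially. J (r n) \<le> I + e / 4 \<and> m (r n) * ln (m (r n)) < e / 4
      \<and> (LINT x|gauss. \<bar>F (r n) x - f x\<bar>) < e \<and> m (r n) < 2"
    by (intro eventually_conj eventually_subseq[OF r(1), of "\<lambda>n. J n \<le> I + e / 4"]
        eventually_subseq[OF r(1), of "\<lambda>n. m n * ln (m n) < e / 4"]
        eventually_subseq[OF r(1), of "\<lambda>n. (LINT x|gauss. \<bar>F n x - f x\<bar>) < e"]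
        eventually_subseq[OF r(1), of "\<lambda>n. m n < 2"]
        evJ[OF e4] evm[OF e4] order_tendstoD(2)[OF limL1 e] order_tendstoD(2)[OF m1 two])
  obtain n where n: "relative_entropy f - e / 4 < a (r n)" "J (r n) \<le> I + e / 4" "m (r n) * ln (m (r n)) < e / 4"
    "(LINT x|gauss. \<bar>F (r n) x - f x\<bar>) < e" "m (r n) < 2"
    using frequently_ex[OF frequently_eventually_frequently[OF freq[OF e4] ev]] by blast
  show thesis
  proof (rule that[OF CF[of "r n"]])
    show "\<alpha> \<le> F (r n) x" "F (r n) x \<le> (\<beta> (r n))\<^sup>2" for x by (rule Flo, rule Fup)
    have "C11_deficit (F (r n)) (E (r n)) = 2 * J (r n) - (a (r n) - m (r n) * ln (m (r n)))"
      unfolding C11_deficit_def gE by (simp add: gavg_1_0 a_def m_def)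
    then show "C11_deficit (F (r n)) (E (r n)) \<le> deficit f + e"
      using n unfolding deficit_def fisher by linarith
    show "(LINT x|gauss. \<bar>F (r n) x - f x\<bar>) \<le> e" using n by simp
    show "gavg 1 (F (r n)) 0 \<le> 2" using n by (simp add: gavg_1_0 m_def)
  qed
qed

text \<open>Each \<open>f k\<close> is replaced by a \<open>C11\<close> function with an error of \<open>1 / (k + 1)\<close> in deficit and in \<open>L\<^sup>1\<close>, and
  the result for sequences of \<open>C11\<close> functions applies.\<close>

theorem corollary1p8:
  fixes \<alpha> :: real and g :: "real ^ 'n \<Rightarrow> real" and f :: "nat \<Rightarrow> real ^ 'n \<Rightarrow> real"
  assumes "0 < \<alpha>" and "\<alpha> \<le> 1"
    and "integrable gauss g"
    and "\<And>k. f k \<in> borel_measurable borel"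
    and "\<And>k. AE x in gauss. \<alpha> \<le> f k x \<and> f k x \<le> g x"
    and "\<And>k. prob_space (density gauss (\<lambda>x. ennreal (f k x)))"
    and "\<And>k. centered (density gauss (\<lambda>x. ennreal (f k x)))"
    and "\<And>k. (\<lambda>x. sqrt (f k x)) \<in> W12_gauss"
    and "(\<lambda>k. deficit (f k)) \<longlonglongrightarrow> 0"
  shows "(\<lambda>k. LINT x|gauss. \<bar>f k x - 1\<bar>) \<longlonglongrightarrow> 0"
proof -
  note [measurable] = assms(4)
  have lo: "AE x in gauss. \<alpha> \<le> f k x" and nn: "AE x in gauss. 0 \<le> f k x" and ab: "AE x in gauss. \<bar>f k x\<bar> \<le> g x" for k
    using assms(5)[of k] assms(1) by (auto elim: eventually_mono)
  have i: "integrable gauss (f k)" for k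
  proof (rule Bochner_Integration.integrable_bound[OF assms(3)])
    show "AE x in gauss. norm (f k x) \<le> norm (g x)" using ab[of k] by eventually_elim simp
  qed measurable
  have int1: "(LINT x|gauss. f k x) = 1" for k
  proof -
    have "(\<integral>\<^sup>+x. ennreal (f k x) \<partial>gauss) = 1"
      using prob_space.emeasure_space_1[OF assms(6)[of k]] by (simp add: emeasure_density)
    then show ?thesis using nn by (subst integral_eq_nn_integral) auto
  qed
  define \<eta> where "\<eta> = (\<lambda>k. inverse (real (Suc k)))"
  have \<eta>: "\<eta> k > 0" for k by (simp add: \<eta>_def)
  have \<eta>0: "\<eta> \<longlonglongrightarrow> 0" unfolding \<eta>_def by (rule LIMSEQ_inverse_real_of_nat)
  define P where "P = (\<lambda>k F D L \<beta>. C11 L F D \<and> (\<forall>x. \<alpha> \<le> F x) \<and> (\<forall>x. F x \<le> \<beta>)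
    \<and> C11_deficit F D \<le> deficit (f k) + \<eta> k \<and> (LINT x|gauss. \<bar>F x - f k x\<bar>) \<le> \<eta> k \<and> gavg 1 F 0 \<le> 2)"
  have "\<exists>F D L \<beta>. P k F D L \<beta>" for k
    by (rule C11_approximation[OF assms(4) lo assms(1) i int1 assms(8) \<eta>[of k]]) (unfold P_def, blast)
  then obtain F D L \<beta> where "\<And>k. P k (F k) (D k) (L k) (\<beta> k)" by metis
  then have F: "\<And>k. C11 (L k) (F k) (D k)" "\<And>k x. \<alpha> \<le> F k x" "\<And>k x. F k x \<le> \<beta> k"
    and d: "\<And>k. C11_deficit (F k) (D k) \<le> deficit (f k) + \<eta> k"
    and c: "\<And>k. (LINT x|gauss. \<bar>F k x - f k x\<bar>) \<le> \<eta> k" and m: "\<And>k. gavg 1 (F k) 0 \<le> 2"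
    unfolding P_def by blast+
  show ?thesis
  proof (rule dominated_tendsto_1[OF F assms(1), where e="\<lambda>k. \<bar>deficit (f k)\<bar> + \<eta> k" and g=g])
    show "C11_deficit (F k) (D k) \<le> \<bar>deficit (f k)\<bar> + \<eta> k" for k using d[of k] by linarith
    show "0 < \<bar>deficit (f k)\<bar> + \<eta> k" for k using \<eta>[of k] by linarith
    show "(\<lambda>k. \<bar>deficit (f k)\<bar> + \<eta> k) \<longlonglongrightarrow> 0"
      using tendsto_add[OF tendsto_rabs[OF assms(9)] \<eta>0] by simp
    show "(LINT x|gauss. \<bar>F k x - f k x\<bar>) \<le> \<bar>deficit (f k)\<bar> + \<eta> k" for k using c[of k] by linarith
  qed (use m assms(3,4) ab int1 in auto)
qed

end
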